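(* Let $n\ge2$, let $H\in\mathsf{SegPs}[\Delta^{{n-1}^{op}},\mathsf{Cat}]$ be a Segalic pseudo-functor and let $L\in\mathsf{Cat}^n$ be an $n$-fold category such that there is an equivalence of categories $(J_nL)_{\underline{k}}\simeq H_{\underline{k}}$ for all $\underline{k}\in\Delta^{{n-1}^{op}}$. Then: (a) $L\in\mathsf{Cat}^n_{wg}$. (b) If, further, $H_{\underline{k}}\in\mathsf{Cat}_{hd}$ for all $\underline{k}$ and $p^{(n)}H\in\mathsf{Cat}^{n-1}_{hd}$, then $L\in\mathsf{Cat}^n_{hd}$.
   Context: **$n$-fold categories.** $\Delta$ is the simplicial category and $\Delta^{n^{op}}$ the product of $n$ copies of $\Delta^{op}$. $\mathsf{Cat}$ is the category of small categories. Put $\mathsf{Cat}^1=\mathsf{Cat}$ and $\mathsf{Cat}^n=\mathsf{Cat}(\mathsf{Cat}^{n-1})$ (internal categories and internal functors) for $n>1$; its objects are $n$-fold categories. Iterating the nerve gives fully faithful functors: the multinerve $N_{(n)}:\mathsf{Cat}^n\to[\Delta^{n^{op}},\mathsf{Set}]$, and $J_n:\mathsf{Cat}^n\to[\Delta^{{n-1}^{op}},\mathsf{Cat}]$ (nerve in all directions but the last). Images of these functors are taken up to isomorphism. For $X\in\mathsf{Cat}^n$, $X_s\in\mathsf{Cat}^{n-1}$ ($s\ge 0$) is the value in degree $s$ of the nerve in the first direction, and $X_{s_1\ldots s_j}\in\mathsf{Cat}^{n-j}$ is obtained by iterating. An $n$-fold category is the same as a simplicial object $X$ in $\mathsf{Cat}^{n-1}$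 whose Segal maps $X_k\to X_1\times_{X_0}\overset{k}{\cdots}\times_{X_0}X_1$, $k\ge2$, are isomorphisms. $X$ is discrete if $N_{(n)}X$ is constant. Let $p:\mathsf{Cat}\to\mathsf{Set}$ be the isomorphism-classes-of-objects functor, and let $\bar p$ denote its levelwise application. Let $d^{(n)}:\mathsf{Cat}^{n-1}\to\mathsf{Cat}^n$ be the discrete inclusion in the last direction: $(J_nd^{(n)}Y)_{\underline{s}}$ is the discrete category on the set $(N_{(n-1)}Y)_{\underline{s}}$. Convention: $\mathsf{Cat}^0=\mathsf{Cat}^0_{hd}=\mathsf{Cat}^0_{wg}=\mathsf{Set}$. **Homotopically discrete $n$-fold categories.** $\mathsf{Cat}^1_{hd}=\mathsf{Cat}_{hd}$ is the full subcategory of $\mathsf{Cat}$ of equivalence relations (groupoids with at most one arrow between any two objects), with $p^{(1)}=p$. Inductively, $\mathsf{Cat}^n_{hd}$ is the full subcategory of $[\Delta^{op},\mathsf{Cat}^{n-1}_{hd}]$ of those $X$ such that (i) the Segal maps $X_s\to X_1\times_{X_0}\overset{s}{\cdots}\times_{X_0}X_1$, $s\ge2$, are isomorphisms; (ii) the simplicial object $s\mapsto p^{(n-1)}X_s$ lies in $\mathsf{Cat}^{n-1}_{hd}$; it is denoted $p^{(n)}X$. Thus $(p^{(n)}X)_{s_1\ldots s_{n-1}}=pX_{s_1\ldots s_{n-1}}$. For $X\in\mathsf{Cat}^n_{hd}$ put $X^d=d^{(n)}\cdots d^{(1)}p^{(1)}\cdots p^{(n)}X$ (discrete; identified with its underlying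 set). The levelwise quotient maps $X_{\underline{s}}\to d\,pX_{\underline{s}}$ give $\gamma^{(n)}:X\to d^{(n)}p^{(n)}X$, and composing $\gamma^{(n)},d^{(n)}\gamma^{(n-1)},\ldots$ gives $\gamma:X\to X^d$. **Weakly globular $n$-fold categories.** $\mathsf{Cat}^1_{wg}=\mathsf{Cat}$, and 1-equivalences are equivalences of categories. Inductively, $\mathsf{Cat}^n_{wg}$ is the full subcategory of $[\Delta^{op},\mathsf{Cat}^{n-1}_{wg}]$ of those $X$ such that: (a) $X_0\in\mathsf{Cat}^{n-1}_{hd}$; (b) the Segal maps $X_k\to X_1\times_{X_0}\overset{k}{\cdots}\times_{X_0}X_1$ are isomorphisms for $k\ge2$; (c) the induced Segal maps $X_k\to X_1\times_{X_0^d}\overset{k}{\cdots}\times_{X_0^d}X_1$ (induced by $\gamma:X_0\to X_0^d$) are $(n-1)$-equivalences in $\mathsf{Cat}^{n-1}_{wg}$ for $k\ge2$; (d) $\bar pJ_nX$ is the multinerve of an object $p^{(n)}X$ of $\mathsf{Cat}^{n-1}_{wg}$, so that there is a functor $p^{(n)}:\mathsf{Cat}^n_{wg}\to\mathsf{Cat}^{n-1}_{wg}$ with $N_{(n-1)}p^{(n)}=\bar pJ_n$. For $a,b\in X_0^d$, $X(a,b)$ is the fiber at $(a,b)$ of $X_1\to X_0\times X_0\xrightarrow{\gamma\times\gamma}X_0^d\times X_0^d$. A map $f:X\to Y$ in $\mathsf{Cat}^n_{wg}$ is an $n$-equivalence if $f(a,b):X(a,b)\to Y(fa,fb)$ is an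 $(n-1)$-equivalence for all $a,b\in X_0^d$, and $p^{(n)}f$ is an $(n-1)$-equivalence. **Segalic pseudo-functors.** $\mathsf{Ps}[\Delta^{m^{op}},\mathsf{Cat}]$ is the 2-category of pseudo-functors $\Delta^{m^{op}}\to\mathsf{Cat}$, pseudo-natural transformations and modifications. For $\underline{k}=([k_1],\ldots,[k_m])$, $\underline{k}(\epsilon,i)$ is $\underline{k}$ with its $i$-th entry replaced by $[\epsilon]$, $\epsilon=0,1$. If $H$ is a pseudo-functor with all $H_{\underline{k}(0,i)}$ discrete, then for $k_i\ge2$ the maps $\nu_j:H_{\underline{k}}\to H_{\underline{k}(1,i)}$, $1\le j\le k_i$, induced by $[1]\to[k_i]$, $0\mapsto j-1$, $1\mapsto j$, are strictly compatible with the face maps $H_{\underline{k}(1,i)}\rightrightarrows H_{\underline{k}(0,i)}$ and so define a Segal map $H_{\underline{k}}\to H_{\underline{k}(1,i)}\times_{H_{\underline{k}(0,i)}}\overset{k_i}{\cdots}\times_{H_{\underline{k}(0,i)}}H_{\underline{k}(1,i)}$. For $m\ge1$, $\mathsf{SegPs}[\Delta^{m^{op}},\mathsf{Cat}]$ is the full subcategory of $\mathsf{Ps}[\Delta^{m^{op}},\mathsf{Cat}]$ of those $H$ (Segalic pseudo-functors) such that: (a) $H_{\underline{k}(0,i)}$ is discrete for all $\underline{k}\in\Delta^{m^{op}}$, $1\le i\le m$; (b) all Segal maps are isomorphisms, for all $\underline{k}$, $1\le i\le m$, $k_i\ge2$; (c) the strict functor $\bar pH\in[\Delta^{m^{op}},\mathsf{Set}]$,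 $(\bar pH)_{\underline{k}}=pH_{\underline{k}}$, is the multinerve of an object $p^{(m+1)}H$ of $\mathsf{Cat}^m_{wg}$ (automatic for $m=1$).
   Formalization: The equivalences of categories between (J_nL)_k and H_k are assumed compatible with the structure functors of J_nL and H up to natural isomorphism (no coherence required); for unrelated equivalences chosen separately for each k the statement is false. *)

theory Defs
  imports Main
begin

section \<open>Categories, functors, equivalences\<close>

record ('o, 'm) cat =
  Obj :: "'o set"
  Arr :: "'m set"
  dom :: "'m \<Rightarrow> 'o"
  cod :: "'m \<Rightarrow> 'o"
  idn :: "'o \<Rightarrow> 'm"
  cmp :: "'m \<Rightarrow> 'm \<Rightarrow> 'm"   \<comment> \<open>\<open>cmp C g f\<close> is \<open>g\<close> after \<open>f\<close>, meaningful if \<open>cod C f = dom C g\<close>\<close>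

definition category :: "('o, 'm) cat \<Rightarrow> bool" where
  "category C \<longleftrightarrow>
     (\<forall>f\<in>Arr C. dom C f \<in> Obj C \<and> cod C f \<in> Obj C) \<and>
     (\<forall>x\<in>Obj C. idn C x \<in> Arr C \<and> dom C (idn C x) = x \<and> cod C (idn C x) = x) \<and>
     (\<forall>f\<in>Arr C. \<forall>g\<in>Arr C. cod C f = dom C g \<longrightarrow>
        cmp C g f \<in> Arr C \<and> dom C (cmp C g f) = dom C f \<and> cod C (cmp C g f) = cod C g) \<and>
     (\<forall>f\<in>Arr C. cmp C f (idn C (dom C f)) = f \<and> cmp C (idn C (cod C f)) f = f) \<and>
     (\<forall>f\<in>Arr C. \<forall>g\<in>Arr C. \<forall>h\<in>Arr C. cod C f = dom C g \<longrightarrow> cod C g = dom C h \<longrightarrow>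
        cmp C h (cmp C g f) = cmp C (cmp C h g) f)"

definition iso_arr :: "('o, 'm) cat \<Rightarrow> 'm \<Rightarrow> bool" where
  "iso_arr C f \<longleftrightarrow> f \<in> Arr C \<and>
     (\<exists>g\<in>Arr C. dom C g = cod C f \<and> cod C g = dom C f \<and>
        cmp C g f = idn C (dom C f) \<and> cmp C f g = idn C (cod C f))"

definition iso_objs :: "('o, 'm) cat \<Rightarrow> 'o \<Rightarrow> 'o \<Rightarrow> bool" where
  "iso_objs C x y \<longleftrightarrow> (\<exists>f. iso_arr C f \<and> dom C f = x \<and> cod C f = y)"

definition discrete_cat :: "('o, 'm) cat \<Rightarrow> bool" where
  "discrete_cat C \<longleftrightarrow> category C \<and> (\<forall>f\<in>Arr C. f = idn C (dom C f))"

definition cat_hd :: "('o, 'm) cat \<Rightarrow> bool" where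
  "cat_hd C \<longleftrightarrow> category C \<and> (\<forall>f\<in>Arr C. iso_arr C f) \<and>
     (\<forall>f\<in>Arr C. \<forall>g\<in>Arr C. dom C f = dom C g \<longrightarrow> cod C f = cod C g \<longrightarrow> f = g)"

text \<open>
  The functor \<open>p\<close> from categories to sets. An isomorphism class of objects is encoded by a
  chosen representative (isomorphic objects get the same one), so that \<open>p C\<close> is again a set of
  elements of the object type; this keeps the recursion on dimension below within one type.
\<close>

definition cls :: "('o, 'm) cat \<Rightarrow> 'o \<Rightarrow> 'o" where
  "cls C x = (SOME y. iso_objs C x y)"

definition p_cat :: "('o, 'm) cat \<Rightarrow> 'o set" where
  "p_cat C = cls C ` Obj C"

record ('o, 'm, 'o2, 'm2) ftr =
  fob :: "'o \<Rightarrow> 'o2"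
  far :: "'m \<Rightarrow> 'm2"

definition is_functor ::
    "('o, 'm) cat \<Rightarrow> ('o2, 'm2) cat \<Rightarrow> ('o, 'm, 'o2, 'm2) ftr \<Rightarrow> bool" where
  "is_functor C D F \<longleftrightarrow>
     (\<forall>x\<in>Obj C. fob F x \<in> Obj D \<and> far F (idn C x) = idn D (fob F x)) \<and>
     (\<forall>f\<in>Arr C. far F f \<in> Arr D \<and> dom D (far F f) = fob F (dom C f) \<and>
        cod D (far F f) = fob F (cod C f)) \<and>
     (\<forall>f\<in>Arr C. \<forall>g\<in>Arr C. cod C f = dom C g \<longrightarrow>
        far F (cmp C g f) = cmp D (far F g) (far F f))"

definition id_ftr :: "('o, 'm, 'o, 'm) ftr" where
  "id_ftr = \<lparr>fob = (\<lambda>x. x), far = (\<lambda>f. f)\<rparr>"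

definition cmp_ftr ::
    "('o2, 'm2, 'o3, 'm3) ftr \<Rightarrow> ('o, 'm, 'o2, 'm2) ftr \<Rightarrow> ('o, 'm, 'o3, 'm3) ftr" where
  "cmp_ftr G F = \<lparr>fob = (\<lambda>x. fob G (fob F x)), far = (\<lambda>f. far G (far F f))\<rparr>"

definition nat_iso ::
    "('o, 'm) cat \<Rightarrow> ('o2, 'm2) cat \<Rightarrow> ('o, 'm, 'o2, 'm2) ftr \<Rightarrow> ('o, 'm, 'o2, 'm2) ftr
      \<Rightarrow> ('o \<Rightarrow> 'm2) \<Rightarrow> bool" where
  "nat_iso C D F G \<eta> \<longleftrightarrow>
     (\<forall>x\<in>Obj C. iso_arr D (\<eta> x) \<and> dom D (\<eta> x) = fob F x \<and> cod D (\<eta> x) = fob G x) \<and>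
     (\<forall>f\<in>Arr C. cmp D (\<eta> (cod C f)) (far F f) = cmp D (far G f) (\<eta> (dom C f)))"

definition equivalence ::
    "('o, 'm) cat \<Rightarrow> ('o2, 'm2) cat \<Rightarrow> ('o, 'm, 'o2, 'm2) ftr \<Rightarrow> bool" where
  "equivalence C D F \<longleftrightarrow> is_functor C D F \<and>
     (\<exists>G \<eta> \<epsilon>. is_functor D C G \<and> nat_iso C C id_ftr (cmp_ftr G F) \<eta> \<and>
        nat_iso D D (cmp_ftr F G) id_ftr \<epsilon>)"

definition cat_iso ::
    "('o, 'm) cat \<Rightarrow> ('o2, 'm2) cat \<Rightarrow> ('o, 'm, 'o2, 'm2) ftr \<Rightarrow> bool" where
  "cat_iso C D F \<longleftrightarrow> is_functor C D F \<and>
     bij_betw (fob F) (Obj C) (Obj D) \<and> bij_betw (far F) (Arr C) (Arr D)"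

definition chain :: "nat \<Rightarrow> 'x set \<Rightarrow> ('x \<Rightarrow> 'y) \<Rightarrow> ('x \<Rightarrow> 'y) \<Rightarrow> 'x list set" where
  "chain k A u v =
     {xs. length xs = k \<and> set xs \<subseteq> A \<and> (\<forall>i. Suc i < k \<longrightarrow> v (xs ! i) = u (xs ! Suc i))}"

text \<open>
  \<open>C \<times>\<^sub>B \<dots> \<times>\<^sub>B C\<close> (\<open>k\<close> factors), for functors \<open>S, T\<close> from \<open>C\<close> to a common
  category \<open>B\<close>: \<open>T\<close> of each factor agrees with \<open>S\<close> of the next.
\<close>

definition cat_fprod ::
    "nat \<Rightarrow> ('o, 'm) cat \<Rightarrow> ('o, 'm, 'o2, 'm2) ftr \<Rightarrow> ('o, 'm, 'o2, 'm2) ftr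
      \<Rightarrow> ('o list, 'm list) cat" where
  "cat_fprod k C S T =
     \<lparr>Obj = chain k (Obj C) (fob S) (fob T), Arr = chain k (Arr C) (far S) (far T),
      dom = map (dom C), cod = map (cod C), idn = map (idn C), cmp = map2 (cmp C)\<rparr>"


section \<open>Powers of the simplicial category\<close>

text \<open>
  An object \<open>[k]\<close> of \<open>\<Delta>\<close> is the number \<open>k\<close>; a monotone map
  \<open>[j] \<rightarrow> [k]\<close> is the sorted list of its \<open>j + 1\<close> values. Objects and arrows of \<open>\<Delta>\<^sup>n\<close> are
  lists of length \<open>n\<close> of these.
\<close>

definition dhom :: "nat \<Rightarrow> nat \<Rightarrow> nat list set" where
  "dhom j k = {f. length f = Suc j \<and> sorted f \<and> set f \<subseteq> {..k}}"

definition did :: "nat \<Rightarrow> nat list" where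
  "did k = [0..<Suc k]"

definition dcmp :: "nat list \<Rightarrow> nat list \<Rightarrow> nat list" where
  "dcmp g f = map (\<lambda>i. g ! i) f"

definition mhom :: "nat list \<Rightarrow> nat list \<Rightarrow> nat list list set" where
  "mhom js ks = {\<phi>. length js = length ks \<and> length \<phi> = length ks \<and>
     (\<forall>i<length ks. \<phi> ! i \<in> dhom (js ! i) (ks ! i))}"

definition mid :: "nat list \<Rightarrow> nat list list" where
  "mid ks = map did ks"

definition mcmp :: "nat list list \<Rightarrow> nat list list \<Rightarrow> nat list list" where
  "mcmp \<psi> \<phi> = map2 dcmp \<psi> \<phi>"


section \<open>Multisimplicial sets\<close>

text \<open>
  \<open>act X js ks \<phi>\<close> is the map \<open>X\<^sub>k\<^sub>s \<rightarrow> X\<^sub>j\<^sub>s\<close> induced by \<open>\<phi> : js \<rightarrow> ks\<close>.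
\<close>

record 'a mss =
  lev :: "nat list \<Rightarrow> 'a set"
  act :: "nat list \<Rightarrow> nat list \<Rightarrow> nat list list \<Rightarrow> 'a \<Rightarrow> 'a"

definition msset :: "nat \<Rightarrow> 'a mss \<Rightarrow> bool" where
  "msset n X \<longleftrightarrow>
     (\<forall>js ks. \<forall>\<phi>\<in>mhom js ks. length ks = n \<longrightarrow> act X js ks \<phi> ` lev X ks \<subseteq> lev X js) \<and>
     (\<forall>ks. \<forall>x\<in>lev X ks. length ks = n \<longrightarrow> act X ks ks (mid ks) x = x) \<and>
     (\<forall>is js ks. \<forall>\<phi>\<in>mhom is js. \<forall>\<psi>\<in>mhom js ks. \<forall>x\<in>lev X ks. length ks = n \<longrightarrow>
        act X is ks (mcmp \<psi> \<phi>) x = act X is js \<phi> (act X js ks \<psi> x))"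

definition msmap :: "nat \<Rightarrow> 'a mss \<Rightarrow> 'b mss \<Rightarrow> (nat list \<Rightarrow> 'a \<Rightarrow> 'b) \<Rightarrow> bool" where
  "msmap n X Y f \<longleftrightarrow>
     (\<forall>ks. length ks = n \<longrightarrow> f ks ` lev X ks \<subseteq> lev Y ks) \<and>
     (\<forall>js ks. \<forall>\<phi>\<in>mhom js ks. \<forall>x\<in>lev X ks. length ks = n \<longrightarrow>
        f js (act X js ks \<phi> x) = act Y js ks \<phi> (f ks x))"

definition msiso :: "nat \<Rightarrow> 'a mss \<Rightarrow> 'b mss \<Rightarrow> (nat list \<Rightarrow> 'a \<Rightarrow> 'b) \<Rightarrow> bool" where
  "msiso n X Y f \<longleftrightarrow> msmap n X Y f \<and>
     (\<forall>ks. length ks = n \<longrightarrow> bij_betw (f ks) (lev X ks) (lev Y ks))"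

definition slices :: "'a mss \<Rightarrow> nat list \<Rightarrow> 'a mss" where
  "slices X ss = \<lparr>lev = (\<lambda>ks. lev X (ss @ ks)),
                  act = (\<lambda>js ks \<phi>. act X (ss @ js) (ss @ ks) (mid ss @ \<phi>))\<rparr>"

abbreviation slice :: "'a mss \<Rightarrow> nat \<Rightarrow> 'a mss" where
  "slice X s \<equiv> slices X [s]"

definition simp_map ::
    "'a mss \<Rightarrow> nat \<Rightarrow> nat \<Rightarrow> nat list \<Rightarrow> nat list \<Rightarrow> 'a \<Rightarrow> 'a" where
  "simp_map X j k \<theta> ks = act X (j # ks) (k # ks) (\<theta> # mid ks)"

abbreviation src :: "'a mss \<Rightarrow> nat list \<Rightarrow> 'a \<Rightarrow> 'a" where
  "src X \<equiv> simp_map X 0 1 [0]"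

abbreviation tgt :: "'a mss \<Rightarrow> nat list \<Rightarrow> 'a \<Rightarrow> 'a" where
  "tgt X \<equiv> simp_map X 0 1 [1]"


section \<open>Iterated fibre products and Segal maps\<close>

text \<open>
  A type closed under finite tuples: the iterated fibre products of multisimplicial sets with
  elements in this type are again of that kind. Arbitrary elements enter through \<open>Atom\<close>.
\<close>

datatype 'a elt = Atom 'a | Tuple (comps: "'a elt list")

definition fprod ::
    "nat \<Rightarrow> 'a elt mss \<Rightarrow> (nat list \<Rightarrow> 'a elt \<Rightarrow> 'b) \<Rightarrow> (nat list \<Rightarrow> 'a elt \<Rightarrow> 'b)
      \<Rightarrow> 'a elt mss" where
  "fprod k Y u v =
     \<lparr>lev = (\<lambda>ks. Tuple ` chain k (lev Y ks) (u ks) (v ks)),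
      act = (\<lambda>js ks \<phi> x. Tuple (map (act Y js ks \<phi>) (comps x)))\<rparr>"

definition segal_map :: "'a elt mss \<Rightarrow> nat \<Rightarrow> nat list \<Rightarrow> 'a elt \<Rightarrow> 'a elt" where
  "segal_map X k ks x = Tuple (map (\<lambda>j. simp_map X 1 k [j, Suc j] ks x) [0..<k])"

definition segal :: "nat \<Rightarrow> 'a elt mss \<Rightarrow> bool" where
  "segal n X \<longleftrightarrow>
     (\<forall>k\<ge>2. msiso (n - 1) (slice X k) (fprod k (slice X 1) (src X) (tgt X)) (segal_map X k))"


section \<open>\<open>n\<close>-fold categories\<close>

text \<open>
  An \<open>n\<close>-fold category is given by its multinerve: a simplicial object in \<open>(n-1)\<close>-fold
  categories with invertible Segal maps, starting from sets for \<open>n = 0\<close>.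
\<close>

primrec nfold_cat :: "nat \<Rightarrow> 'a elt mss \<Rightarrow> bool" where
  "nfold_cat 0 X \<longleftrightarrow> msset 0 X"
| "nfold_cat (Suc n) X \<longleftrightarrow>
     msset (Suc n) X \<and> (\<forall>s. nfold_cat n (slice X s)) \<and> segal (Suc n) X"

text \<open>
  The category with nerve \<open>X\<close> (for \<open>n = 1\<close>): the composite of \<open>g\<close> after \<open>f\<close> is
  the long edge of the 2-simplex with short edges \<open>f\<close>, \<open>g\<close>.
\<close>

definition cat_of :: "'a mss \<Rightarrow> ('a, 'a) cat" where
  "cat_of X =
     \<lparr>Obj = lev X [0], Arr = lev X [1],
      dom = act X [0] [1] [[0]], cod = act X [0] [1] [[1]],
      idn = act X [1] [0] [[0, 0]],
      cmp = (\<lambda>g f. act X [1] [2] [[0, 2]]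
               (THE x. x \<in> lev X [2] \<and> act X [1] [2] [[0, 1]] x = f \<and>
                       act X [1] [2] [[1, 2]] x = g))\<rparr>"

definition ftr_of :: "(nat list \<Rightarrow> 'a \<Rightarrow> 'b) \<Rightarrow> ('a, 'a, 'b, 'b) ftr" where
  "ftr_of f = \<lparr>fob = f [0], far = f [1]\<rparr>"

record ('o, 'm) cat_diag =
  dcat :: "nat list \<Rightarrow> ('o, 'm) cat"
  dftr :: "nat list \<Rightarrow> nat list \<Rightarrow> nat list list \<Rightarrow> ('o, 'm, 'o, 'm) ftr"

text \<open>\<open>J X\<close> is the functor \<open>J\<^sub>n X\<close>: the nerve of \<open>X\<close> in all directions but the last.\<close>

definition J :: "'a mss \<Rightarrow> ('a, 'a) cat_diag" where
  "J X = \<lparr>dcat = (\<lambda>ks. cat_of (slices X ks)),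
          dftr = (\<lambda>js ks \<phi>. ftr_of (\<lambda>s. act X (js @ s) (ks @ s) (\<phi> @ mid s)))\<rparr>"

definition pbar :: "('o, 'm, 'z) cat_diag_scheme \<Rightarrow> 'o mss" where
  "pbar D = \<lparr>lev = (\<lambda>ks. p_cat (dcat D ks)),
             act = (\<lambda>js ks \<phi> x. cls (dcat D js) (fob (dftr D js ks \<phi>) x))\<rparr>"

text \<open>
  \<open>pn X\<close> is (the multinerve of) \<open>p\<^sup>(\<^sup>n\<^sup>) X\<close>, and \<open>pn_map Y f\<close> is \<open>p\<^sup>(\<^sup>n\<^sup>) f\<close> for
  \<open>f : X \<rightarrow> Y\<close>.
\<close>

abbreviation pn :: "'a mss \<Rightarrow> 'a mss" where
  "pn X \<equiv> pbar (J X)"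

definition pn_map :: "'b mss \<Rightarrow> (nat list \<Rightarrow> 'a \<Rightarrow> 'b) \<Rightarrow> nat list \<Rightarrow> 'a \<Rightarrow> 'b" where
  "pn_map Y f ks x = cls (dcat (J Y) ks) (f (ks @ [0]) x)"


section \<open>Homotopically discrete \<open>n\<close>-fold categories\<close>

fun hd_cat :: "nat \<Rightarrow> 'a elt mss \<Rightarrow> bool" where
  "hd_cat 0 X \<longleftrightarrow> msset 0 X"
| "hd_cat (Suc 0) X \<longleftrightarrow> nfold_cat 1 X \<and> cat_hd (cat_of X)"
| "hd_cat (Suc (Suc m)) X \<longleftrightarrow>
     msset (Suc (Suc m)) X \<and> (\<forall>s. hd_cat (Suc m) (slice X s)) \<and>
     segal (Suc (Suc m)) X \<and> hd_cat (Suc m) (pn X)"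

text \<open>The set \<open>X\<^sup>d\<close>, the map \<open>X\<^sup>d \<rightarrow> Y\<^sup>d\<close> induced by \<open>f : X \<rightarrow> Y\<close>, and \<open>\<gamma> : X \<rightarrow> X\<^sup>d\<close>.\<close>

primrec dset :: "nat \<Rightarrow> 'a mss \<Rightarrow> 'a set" where
  "dset 0 X = lev X []"
| "dset (Suc n) X = dset n (pn X)"

primrec dmap :: "nat \<Rightarrow> 'b mss \<Rightarrow> (nat list \<Rightarrow> 'a \<Rightarrow> 'b) \<Rightarrow> 'a \<Rightarrow> 'b" where
  "dmap 0 Y f = f []"
| "dmap (Suc n) Y f = dmap n (pn Y) (pn_map Y f)"

text \<open>
  \<open>\<gamma>\<^sup>(\<^sup>n\<^sup>)\<close> on multinerves: an element of \<open>X\<close> in degree \<open>(k\<^sub>1, \<dots>, k\<^sub>n)\<close> is a string of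
  \<open>k\<^sub>n\<close> arrows in the category \<open>X\<close> in degree \<open>(k\<^sub>1, \<dots>, k\<^sub>n\<^sub>-\<^sub>1)\<close>; all objects of the string
  are isomorphic if this category is in \<open>Cat\<^sub>h\<^sub>d\<close>, and the class of the first one is taken.
\<close>

definition gamma1 :: "'a mss \<Rightarrow> nat list \<Rightarrow> 'a \<Rightarrow> 'a" where
  "gamma1 X ks x = cls (dcat (J X) (butlast ks))
     (act X (butlast ks @ [0]) ks (mid (butlast ks) @ [[0]]) x)"

primrec gamma :: "nat \<Rightarrow> 'a mss \<Rightarrow> nat list \<Rightarrow> 'a \<Rightarrow> 'a" where
  "gamma 0 X ks x = x"
| "gamma (Suc n) X ks x = gamma n (pn X) (butlast ks) (gamma1 X ks x)"


section \<open>Weakly globular \<open>n\<close>-fold categories\<close>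

text \<open>
  For an \<open>n\<close>-fold \<open>X\<close>: the composites \<open>X\<^sub>1 \<rightarrow> X\<^sub>0 \<rightarrow> X\<^sub>0\<^sup>d\<close>, the target
  \<open>X\<^sub>1 \<times> \<dots> \<times> X\<^sub>1\<close> (over \<open>X\<^sub>0\<^sup>d\<close>) of the induced Segal map, and \<open>X(a,b)\<close>.
\<close>

definition dsrc :: "nat \<Rightarrow> 'a mss \<Rightarrow> nat list \<Rightarrow> 'a \<Rightarrow> 'a" where
  "dsrc n X ks x = gamma (n - 1) (slice X 0) ks (src X ks x)"

definition dtgt :: "nat \<Rightarrow> 'a mss \<Rightarrow> nat list \<Rightarrow> 'a \<Rightarrow> 'a" where
  "dtgt n X ks x = gamma (n - 1) (slice X 0) ks (tgt X ks x)"

definition ind_fprod :: "nat \<Rightarrow> 'a elt mss \<Rightarrow> nat \<Rightarrow> 'a elt mss" where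
  "ind_fprod n X k = fprod k (slice X 1) (dsrc n X) (dtgt n X)"

definition hom_fib :: "nat \<Rightarrow> 'a mss \<Rightarrow> 'a \<Rightarrow> 'a \<Rightarrow> 'a mss" where
  "hom_fib n X a b =
     \<lparr>lev = (\<lambda>ks. {x \<in> lev (slice X 1) ks. dsrc n X ks x = a \<and> dtgt n X ks x = b}),
      act = act (slice X 1)\<rparr>"

text \<open>
  \<open>wg n X\<close>: \<open>X\<close> is a weakly globular \<open>n\<close>-fold category; \<open>weq n X Y f\<close>: \<open>X\<close> and \<open>Y\<close> are
  weakly globular and \<open>f : X \<rightarrow> Y\<close> is an \<open>n\<close>-equivalence. The clause \<open>weq 0\<close> is never used
  by \<open>wg n\<close>.
\<close>

function (sequential) wg :: "nat \<Rightarrow> 'a elt mss \<Rightarrow> bool"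
  and weq :: "nat \<Rightarrow> 'a elt mss \<Rightarrow> 'a elt mss \<Rightarrow> (nat list \<Rightarrow> 'a elt \<Rightarrow> 'a elt) \<Rightarrow> bool" where
  "wg 0 X \<longleftrightarrow> msset 0 X"
| "wg (Suc 0) X \<longleftrightarrow> nfold_cat 1 X"
| "wg (Suc (Suc m)) X \<longleftrightarrow>
     msset (Suc (Suc m)) X \<and> (\<forall>s. wg (Suc m) (slice X s)) \<and>
     hd_cat (Suc m) (slice X 0) \<and>
     segal (Suc (Suc m)) X \<and>
     (\<forall>k\<ge>2. weq (Suc m) (slice X k) (ind_fprod (Suc (Suc m)) X k) (segal_map X k)) \<and>
     wg (Suc m) (pn X)"
| "weq 0 X Y f \<longleftrightarrow> msset 0 X \<and> msset 0 Y \<and> msiso 0 X Y f"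
| "weq (Suc 0) X Y f \<longleftrightarrow>
     wg (Suc 0) X \<and> wg (Suc 0) Y \<and> msmap (Suc 0) X Y f \<and>
     equivalence (cat_of X) (cat_of Y) (ftr_of f)"
| "weq (Suc (Suc m)) X Y f \<longleftrightarrow>
     wg (Suc (Suc m)) X \<and> wg (Suc (Suc m)) Y \<and> msmap (Suc (Suc m)) X Y f \<and>
     (\<forall>a\<in>dset (Suc m) (slice X 0). \<forall>b\<in>dset (Suc m) (slice X 0).
        weq (Suc m) (hom_fib (Suc (Suc m)) X a b)
          (hom_fib (Suc (Suc m)) Y
             (dmap (Suc m) (slice Y 0) (\<lambda>ks. f (0 # ks)) a)
             (dmap (Suc m) (slice Y 0) (\<lambda>ks. f (0 # ks)) b))
          (\<lambda>ks. f (1 # ks))) \<and>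
     weq (Suc m) (pn X) (pn Y) (pn_map Y f)"
  by pat_completeness auto
termination
  by (relation "measure (case_sum (\<lambda>(n, _). 2 * n) (\<lambda>(n, _). 2 * n + 1))") auto


section \<open>Segalic pseudo-functors\<close>

text \<open>
  Contravariant pseudo-functors: for \<open>\<phi> : is \<rightarrow> js\<close> and \<open>\<psi> : js \<rightarrow> ks\<close> the constraint
  \<open>pcmp H is js ks \<phi> \<psi>\<close> goes from \<open>H\<^sub>\<phi> H\<^sub>\<psi>\<close> to \<open>H\<^sub>\<psi>\<^sub>\<phi>\<close>, and \<open>puni H ks\<close> from the identity
  to the image of the identity of \<open>ks\<close>.
\<close>

record ('o, 'm) ps_fun = "('o, 'm) cat_diag" +
  puni :: "nat list \<Rightarrow> 'o \<Rightarrow> 'm"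
  pcmp :: "nat list \<Rightarrow> nat list \<Rightarrow> nat list \<Rightarrow> nat list list \<Rightarrow> nat list list \<Rightarrow> 'o \<Rightarrow> 'm"

definition pseudo_functor :: "nat \<Rightarrow> ('o, 'm) ps_fun \<Rightarrow> bool" where
  "pseudo_functor m H \<longleftrightarrow>
     (\<forall>ks. length ks = m \<longrightarrow> category (dcat H ks)) \<and>
     (\<forall>js ks. \<forall>\<phi>\<in>mhom js ks. length ks = m \<longrightarrow>
        is_functor (dcat H ks) (dcat H js) (dftr H js ks \<phi>)) \<and>
     (\<forall>ks. length ks = m \<longrightarrow>
        nat_iso (dcat H ks) (dcat H ks) id_ftr (dftr H ks ks (mid ks)) (puni H ks)) \<and>
     (\<forall>is js ks. \<forall>\<phi>\<in>mhom is js. \<forall>\<psi>\<in>mhom js ks. length ks = m \<longrightarrow>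
        nat_iso (dcat H ks) (dcat H is) (cmp_ftr (dftr H is js \<phi>) (dftr H js ks \<psi>))
          (dftr H is ks (mcmp \<psi> \<phi>)) (pcmp H is js ks \<phi> \<psi>)) \<and>
     (\<forall>hs is js ks. \<forall>\<phi>\<in>mhom hs is. \<forall>\<chi>\<in>mhom is js. \<forall>\<psi>\<in>mhom js ks.
        \<forall>x\<in>Obj (dcat H ks). length ks = m \<longrightarrow>
        cmp (dcat H hs) (pcmp H hs js ks (mcmp \<chi> \<phi>) \<psi> x)
            (pcmp H hs is js \<phi> \<chi> (fob (dftr H js ks \<psi>) x)) =
        cmp (dcat H hs) (pcmp H hs is ks \<phi> (mcmp \<psi> \<chi>) x)
            (far (dftr H hs is \<phi>) (pcmp H is js ks \<chi> \<psi> x))) \<and>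
     (\<forall>js ks. \<forall>\<psi>\<in>mhom js ks. \<forall>x\<in>Obj (dcat H ks). length ks = m \<longrightarrow>
        cmp (dcat H js) (pcmp H js js ks (mid js) \<psi> x) (puni H js (fob (dftr H js ks \<psi>) x)) =
          idn (dcat H js) (fob (dftr H js ks \<psi>) x) \<and>
        cmp (dcat H js) (pcmp H js ks ks \<psi> (mid ks) x)
            (far (dftr H js ks \<psi>) (puni H ks x)) =
          idn (dcat H js) (fob (dftr H js ks \<psi>) x))"

text \<open>
  The functor induced by \<open>\<theta> : [j] \<rightarrow> [l]\<close> in the \<open>i\<close>-th direction (counted from 0) and
  identities in the others, from \<open>H\<close> in degree \<open>ks[i := l]\<close> to \<open>H\<close> in degree \<open>ks[i := j]\<close>.
\<close>

definition dir_ftr ::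
    "('o, 'm, 'z) cat_diag_scheme \<Rightarrow> nat list \<Rightarrow> nat \<Rightarrow> nat \<Rightarrow> nat \<Rightarrow> nat list
      \<Rightarrow> ('o, 'm, 'o, 'm) ftr" where
  "dir_ftr H ks i j l \<theta> = dftr H (ks[i := j]) (ks[i := l]) ((mid ks)[i := \<theta>])"

definition dir_segal_map ::
    "('o, 'm, 'z) cat_diag_scheme \<Rightarrow> nat list \<Rightarrow> nat \<Rightarrow> ('o, 'm, 'o list, 'm list) ftr" where
  "dir_segal_map H ks i =
     \<lparr>fob = (\<lambda>x. map (\<lambda>j. fob (dir_ftr H ks i 1 (ks ! i) [j, Suc j]) x) [0..<ks ! i]),
      far = (\<lambda>f. map (\<lambda>j. far (dir_ftr H ks i 1 (ks ! i) [j, Suc j]) f) [0..<ks ! i])\<rparr>"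

definition segalic :: "nat \<Rightarrow> ('b elt, 'm) ps_fun \<Rightarrow> bool" where
  "segalic m H \<longleftrightarrow>
     pseudo_functor m H \<and>
     (\<forall>ks i. length ks = m \<longrightarrow> i < m \<longrightarrow> discrete_cat (dcat H (ks[i := 0]))) \<and>
     (\<forall>ks i. length ks = m \<longrightarrow> i < m \<longrightarrow> ks ! i \<ge> 2 \<longrightarrow>
        cat_iso (dcat H ks)
          (cat_fprod (ks ! i) (dcat H (ks[i := 1]))
             (dir_ftr H ks i 0 1 [0]) (dir_ftr H ks i 0 1 [1]))
          (dir_segal_map H ks i)) \<and>
     wg m (pbar H)"

text \<open>
  Equivalences of categories \<open>T\<^sub>k : D\<^sub>k \<rightarrow> E\<^sub>k\<close> in every degree, compatible with the structure
  functors up to natural isomorphism. No coherence of these isomorphisms is demanded, so every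
  pseudo-natural transformation whose components are equivalences qualifies. Some compatibility is
  needed: let the double category \<open>L\<close> have two vertically isomorphic objects \<open>x\<close>, \<open>y\<close>, each
  with horizontal endomorphism monoid \<open>\<nat>\<close>, and as its only non-identity squares those between the
  horizontal identities of \<open>x\<close> and \<open>y\<close>; then \<open>L\<^sub>k\<close> is equivalent to the discrete category
  \<open>\<nat>\<^sup>k\<close> for every \<open>k\<close>, but \<open>L\<close> is not weakly globular.
\<close>

definition levelwise_equivalence ::
    "nat \<Rightarrow> ('o, 'm, 'y) cat_diag_scheme \<Rightarrow> ('o2, 'm2, 'z) cat_diag_scheme
      \<Rightarrow> (nat list \<Rightarrow> ('o, 'm, 'o2, 'm2) ftr) \<Rightarrow> bool" where
  "levelwise_equivalence m D E T \<longleftrightarrow>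
     (\<forall>ks. length ks = m \<longrightarrow> equivalence (dcat D ks) (dcat E ks) (T ks)) \<and>
     (\<forall>js ks. \<forall>\<phi>\<in>mhom js ks. length ks = m \<longrightarrow>
        (\<exists>\<eta>. nat_iso (dcat D ks) (dcat E js) (cmp_ftr (dftr E js ks \<phi>) (T ks))
                (cmp_ftr (T js) (dftr D js ks \<phi>)) \<eta>))"

end

theory Submission
  imports Defs
begin

text \<open>
  Weak globularity turns out to be a condition on three pieces of strict data only: an \<open>n\<close>-fold
  category \<open>X\<close> is weakly globular iff \<open>p\<^sup>(\<^sup>n\<^sup>)X\<close> is the multinerve of a weakly globular one and the
  categories \<open>X\<^sub>k\<close>, for \<open>k\<close> with some entry 0, are equivalence relations; it is homotopically
  discrete iff the same holds with all \<open>X\<^sub>k\<close> equivalence relations. Both conditions only depend on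
  \<open>X\<^sub>k\<close> up to equivalence and on \<open>p\<^sup>(\<^sup>n\<^sup>)X\<close> up to isomorphism, so they pass from \<open>H\<close> to \<open>L\<close>.

  The induced Segal maps take care of themselves because a map \<open>f\<close> is an \<open>n\<close>-equivalence as soon as
  all \<open>f\<^sub>k\<close> are fully faithful and \<open>p\<^sup>(\<^sup>n\<^sup>)f\<close> is an \<open>(n-1)\<close>-equivalence. Induced Segal maps are fully
  faithful in every degree: arrows of \<open>X\<^sub>1\<close> whose ends match over \<open>X\<^sub>0\<close> have equal images in \<open>X\<^sub>0\<close>, where
  parallel arrows agree, so that a family of arrows over \<open>X\<^sub>0\<^sup>d\<close> comes from the strict Segal condition.
\<close>

section \<open>Calculus in powers of the simplicial category\<close>

text \<open>The obstacle is that \<open>pn\<close> chooses representatives of classes: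
  \<open>pn\<close> of a fibre X(a,b) or of a fibre product over X_0^d is not the one formed in
  \<open>pn X\<close>, only an isomorphic copy. An induction along \<open>pn\<close> therefore
  cannot speak of the concrete \<open>hom_fib\<close> and \<open>ind_fprod\<close>. It speaks of any
  \<open>Z\<close> with projections that identify it with compatible families
  (\<open>represents\<close>). That \<open>pn\<close> respects this description is due to X_0^d
  being discrete: an arrow of X_1 has a single value there, shared with both of its ends.
  Compatibility of a family of objects thus depends only on isomorphism classes, and arrows between
  compatible families are compatible themselves. Essential surjectivity is never imposed separately:
  iterating \<open>pn\<close> down to dimension 0 turns it into part of the bijectivity in
  \<open>tower_eq 0\<close>.\<close>

lemma mhom_Cons [simp]: "\<theta> # \<phi> \<in> mhom (j # js) (k # ks) \<longleftrightarrow> \<theta> \<in> dhom j k \<and> \<phi> \<in> mhom js ks"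
  by (auto simp: mhom_def All_less_Suc2)

lemma mhom_Nil [simp]: "\<phi> \<in> mhom js [] \<longleftrightarrow> \<phi> = [] \<and> js = []"
  by (auto simp: mhom_def)

lemma mhom_length: "\<phi> \<in> mhom js ks \<Longrightarrow> length js = length ks \<and> length \<phi> = length ks"
  by (simp add: mhom_def)

lemma mhom_append: "\<phi> \<in> mhom js ks \<Longrightarrow> \<psi> \<in> mhom js' ks' \<Longrightarrow> \<phi> @ \<psi> \<in> mhom (js @ js') (ks @ ks')"
  by (auto simp: mhom_def nth_append)

text \<open>\<open>p\<close> acts in the last direction, whereas lists are taken apart from the
  front; the discretization map needs the last entry of an index split off together with its
  component of \<open>\<phi>\<close>.\<close>

lemma mhom_snocE:
  assumes "\<phi> \<in> mhom js ks" "length ks = Suc n"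
  obtains js' j ks' k \<phi>' \<theta> where "js = js' @ [j]" "ks = ks' @ [k]" "\<phi> = \<phi>' @ [\<theta>]"
    "\<phi>' \<in> mhom js' ks'" "\<theta> \<in> dhom j k" "length ks' = n"
proof -
  note len = mhom_length[OF assms(1)]
  from len assms(2) obtain js' j ks' k \<phi>' \<theta> where
    eq: "js = js' @ [j]" "ks = ks' @ [k]" "\<phi> = \<phi>' @ [\<theta>]"
    by (metis length_Suc_conv_rev)
  have *: "\<forall>i<Suc n. (\<phi>' @ [\<theta>]) ! i \<in> dhom ((js' @ [j]) ! i) ((ks' @ [k]) ! i)"
    using assms eq by (auto simp: mhom_def)
  have "\<phi>' ! i \<in> dhom (js' ! i) (ks' ! i)" if "i < n" for i
    using *[rule_format, of i] that eq len assms(2) by (auto simp: nth_append)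
  moreover have "\<theta> \<in> dhom j k"
    using *[rule_format, of n] eq len assms(2) by (auto simp: nth_append)
  ultimately show ?thesis
    using that[OF eq] eq len assms(2) by (auto simp: mhom_def)
qed

lemma did_in [simp]: "did k \<in> dhom k k"
  by (auto simp: did_def dhom_def simp del: upt_Suc)

lemma did_0 [simp]: "did 0 = [0]"
  by (simp add: did_def)

lemma mid_in [simp]: "mid ks \<in> mhom ks ks"
  by (auto simp: mid_def mhom_def)

lemma mid_Nil [simp]: "mid [] = []"
  and mid_Cons [simp]: "mid (k # ks) = did k # mid ks"
  and mid_append [simp]: "mid (ks @ ls) = mid ks @ mid ls"
  and length_mid [simp]: "length (mid ks) = length ks"
  by (simp_all add: mid_def)

lemma mcmp_Nil [simp]: "mcmp [] [] = []"
  and mcmp_Cons [simp]: "mcmp (g # \<psi>) (f # \<phi>) = dcmp g f # mcmp \<psi> \<phi>"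
  by (simp_all add: mcmp_def)

lemma mcmp_append [simp]: "length \<psi> = length \<phi> \<Longrightarrow> mcmp (\<psi> @ \<psi>') (\<phi> @ \<phi>') = mcmp \<psi> \<phi> @ mcmp \<psi>' \<phi>'"
  by (simp add: mcmp_def)

lemma dhom_iff: "f \<in> dhom j k \<longleftrightarrow> length f = Suc j \<and> sorted f \<and> (\<forall>x\<in>set f. x \<le> k)"
  by (auto simp: dhom_def)

lemma dcmp_did_left [simp]: "f \<in> dhom j k \<Longrightarrow> dcmp (did k) f = f"
  unfolding dcmp_def did_def dhom_iff by (intro map_idI) (auto simp: less_Suc_eq_le simp del: upt_Suc)

lemma dcmp_did_right [simp]: "f \<in> dhom j k \<Longrightarrow> dcmp f (did j) = f"
  unfolding dcmp_def did_def dhom_iff by (auto intro: nth_equalityI simp del: upt_Suc)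

lemma mcmp_mid_left [simp]: "\<phi> \<in> mhom js ks \<Longrightarrow> mcmp (mid ks) \<phi> = \<phi>"
  by (auto simp: mhom_def mcmp_def mid_def intro!: nth_equalityI)

lemma mcmp_mid_right [simp]: "\<phi> \<in> mhom js ks \<Longrightarrow> mcmp \<phi> (mid js) = \<phi>"
  by (auto simp: mhom_def mcmp_def mid_def intro!: nth_equalityI)

lemma mcmp_mid_mid [simp]: "mcmp (mid ks) (mid ks) = mid ks"
  by (rule mcmp_mid_left[OF mid_in])

lemma vertex_in: "j \<le> k \<Longrightarrow> [j] \<in> dhom 0 k"
  and edge_in: "i \<le> j \<Longrightarrow> j \<le> k \<Longrightarrow> [i, j] \<in> dhom (Suc 0) k"
  by (auto simp: dhom_def)

section \<open>Multisimplicial sets, their slices and simplicial structure maps\<close>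

lemma msset_act: "msset n X \<Longrightarrow> \<phi> \<in> mhom js ks \<Longrightarrow> length ks = n \<Longrightarrow> x \<in> lev X ks \<Longrightarrow>
    act X js ks \<phi> x \<in> lev X js"
  unfolding msset_def by blast

lemma msset_id: "msset n X \<Longrightarrow> length ks = n \<Longrightarrow> x \<in> lev X ks \<Longrightarrow> act X ks ks (mid ks) x = x"
  unfolding msset_def by blast

lemma msset_comp: "msset n X \<Longrightarrow> \<phi> \<in> mhom is js \<Longrightarrow> \<psi> \<in> mhom js ks \<Longrightarrow> length ks = n \<Longrightarrow>
    x \<in> lev X ks \<Longrightarrow> act X is js \<phi> (act X js ks \<psi> x) = act X is ks (mcmp \<psi> \<phi>) x"
  unfolding msset_def by metis

lemma msmap_lev: "msmap n X Y f \<Longrightarrow> length ks = n \<Longrightarrow> x \<in> lev X ks \<Longrightarrow> f ks x \<in> lev Y ks"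
  unfolding msmap_def by blast

lemma msmap_act: "msmap n X Y f \<Longrightarrow> \<phi> \<in> mhom js ks \<Longrightarrow> length ks = n \<Longrightarrow> x \<in> lev X ks \<Longrightarrow>
    f js (act X js ks \<phi> x) = act Y js ks \<phi> (f ks x)"
  unfolding msmap_def by blast

lemma slices_sel [simp]: "lev (slices X ss) ks = lev X (ss @ ks)"
  "act (slices X ss) js ks \<phi> = act X (ss @ js) (ss @ ks) (mid ss @ \<phi>)"
  by (simp_all add: slices_def)

lemma slices_Nil [simp]: "slices X [] = X"
  by (simp add: slices_def)

lemma slices_slices [simp]: "slices (slices X ss) ts = slices X (ss @ ts)"
  by (simp add: slices_def)

lemma msset_slices:
  assumes "msset (length ss + m) X" shows "msset m (slices X ss)"
proof -
  have "act X (ss @ is) (ss @ ks) (mid ss @ mcmp \<psi> \<phi>) x =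
      act X (ss @ is) (ss @ js) (mid ss @ \<phi>) (act X (ss @ js) (ss @ ks) (mid ss @ \<psi>) x)"
    if "\<phi> \<in> mhom is js" "\<psi> \<in> mhom js ks" "x \<in> lev X (ss @ ks)" "length ks = m"
    for "is" js ks \<phi> \<psi> x
    using that assms by (subst msset_comp[of _ X]) (auto intro: mhom_append)
  moreover have "act X (ss @ js) (ss @ ks) (mid ss @ \<phi>) x \<in> lev X (ss @ js)"
    if "\<phi> \<in> mhom js ks" "x \<in> lev X (ss @ ks)" "length ks = m" for js ks \<phi> x
    using that assms by (intro msset_act[of "length ss + m"] mhom_append) auto
  moreover have "act X (ss @ ks) (ss @ ks) (mid ss @ mid ks) x = x"
    if "x \<in> lev X (ss @ ks)" "length ks = m" for ks x
    using msset_id[OF assms, of "ss @ ks"] that by auto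
  ultimately show ?thesis unfolding msset_def by auto
qed

lemma msset_slice: "msset (Suc n) X \<Longrightarrow> msset n (slice X s)"
  using msset_slices[of "[s]" n X] by simp

lemma msmap_slices:
  assumes "msmap (length ss + m) X Y f" shows "msmap m (slices X ss) (slices Y ss) (\<lambda>ks. f (ss @ ks))"
  unfolding msmap_def
  using msmap_lev[OF assms] msmap_act[OF assms] by (auto simp: mhom_append)

lemma msmap_slice: "msmap (Suc n) X Y f \<Longrightarrow> msmap n (slice X s) (slice Y s) (\<lambda>ks. f (s # ks))"
  using msmap_slices[of "[s]" n X Y f] by simp

text \<open>Maps in the first directions commute with those in the remaining ones. With one
  remaining direction this yields the functors of \<open>J X\<close>, with one first direction the
  simplicial structure maps.\<close>

lemma msmap_structure:
  assumes "msset (length ks + m) X" "\<phi> \<in> mhom js ks"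
  shows "msmap m (slices X ks) (slices X js) (\<lambda>s. act X (js @ s) (ks @ s) (\<phi> @ mid s))"
proof -
  note len = mhom_length[OF assms(2)]
  have "act X (js @ s) (ks @ s) (\<phi> @ mid s) x \<in> lev X (js @ s)"
    if "length s = m" "x \<in> lev X (ks @ s)" for s x
    using that assms by (intro msset_act[of "length ks + m"] mhom_append) auto
  moreover have "act X (js @ s) (ks @ s) (\<phi> @ mid s) (act X (ks @ s) (ks @ t) (mid ks @ \<psi>) x)
       = act X (js @ s) (js @ t) (mid js @ \<psi>) (act X (js @ t) (ks @ t) (\<phi> @ mid t) x)"
    if "\<psi> \<in> mhom s t" "length t = m" "x \<in> lev X (ks @ t)" for s t \<psi> x
    using that assms len by (simp add: msset_comp[OF assms(1)] mhom_append)
  ultimately show ?thesis unfolding msmap_def by auto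
qed

lemma msmap_simp_map:
  assumes "msset (Suc n) X" "\<theta> \<in> dhom j k"
  shows "msmap n (slice X k) (slice X j) (simp_map X j k \<theta>)"
  using msmap_structure[of "[k]" n X "[\<theta>]" "[j]"] assms by (simp add: simp_map_def[abs_def])

lemma simp_map_lev:
  assumes "msset (Suc n) X" "\<theta> \<in> dhom j k" "x \<in> lev X (k # ks)" "length ks = n"
  shows "simp_map X j k \<theta> ks x \<in> lev X (j # ks)"
  using msmap_lev[OF msmap_simp_map[OF assms(1,2)]] assms(3,4) by simp

lemma simp_map_act:
  assumes "msset (Suc n) X" "\<theta> \<in> dhom j k" "x \<in> lev X (k # ks)" "length ks = n" "\<phi> \<in> mhom js ks"
  shows "simp_map X j k \<theta> js (act X (k # js) (k # ks) (did k # \<phi>) x) =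
    act X (j # js) (j # ks) (did j # \<phi>) (simp_map X j k \<theta> ks x)"
  using msmap_act[OF msmap_simp_map[OF assms(1,2)] assms(5)] assms(3,4) by simp

lemma simp_map_simp_map:
  assumes "msset (Suc n) X" "\<theta> \<in> dhom i j" "\<theta>' \<in> dhom j k" "x \<in> lev X (k # ks)" "length ks = n"
  shows "simp_map X i j \<theta> ks (simp_map X j k \<theta>' ks x) = simp_map X i k (dcmp \<theta>' \<theta>) ks x"
  using assms by (simp add: simp_map_def msset_comp[OF assms(1)])

lemma msmap_simp_map_commute:
  assumes "msmap (Suc n) X Y f" "\<theta> \<in> dhom j k" "x \<in> lev X (k # ks)" "length ks = n"
  shows "f (j # ks) (simp_map X j k \<theta> ks x) = simp_map Y j k \<theta> ks (f (k # ks) x)"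
  using msmap_act[OF assms(1), of "\<theta> # mid ks" "j # ks" "k # ks"] assms by (simp add: simp_map_def)

section \<open>The Segal condition in terms of elements\<close>

abbreviation edge :: "'a mss \<Rightarrow> nat \<Rightarrow> nat \<Rightarrow> nat list \<Rightarrow> 'a \<Rightarrow> 'a" where
  "edge X k j \<equiv> simp_map X 1 k [j, Suc j]"

text \<open>Families are functions of which only the values below \<open>k\<close> count. This form
  avoids \<open>Tuple\<close>, so that strings can be moved between objects with different element
  types.\<close>

definition segal_bij :: "'a mss \<Rightarrow> nat \<Rightarrow> nat list \<Rightarrow> bool" where
  "segal_bij X k ks \<longleftrightarrow>
     (\<forall>x\<in>lev X (k # ks). \<forall>y\<in>lev X (k # ks). (\<forall>j<k. edge X k j ks x = edge X k j ks y) \<longrightarrow> x = y) \<and>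
     (\<forall>c. (\<forall>j<k. c j \<in> lev X (1 # ks)) \<longrightarrow>
        (\<forall>j. Suc j < k \<longrightarrow> tgt X ks (c j) = src X ks (c (Suc j))) \<longrightarrow>
        (\<exists>x\<in>lev X (k # ks). \<forall>j<k. edge X k j ks x = c j))"

lemma segal_bijD1:
  "segal_bij X k ks \<Longrightarrow> x \<in> lev X (k # ks) \<Longrightarrow> y \<in> lev X (k # ks) \<Longrightarrow>
    (\<And>j. j < k \<Longrightarrow> edge X k j ks x = edge X k j ks y) \<Longrightarrow> x = y"
  unfolding segal_bij_def by blast

lemma segal_bijD2:
  assumes "segal_bij X k ks" "\<And>j. j < k \<Longrightarrow> c j \<in> lev X (1 # ks)"
    "\<And>j. Suc j < k \<Longrightarrow> tgt X ks (c j) = src X ks (c (Suc j))"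
  obtains x where "x \<in> lev X (k # ks)" "\<And>j. j < k \<Longrightarrow> edge X k j ks x = c j"
  using assms unfolding segal_bij_def by metis

lemma edge_compatible:
  assumes "msset (Suc n) X" "x \<in> lev X (k # ks)" "length ks = n" "Suc j < k"
  shows "tgt X ks (edge X k j ks x) = src X ks (edge X k (Suc j) ks x)"
  using assms by (simp add: simp_map_simp_map vertex_in edge_in dcmp_def)

lemma edge_lev:
  assumes "msset (Suc n) X" "x \<in> lev X (k # ks)" "length ks = n" "j < k"
  shows "edge X k j ks x \<in> lev X (1 # ks)"
  using simp_map_lev[OF assms(1) edge_in assms(2,3)] assms(4) by simp

text \<open>Functoriality alone puts the Segal map into the fibre product and makes it compatible
  with the structure maps, so invertibility is a matter of bijectivity in each degree.\<close>

lemma segal_iff: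
  fixes X :: "'a elt mss"
  assumes X: "msset (Suc n) X"
  shows "segal (Suc n) X \<longleftrightarrow> (\<forall>k\<ge>2. \<forall>ks. length ks = n \<longrightarrow> segal_bij X k ks)"
proof -
  have "msiso n (slice X k) (fprod k (slice X 1) (src X) (tgt X)) (segal_map X k) \<longleftrightarrow>
     (\<forall>ks. length ks = n \<longrightarrow> segal_bij X k ks)" for k
  proof -
    let ?Z = "fprod k (slice X 1) (src X) (tgt X)"
    have sub: "segal_map X k ks x \<in> lev ?Z ks" if "length ks = n" "x \<in> lev X (k # ks)" for ks x
      using that X edge_lev[OF X] edge_compatible[OF X]
      by (auto simp: segal_map_def fprod_def chain_def intro!: imageI)
    have map: "msmap n (slice X k) ?Z (segal_map X k)"
      unfolding msmap_def
      using sub simp_map_act[OF X edge_in] by (auto simp: segal_map_def fprod_def)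
    have "bij_betw (segal_map X k ks) (lev X (k # ks)) (lev ?Z ks) \<longleftrightarrow> segal_bij X k ks"
      if len: "length ks = n" for ks
    proof
      assume b: "bij_betw (segal_map X k ks) (lev X (k # ks)) (lev ?Z ks)"
      show "segal_bij X k ks"
        unfolding segal_bij_def
      proof (intro conjI ballI allI impI)
        fix x y assume "x \<in> lev X (k # ks)" "y \<in> lev X (k # ks)"
          "\<forall>j<k. edge X k j ks x = edge X k j ks y"
        then show "x = y"
          using b by (auto simp: bij_betw_def inj_on_def segal_map_def)
      next
        fix c assume c: "\<forall>j<k. c j \<in> lev X (1 # ks)"
          "\<forall>j. Suc j < k \<longrightarrow> tgt X ks (c j) = src X ks (c (Suc j))"
        then have "Tuple (map c [0..<k]) \<in> lev ?Z ks"
          by (auto simp: fprod_def chain_def intro!: imageI)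
        then obtain x where "x \<in> lev X (k # ks)" "segal_map X k ks x = Tuple (map c [0..<k])"
          using b by (force simp: bij_betw_def)
        then show "\<exists>x\<in>lev X (k # ks). \<forall>j<k. edge X k j ks x = c j"
          by (intro bexI[of _ x]) (auto simp: segal_map_def)
      qed
    next
      assume b: "segal_bij X k ks"
      show "bij_betw (segal_map X k ks) (lev X (k # ks)) (lev ?Z ks)"
        unfolding bij_betw_def
      proof (intro conjI inj_onI equalityI subsetI)
        fix x y assume "x \<in> lev X (k # ks)" "y \<in> lev X (k # ks)" "segal_map X k ks x = segal_map X k ks y"
        then show "x = y" by (auto simp: segal_map_def intro: segal_bijD1[OF b, of x y])
      next
        fix z assume "z \<in> lev ?Z ks"
        then obtain xs where xs: "z = Tuple xs" "xs \<in> chain k (lev X (1 # ks)) (src X ks) (tgt X ks)"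
          by (auto simp: fprod_def)
        obtain x where x: "x \<in> lev X (k # ks)" "\<And>j. j < k \<Longrightarrow> edge X k j ks x = xs ! j"
        proof (rule segal_bijD2[OF b, of "(!) xs"])
          show "xs ! j \<in> lev X (1 # ks)" if "j < k" for j
            using xs(2) that nth_mem[of j xs] unfolding chain_def by blast
        qed (use xs(2) in \<open>auto simp: chain_def\<close>)
        have "map (\<lambda>j. edge X k j ks x) [0..<k] = xs"
          using xs(2) x(2) by (intro nth_equalityI) (auto simp: chain_def)
        then have "z = segal_map X k ks x" using xs(1) by (simp add: segal_map_def)
        then show "z \<in> segal_map X k ks ` lev X (k # ks)" using x(1) by blast
      qed (use sub len in auto)
    qed
    then show ?thesis using map by (auto simp: msiso_def)
  qed
  then show ?thesis by (auto simp: segal_def)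
qed

lemma nfold_cat_msset: "nfold_cat n X \<Longrightarrow> msset n X"
  by (cases n) auto

lemma nfold_cat_slice: "nfold_cat (Suc n) X \<Longrightarrow> nfold_cat n (slice X s)"
  by simp

lemma nfold_cat_slices: "nfold_cat (length ss + m) X \<Longrightarrow> nfold_cat m (slices X ss)"
proof (induction ss arbitrary: X)
  case (Cons s ss)
  then show ?case using Cons.IH[of "slice X s"] by simp
qed simp

lemma nfold_cat_segal_bij: "nfold_cat (Suc n) X \<Longrightarrow> 2 \<le> k \<Longrightarrow> length ks = n \<Longrightarrow> segal_bij X k ks"
  using segal_iff[of n X] by auto


section \<open>Isomorphism classes and equivalences\<close>

abbreviation in_hom :: "('o, 'm) cat \<Rightarrow> 'm \<Rightarrow> 'o \<Rightarrow> 'o \<Rightarrow> bool" where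
  "in_hom C f x y \<equiv> f \<in> Arr C \<and> dom C f = x \<and> cod C f = y"

text \<open>The inverse and the endpoints are kept explicit so that an isomorphism can be mapped by
  a functor, or lifted through projections, one half at a time.\<close>

definition inv_pair :: "('o, 'm) cat \<Rightarrow> 'm \<Rightarrow> 'm \<Rightarrow> 'o \<Rightarrow> 'o \<Rightarrow> bool" where
  "inv_pair C f g x y \<longleftrightarrow> in_hom C f x y \<and> in_hom C g y x \<and>
     cmp C g f = idn C x \<and> cmp C f g = idn C y"

lemma iso_arr_iff: "iso_arr C f \<longleftrightarrow> (\<exists>g. inv_pair C f g (dom C f) (cod C f))"
  by (auto simp: iso_arr_def inv_pair_def)

lemma inv_pair_iso_arr: "inv_pair C f g x y \<Longrightarrow> iso_arr C f"
  unfolding iso_arr_iff by (auto simp: inv_pair_def)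

lemma iso_objs_iff: "iso_objs C x y \<longleftrightarrow> (\<exists>f g. inv_pair C f g x y)"
  unfolding iso_objs_def iso_arr_iff by (auto simp: inv_pair_def)

lemma inv_pair_sym: "inv_pair C f g x y \<Longrightarrow> inv_pair C g f y x"
  by (auto simp: inv_pair_def)

lemma cat_objs: "category C \<Longrightarrow> in_hom C f x y \<Longrightarrow> x \<in> Obj C \<and> y \<in> Obj C"
  by (auto simp: category_def)

lemma cat_idn: "category C \<Longrightarrow> x \<in> Obj C \<Longrightarrow> in_hom C (idn C x) x x"
  by (auto simp: category_def)

lemma cat_cmp: "category C \<Longrightarrow> in_hom C f x y \<Longrightarrow> in_hom C g y z \<Longrightarrow> in_hom C (cmp C g f) x z"
  by (auto simp: category_def)

lemma cat_unit: "category C \<Longrightarrow> in_hom C f x y \<Longrightarrow> cmp C f (idn C x) = f \<and> cmp C (idn C y) f = f"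
  by (auto simp: category_def)

lemma cat_assoc: "category C \<Longrightarrow> in_hom C f x y \<Longrightarrow> in_hom C g y z \<Longrightarrow> in_hom C h z w \<Longrightarrow>
    cmp C (cmp C h g) f = cmp C h (cmp C g f)"
  by (auto simp: category_def)

lemma inv_pair_cancel:
  assumes C: "category C" and fg: "inv_pair C f g x y"
  shows "in_hom C h w x \<Longrightarrow> cmp C g (cmp C f h) = h"
  using cat_assoc[OF C, of h w x f y g x] cat_unit[OF C, of h w x] fg by (auto simp: inv_pair_def)

lemma inv_pair_trans:
  assumes C: "category C" and fg: "inv_pair C f g x y" and fg': "inv_pair C f' g' y z"
  shows "inv_pair C (cmp C f' f) (cmp C g g') x z"
proof -
  have h: "in_hom C f x y" "in_hom C g y x" "in_hom C f' y z" "in_hom C g' z y"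
    using fg fg' by (auto simp: inv_pair_def)
  have "cmp C (cmp C g g') (cmp C f' f) = cmp C g (cmp C g' (cmp C f' f))"
    by (rule cat_assoc[OF C cat_cmp[OF C h(1,3)] h(4,2)])
  also have "\<dots> = idn C x"
    using inv_pair_cancel[OF C fg' h(1)] fg by (auto simp: inv_pair_def)
  finally have 1: "cmp C (cmp C g g') (cmp C f' f) = idn C x" .
  have "cmp C (cmp C f' f) (cmp C g g') = cmp C f' (cmp C f (cmp C g g'))"
    by (rule cat_assoc[OF C cat_cmp[OF C h(4,2)] h(1,3)])
  also have "\<dots> = idn C z"
    using inv_pair_cancel[OF C inv_pair_sym[OF fg] h(4)] fg' by (auto simp: inv_pair_def)
  finally show ?thesis
    using 1 cat_cmp[OF C h(1,3)] cat_cmp[OF C h(4,2)] unfolding inv_pair_def by simp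
qed

lemma inv_pair_refl: "category C \<Longrightarrow> x \<in> Obj C \<Longrightarrow> inv_pair C (idn C x) (idn C x) x x"
  by (simp add: inv_pair_def cat_idn cat_unit[OF _ cat_idn])

lemma iso_objs_refl: "category C \<Longrightarrow> x \<in> Obj C \<Longrightarrow> iso_objs C x x"
  unfolding iso_objs_iff by (intro exI) (rule inv_pair_refl)

lemma iso_objs_sym: "iso_objs C x y \<Longrightarrow> iso_objs C y x"
  unfolding iso_objs_iff by (elim exE, intro exI) (rule inv_pair_sym)

lemma iso_objs_trans: "category C \<Longrightarrow> iso_objs C x y \<Longrightarrow> iso_objs C y z \<Longrightarrow> iso_objs C x z"
  unfolding iso_objs_iff by (elim exE, intro exI) (rule inv_pair_trans)

lemma iso_objs_Obj: "category C \<Longrightarrow> iso_objs C x y \<Longrightarrow> x \<in> Obj C \<and> y \<in> Obj C"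
  unfolding iso_objs_iff inv_pair_def by (elim exE conjE) (rule cat_objs, auto)

lemma iso_objs_cls: "category C \<Longrightarrow> x \<in> Obj C \<Longrightarrow> iso_objs C x (cls C x)"
  unfolding cls_def by (rule someI) (rule iso_objs_refl)

lemma cls_Obj: "category C \<Longrightarrow> x \<in> Obj C \<Longrightarrow> cls C x \<in> Obj C"
  by (rule conjunct2[OF iso_objs_Obj[OF _ iso_objs_cls]])

lemma cls_eq_iff: "category C \<Longrightarrow> x \<in> Obj C \<Longrightarrow> y \<in> Obj C \<Longrightarrow> cls C x = cls C y \<longleftrightarrow> iso_objs C x y"
proof
  assume C: "category C" "x \<in> Obj C" "y \<in> Obj C" and "cls C x = cls C y"
  then show "iso_objs C x y"
    using iso_objs_trans[OF C(1) iso_objs_cls[OF C(1,2)]] iso_objs_sym[OF iso_objs_cls[OF C(1,3)]]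
    by simp
next
  assume C: "category C" "x \<in> Obj C" "y \<in> Obj C" and "iso_objs C x y"
  \<comment> \<open>The choice in \<open>cls\<close> sees the object only through this predicate,
    hence isomorphic objects get literally the same representative.\<close>
  then have "iso_objs C x = iso_objs C y"
    using iso_objs_trans[OF C(1)] iso_objs_sym[of C] by (intro ext iffI) blast+
  then show "cls C x = cls C y" by (simp add: cls_def)
qed

lemma cls_cls: "category C \<Longrightarrow> x \<in> Obj C \<Longrightarrow> cls C (cls C x) = cls C x"
  by (rule iffD2[OF cls_eq_iff]) (auto intro: cls_Obj iso_objs_sym[OF iso_objs_cls])

text \<open>\<open>cls\<close> is idempotent, so the chosen representatives are its fixed points. An
  element of \<open>pn X\<close> is therefore an object of \<open>X\<close> itself, and maps defined
  on \<open>X\<close> apply to it.\<close>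

lemma p_cat_iff: "category C \<Longrightarrow> x \<in> p_cat C \<longleftrightarrow> x \<in> Obj C \<and> cls C x = x"
  unfolding p_cat_def by (auto simp: cls_Obj cls_cls intro: rev_image_eqI)

lemma functor_fob: "is_functor C D F \<Longrightarrow> x \<in> Obj C \<Longrightarrow> fob F x \<in> Obj D"
  by (simp add: is_functor_def)

lemma functor_idn: "is_functor C D F \<Longrightarrow> x \<in> Obj C \<Longrightarrow> far F (idn C x) = idn D (fob F x)"
  by (simp add: is_functor_def)

lemma functor_far: "is_functor C D F \<Longrightarrow> in_hom C f x y \<Longrightarrow> in_hom D (far F f) (fob F x) (fob F y)"
  by (auto simp: is_functor_def)

lemma functor_cmp: "is_functor C D F \<Longrightarrow> in_hom C f x y \<Longrightarrow> in_hom C g y z \<Longrightarrow>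
    far F (cmp C g f) = cmp D (far F g) (far F f)"
  by (auto simp: is_functor_def)

lemma functor_inv_pair:
  assumes "category C" "is_functor C D F" "inv_pair C f g x y"
  shows "inv_pair D (far F f) (far F g) (fob F x) (fob F y)"
proof -
  have h: "in_hom C f x y" "in_hom C g y x" "cmp C g f = idn C x" "cmp C f g = idn C y"
    using assms(3) by (auto simp: inv_pair_def)
  then show ?thesis
    unfolding inv_pair_def
    using functor_far[OF assms(2) h(1)] functor_far[OF assms(2) h(2)]
      functor_cmp[OF assms(2) h(1,2)] functor_cmp[OF assms(2) h(2,1)]
      functor_idn[OF assms(2)] cat_objs[OF assms(1) h(1)] by simp
qed

lemma functor_iso_objs:
  "category C \<Longrightarrow> is_functor C D F \<Longrightarrow> iso_objs C x y \<Longrightarrow> iso_objs D (fob F x) (fob F y)"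
  unfolding iso_objs_iff by (elim exE, intro exI) (rule functor_inv_pair)

lemma functor_cls:
  assumes "category C" "category D" "is_functor C D F" "x \<in> Obj C"
  shows "cls D (fob F (cls C x)) = cls D (fob F x)"
  by (rule iffD2[OF cls_eq_iff[OF assms(2)]])
    (use assms in \<open>auto intro: functor_fob cls_Obj iso_objs_sym functor_iso_objs iso_objs_cls\<close>)

section \<open>Fully faithful functors and equivalences\<close>

definition fully_faithful ::
    "('o, 'm) cat \<Rightarrow> ('o2, 'm2) cat \<Rightarrow> ('o, 'm, 'o2, 'm2) ftr \<Rightarrow> bool" where
  "fully_faithful C D F \<longleftrightarrow>
     (\<forall>x\<in>Obj C. \<forall>y\<in>Obj C. \<forall>g. in_hom D g (fob F x) (fob F y) \<longrightarrow>
        (\<exists>!f. in_hom C f x y \<and> far F f = g))"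

lemma equivalence_if_fully_faithful:
  assumes C: "category C" and D: "category D" and F: "is_functor C D F"
    and ff: "fully_faithful C D F" and surj: "\<And>y. y \<in> Obj D \<Longrightarrow> \<exists>x\<in>Obj C. iso_objs D (fob F x) y"
  shows "equivalence C D F"
proof -
  have "\<forall>y. \<exists>x f g. y \<in> Obj D \<longrightarrow> x \<in> Obj C \<and> inv_pair D f g (fob F x) y"
    using surj unfolding iso_objs_iff by blast
  then obtain G e e' where Gee: "y \<in> Obj D \<longrightarrow> G y \<in> Obj C \<and> inv_pair D (e y) (e' y) (fob F (G y)) y" for y
    by metis
  have G: "G y \<in> Obj C" and e: "inv_pair D (e y) (e' y) (fob F (G y)) y"
    and eh: "in_hom D (e y) (fob F (G y)) y" and e'h: "in_hom D (e' y) y (fob F (G y))"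
    if "y \<in> Obj D" for y
    using Gee that by (auto simp: inv_pair_def)
  define lift where "lift x y g = (THE f. in_hom C f x y \<and> far F f = g)" for x y g
  have lift: "in_hom C (lift x y g) x y \<and> far F (lift x y g) = g"
    if "x \<in> Obj C" "y \<in> Obj C" "in_hom D g (fob F x) (fob F y)" for x y g
    unfolding lift_def by (rule theI') (use ff that in \<open>simp add: fully_faithful_def\<close>)
  have faithful: "f = f'" if "in_hom C f x y" "in_hom C f' x y" "far F f = far F f'" for f f' x y
  proof -
    have "\<exists>!f''. in_hom C f'' x y \<and> far F f'' = far F f"
      using ff cat_objs[OF C that(1)] functor_far[OF F that(1)] unfolding fully_faithful_def by blast
    then show ?thesis using that by metis
  qed
  \<comment> \<open>Conjugation by the chosen isomorphisms makes an arrow of \<open>D\<close> run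
    between objects in the image of \<open>F\<close>; its unique lift is the value of the inverse
    functor.\<close>
  define K where "K g = cmp D (e' (cod D g)) (cmp D g (e (dom D g)))" for g
  have K: "in_hom D (K g) (fob F (G x)) (fob F (G y))" if "in_hom D g x y" for g x y
    using that cat_objs[OF D that] cat_cmp[OF D cat_cmp[OF D eh that] e'h] by (auto simp: K_def)
  define GG where "GG = \<lparr>fob = G, far = \<lambda>g. lift (G (dom D g)) (G (cod D g)) (K g)\<rparr>"
  have GGfar: "in_hom C (far GG g) (G x) (G y) \<and> far F (far GG g) = K g" if "in_hom D g x y" for g x y
    using lift[OF G G K[OF that]] cat_objs[OF D that] that by (auto simp: GG_def)
  have GGfob: "fob GG y = G y" for y by (simp add: GG_def)
  have eK: "cmp D (e y) (K g) = cmp D g (e x)" if "in_hom D g x y" for g x y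
    using inv_pair_cancel[OF D inv_pair_sym[OF e] cat_cmp[OF D eh that]] cat_objs[OF D that] that
    by (auto simp: K_def)
  have funG: "is_functor D C GG"
    unfolding is_functor_def
  proof (intro conjI ballI impI)
    fix y assume y: "y \<in> Obj D"
    show "fob GG y \<in> Obj C" using G[OF y] by (simp add: GGfob)
    have "K (idn D y) = idn D (fob F (G y))"
      using cat_idn[OF D y] cat_unit[OF D eh[OF y]] e[OF y] by (simp add: K_def inv_pair_def)
    then show "far GG (idn D y) = idn C (fob GG y)"
      using faithful[of "far GG (idn D y)" "G y" "G y" "idn C (G y)"]
        GGfar[OF cat_idn[OF D y]] cat_idn[OF C G[OF y]] functor_idn[OF F G[OF y]] GGfob by simp
  next
    fix g assume "g \<in> Arr D"
    then show "far GG g \<in> Arr C" "dom C (far GG g) = fob GG (dom D g)" "cod C (far GG g) = fob GG (cod D g)"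
      using GGfar[of g] by (auto simp: GGfob)
  next
    fix g h assume gh: "g \<in> Arr D" "h \<in> Arr D" "cod D g = dom D h"
    define x y z where xyz: "x = dom D g" "y = dom D h" "z = cod D h"
    have g: "in_hom D g x y" and h: "in_hom D h y z" using gh xyz by auto
    note o = cat_objs[OF D g] cat_objs[OF D h]
    have "cmp D (K h) (K g) = cmp D (cmp D (e' z) (cmp D h (e y))) (K g)"
      using xyz by (simp add: K_def)
    also have "\<dots> = cmp D (e' z) (cmp D (cmp D h (e y)) (K g))"
      using cat_assoc[OF D K[OF g] cat_cmp[OF D eh h] e'h] o by blast
    also have "cmp D (cmp D h (e y)) (K g) = cmp D h (cmp D g (e x))"
      using cat_assoc[OF D K[OF g] eh h] eK[OF g] o by simp
    also have "\<dots> = cmp D (cmp D h g) (e x)"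
      using cat_assoc[OF D eh g h] o by simp
    finally have KK: "cmp D (K h) (K g) = K (cmp D h g)"
      using cat_cmp[OF D g h] by (simp add: K_def)
    show "far GG (cmp D h g) = cmp C (far GG h) (far GG g)"
    proof (rule faithful)
      show "in_hom C (far GG (cmp D h g)) (G x) (G z)" using GGfar[OF cat_cmp[OF D g h]] by simp
      show "in_hom C (cmp C (far GG h) (far GG g)) (G x) (G z)"
        using cat_cmp[OF C, of "far GG g" "G x" "G y" "far GG h" "G z"] GGfar[OF g] GGfar[OF h] by simp
      show "far F (far GG (cmp D h g)) = far F (cmp C (far GG h) (far GG g))"
        using functor_cmp[OF F, of "far GG g" "G x" "G y" "far GG h" "G z"]
          GGfar[OF g] GGfar[OF h] GGfar[OF cat_cmp[OF D g h]] KK by simp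
    qed
  qed
  \<comment> \<open>The unit at \<open>x\<close> and its inverse are the lifts of \<open>e'\<close>
    and \<open>e\<close> at \<open>F x\<close>; faithfulness carries the inverse laws and naturality
    back from \<open>D\<close>.\<close>
  define \<eta> where "\<eta> x = lift x (G (fob F x)) (e' (fob F x))" for x
  define \<eta>' where "\<eta>' x = lift (G (fob F x)) x (e (fob F x))" for x
  have \<eta>: "in_hom C (\<eta> x) x (G (fob F x)) \<and> far F (\<eta> x) = e' (fob F x)"
    and \<eta>': "in_hom C (\<eta>' x) (G (fob F x)) x \<and> far F (\<eta>' x) = e (fob F x)" if "x \<in> Obj C" for x
    using lift[OF that G e'h] lift[OF G that eh] functor_fob[OF F that] unfolding \<eta>_def \<eta>'_def by auto
  have pair: "inv_pair C (\<eta> x) (\<eta>' x) x (G (fob F x))" if x: "x \<in> Obj C" for x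
  proof -
    have h: "in_hom C (\<eta> x) x (G (fob F x))" "in_hom C (\<eta>' x) (G (fob F x)) x"
      and Gx: "G (fob F x) \<in> Obj C"
      using \<eta>[OF x] \<eta>'[OF x] G functor_fob[OF F x] by auto
    have ee: "inv_pair D (e (fob F x)) (e' (fob F x)) (fob F (G (fob F x))) (fob F x)"
      using e functor_fob[OF F x] by blast
    have "cmp C (\<eta>' x) (\<eta> x) = idn C x"
      using faithful[OF cat_cmp[OF C h] cat_idn[OF C x]] functor_cmp[OF F h] functor_idn[OF F x]
        \<eta>[OF x] \<eta>'[OF x] ee by (simp add: inv_pair_def)
    moreover have "cmp C (\<eta> x) (\<eta>' x) = idn C (G (fob F x))"
      using faithful[OF cat_cmp[OF C h(2,1)] cat_idn[OF C Gx]] functor_cmp[OF F h(2,1)]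
        functor_idn[OF F Gx] \<eta>[OF x] \<eta>'[OF x] ee by (simp add: inv_pair_def)
    ultimately show ?thesis using h by (simp add: inv_pair_def)
  qed
  have "nat_iso C C id_ftr (cmp_ftr GG F) \<eta>"
    unfolding nat_iso_def
  proof (intro conjI ballI)
    fix x assume x: "x \<in> Obj C"
    show "iso_arr C (\<eta> x)" "dom C (\<eta> x) = fob id_ftr x" "cod C (\<eta> x) = fob (cmp_ftr GG F) x"
      using inv_pair_iso_arr[OF pair[OF x]] \<eta>[OF x] by (auto simp: id_ftr_def cmp_ftr_def GGfob)
  next
    fix f assume "f \<in> Arr C"
    define x y where xy: "x = dom C f" "y = cod C f"
    have f: "in_hom C f x y" using \<open>f \<in> Arr C\<close> xy by auto
    note o = cat_objs[OF C f]
    note Ff = functor_far[OF F f]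
    have Fo: "fob F x \<in> Obj D" "fob F y \<in> Obj D" using o functor_fob[OF F] by auto
    have hx: "in_hom C (\<eta> x) x (G (fob F x))" and hy: "in_hom C (\<eta> y) y (G (fob F y))"
      using \<eta> o by auto
    have hG: "in_hom C (far GG (far F f)) (G (fob F x)) (G (fob F y))" using GGfar[OF Ff] by simp
    have "far F (cmp C (far GG (far F f)) (\<eta> x)) = cmp D (K (far F f)) (e' (fob F x))"
      using functor_cmp[OF F hx hG] GGfar[OF Ff] \<eta> o by simp
    also have "\<dots> = cmp D (cmp D (e' (fob F y)) (cmp D (far F f) (e (fob F x)))) (e' (fob F x))"
      using Ff by (simp add: K_def)
    also have "\<dots> = cmp D (e' (fob F y)) (cmp D (cmp D (far F f) (e (fob F x))) (e' (fob F x)))"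
      using cat_assoc[OF D e'h cat_cmp[OF D eh Ff] e'h] Fo by blast
    also have "cmp D (cmp D (far F f) (e (fob F x))) (e' (fob F x)) = far F f"
      using cat_assoc[OF D e'h eh Ff] cat_unit[OF D Ff] e Fo by (simp add: inv_pair_def)
    also have "cmp D (e' (fob F y)) (far F f) = far F (cmp C (\<eta> y) f)"
      using functor_cmp[OF F f hy] \<eta> o by simp
    finally have "cmp C (far GG (far F f)) (\<eta> x) = cmp C (\<eta> y) f"
      using faithful[OF cat_cmp[OF C hx hG] cat_cmp[OF C f hy]] by simp
    then show "cmp C (\<eta> (cod C f)) (far id_ftr f) = cmp C (far (cmp_ftr GG F) f) (\<eta> (dom C f))"
      using xy by (simp add: id_ftr_def cmp_ftr_def)
  qed
  \<comment> \<open>The counit is the chosen \<open>e\<close> itself, and \<open>eK\<close> is its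
    naturality.\<close>
  moreover have "nat_iso D D (cmp_ftr F GG) id_ftr e"
    unfolding nat_iso_def
    using e[THEN inv_pair_iso_arr] eh eK GGfar by (auto simp: id_ftr_def cmp_ftr_def GGfob)
  ultimately show ?thesis
    unfolding equivalence_def using F funG by blast
qed


section \<open>Nerves of categories and the functor p\<close>

lemma cat_of_sel [simp]:
  "Obj (cat_of X) = lev X [0]" "Arr (cat_of X) = lev X [Suc 0]"
  "dom (cat_of X) = act X [0] [Suc 0] [[0]]" "cod (cat_of X) = act X [0] [Suc 0] [[Suc 0]]"
  "idn (cat_of X) = act X [Suc 0] [0] [[0, 0]]"
  by (simp_all add: cat_of_def)

lemma act1_act1:
  assumes "msset (Suc 0) X" "f \<in> dhom i j" "g \<in> dhom j k" "x \<in> lev X [k]"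
  shows "act X [i] [j] [f] (act X [j] [k] [g] x) = act X [i] [k] [dcmp g f] x"
  using msset_comp[OF assms(1), of "[f]" "[i]" "[j]" "[g]" "[k]" x] assms by simp

lemma act1_lev:
  "msset (Suc 0) X \<Longrightarrow> f \<in> dhom j k \<Longrightarrow> x \<in> lev X [k] \<Longrightarrow> act X [j] [k] [f] x \<in> lev X [j]"
  using msset_act[of "Suc 0" X "[f]" "[j]" "[k]"] by simp

lemma act1_id: "msset (Suc 0) X \<Longrightarrow> x \<in> lev X [k] \<Longrightarrow> act X [k] [k] [did k] x = x"
  using msset_id[of "Suc 0" X "[k]"] by simp

text \<open>By the Segal condition for \<open>k = 2\<close> a 2-simplex is determined by its short
  edges, so the description in \<open>cmp (cat_of X)\<close> picks exactly \<open>x\<close>.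
  Identities between composites can thus be shown by exhibiting a simplex.\<close>

lemma nerve_cmp:
  assumes N: "nfold_cat (Suc 0) X" and x: "x \<in> lev X [2]"
  shows "cmp (cat_of X) (act X [Suc 0] [2] [[Suc 0, 2]] x) (act X [Suc 0] [2] [[0, Suc 0]] x) =
    act X [Suc 0] [2] [[0, 2]] x"
proof -
  have "(THE z. z \<in> lev X [2] \<and> act X [1] [2] [[0, 1]] z = act X [Suc 0] [2] [[0, Suc 0]] x \<and>
      act X [1] [2] [[1, 2]] z = act X [Suc 0] [2] [[Suc 0, 2]] x) = x"
  proof (rule the_equality)
    fix z assume z: "z \<in> lev X [2] \<and> act X [1] [2] [[0, 1]] z = act X [Suc 0] [2] [[0, Suc 0]] x \<and>
      act X [1] [2] [[1, 2]] z = act X [Suc 0] [2] [[Suc 0, 2]] x"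
    show "z = x"
    proof (rule segal_bijD1[OF nfold_cat_segal_bij[OF N, of 2 "[]"]])
      fix j :: nat assume "j < 2"
      then have "j = 0 \<or> j = 1" by auto
      then show "edge X 2 j [] z = edge X 2 j [] x"
        using z by (auto simp: simp_map_def numeral_2_eq_2)
    qed (use x z in auto)
  qed (use x in auto)
  then show ?thesis by (simp add: cat_of_def)
qed

lemma nerve_filler:
  assumes N: "nfold_cat (Suc 0) X" and fg: "f \<in> lev X [Suc 0]" "g \<in> lev X [Suc 0]"
    "act X [0] [Suc 0] [[Suc 0]] f = act X [0] [Suc 0] [[0]] g"
  obtains x where "x \<in> lev X [2]" "act X [Suc 0] [2] [[0, Suc 0]] x = f" "act X [Suc 0] [2] [[Suc 0, 2]] x = g"
proof (rule segal_bijD2[OF nfold_cat_segal_bij[OF N, of 2 "[]"], of "\<lambda>j. if j = 0 then f else g"])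
  fix x assume x: "x \<in> lev X [2]" "\<And>j. j < 2 \<Longrightarrow> edge X 2 j [] x = (if j = 0 then f else g)"
  show thesis
    using that[OF x(1)] x(2)[of 0] x(2)[of "Suc 0"] by (simp add: simp_map_def numeral_2_eq_2)
qed (use fg in \<open>auto simp: simp_map_def less_2_cases_iff\<close>)

lemma nerve_filler3:
  assumes N: "nfold_cat (Suc 0) X" and fgh: "f \<in> lev X [Suc 0]" "g \<in> lev X [Suc 0]" "h \<in> lev X [Suc 0]"
    "act X [0] [Suc 0] [[Suc 0]] f = act X [0] [Suc 0] [[0]] g"
    "act X [0] [Suc 0] [[Suc 0]] g = act X [0] [Suc 0] [[0]] h"
  obtains x where "x \<in> lev X [3]" "act X [Suc 0] [3] [[0, Suc 0]] x = f"
    "act X [Suc 0] [3] [[Suc 0, 2]] x = g" "act X [Suc 0] [3] [[2, 3]] x = h"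
proof (rule segal_bijD2[OF nfold_cat_segal_bij[OF N, of 3 "[]"],
      of "\<lambda>j. if j = 0 then f else if j = 1 then g else h"])
  fix x assume x: "x \<in> lev X [3]"
    "\<And>j. j < 3 \<Longrightarrow> edge X 3 j [] x = (if j = 0 then f else if j = 1 then g else h)"
  show thesis
    using that[OF x(1)] x(2)[of 0] x(2)[of "Suc 0"] x(2)[of 2]
    by (simp add: simp_map_def eval_nat_numeral)
next
  fix j :: nat assume "Suc j < 3"
  then have "j = 0 \<or> j = 1" by auto
  then show "tgt X [] (if j = 0 then f else if j = 1 then g else h) =
    src X [] (if Suc j = 0 then f else if Suc j = 1 then g else h)"
    using fgh by (auto simp: simp_map_def)
qed (use fgh in \<open>auto simp: simp_map_def\<close>)

lemma category_cat_of:
  assumes N: "nfold_cat (Suc 0) X"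
  shows "category (cat_of X)"
proof -
  note M = nfold_cat_msset[OF N]
  note a = act1_act1[OF M] act1_lev[OF M] dhom_iff dcmp_def
  note did1 = act1_id[OF M, where k = "Suc 0", unfolded did_def, simplified]
  note did0 = act1_id[OF M, where k = 0, simplified]
  show ?thesis
    unfolding category_def
  proof (intro conjI ballI impI)
    fix f assume f: "f \<in> Arr (cat_of X)"
    then show "dom (cat_of X) f \<in> Obj (cat_of X)" "cod (cat_of X) f \<in> Obj (cat_of X)"
      by (auto simp: a)
    \<comment> \<open>The unit laws are read off the two degenerate 2-simplices on \<open>f\<close>,
      with vertices 0, 0, 1 and 0, 1, 1.\<close>
    show "cmp (cat_of X) f (idn (cat_of X) (dom (cat_of X) f)) = f"
      using nerve_cmp[OF N, of "act X [2] [Suc 0] [[0, 0, Suc 0]] f"] f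
      by (simp add: a did1)
    show "cmp (cat_of X) (idn (cat_of X) (cod (cat_of X) f)) f = f"
      using nerve_cmp[OF N, of "act X [2] [Suc 0] [[0, Suc 0, Suc 0]] f"] f
      by (simp add: a did1)
  next
    fix x assume x: "x \<in> Obj (cat_of X)"
    then show "idn (cat_of X) x \<in> Arr (cat_of X)" "dom (cat_of X) (idn (cat_of X) x) = x"
      "cod (cat_of X) (idn (cat_of X) x) = x"
      by (simp_all add: a did0)
  next
    fix f g assume fg: "f \<in> Arr (cat_of X)" "g \<in> Arr (cat_of X)" "cod (cat_of X) f = dom (cat_of X) g"
    obtain x where x: "x \<in> lev X [2]" "act X [Suc 0] [2] [[0, Suc 0]] x = f"
        "act X [Suc 0] [2] [[Suc 0, 2]] x = g"
      using nerve_filler[OF N, of f g] fg by auto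
    note c = nerve_cmp[OF N x(1), unfolded x(2,3)]
    show "cmp (cat_of X) g f \<in> Arr (cat_of X)"
      "dom (cat_of X) (cmp (cat_of X) g f) = dom (cat_of X) f"
      "cod (cat_of X) (cmp (cat_of X) g f) = cod (cat_of X) g"
      using x(1) unfolding c by (simp_all add: a flip: x(2,3))
  next
    fix f g h assume fgh: "f \<in> Arr (cat_of X)" "g \<in> Arr (cat_of X)" "h \<in> Arr (cat_of X)"
      "cod (cat_of X) f = dom (cat_of X) g" "cod (cat_of X) g = dom (cat_of X) h"
    obtain w where w: "w \<in> lev X [3]" "act X [Suc 0] [3] [[0, Suc 0]] w = f"
        "act X [Suc 0] [3] [[Suc 0, 2]] w = g" "act X [Suc 0] [3] [[2, 3]] w = h"
      using nerve_filler3[OF N, of f g h] fgh by auto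
    \<comment> \<open>Each 2-face of the 3-simplex \<open>w\<close> exhibits one composite; both
      bracketings are its edge from 0 to 3.\<close>
    have face: "cmp (cat_of X) (act X [Suc 0] [3] [[j, k]] w) (act X [Suc 0] [3] [[i, j]] w) =
        act X [Suc 0] [3] [[i, k]] w" if "i \<le> j" "j \<le> k" "k \<le> 3" for i j k
      using nerve_cmp[OF N, of "act X [2] [3] [[i, j, k]] w"] w(1) that by (simp add: a)
    show "cmp (cat_of X) h (cmp (cat_of X) g f) = cmp (cat_of X) (cmp (cat_of X) h g) f"
      using face[of 0 1 2] face[of 0 2 3] face[of 1 2 3] face[of 0 1 3] by (simp add: w)
  qed
qed

text \<open>Composites are preserved because \<open>f\<close> sends the 2-simplex that exhibits a
  composite to a 2-simplex over the images of its edges.\<close>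

lemma functor_ftr_of:
  assumes X: "nfold_cat (Suc 0) X" and Y: "nfold_cat (Suc 0) Y" and f: "msmap (Suc 0) X Y f"
  shows "is_functor (cat_of X) (cat_of Y) (ftr_of f)"
proof -
  note l = msmap_lev[OF f]
  have a: "f [j] (act X [j] [k] [\<theta>] x) = act Y [j] [k] [\<theta>] (f [k] x)"
    if "\<theta> \<in> dhom j k" "x \<in> lev X [k]" for j k \<theta> x
    using msmap_act[OF f, of "[\<theta>]" "[j]" "[k]" x] that by simp
  have "f [Suc 0] (cmp (cat_of X) v u) = cmp (cat_of Y) (f [Suc 0] v) (f [Suc 0] u)"
    if uv: "u \<in> lev X [Suc 0]" "v \<in> lev X [Suc 0]"
      "act X [0] [Suc 0] [[Suc 0]] u = act X [0] [Suc 0] [[0]] v" for u v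
  proof -
    obtain x where x: "x \<in> lev X [2]" "act X [Suc 0] [2] [[0, Suc 0]] x = u"
        "act X [Suc 0] [2] [[Suc 0, 2]] x = v"
      using nerve_filler[OF X uv] by auto
    have "f [Suc 0] (cmp (cat_of X) v u) = f [Suc 0] (act X [Suc 0] [2] [[0, 2]] x)"
      using nerve_cmp[OF X x(1)] x by simp
    also have "\<dots> = cmp (cat_of Y) (f [Suc 0] v) (f [Suc 0] u)"
      using nerve_cmp[OF Y, of "f [2] x"] l[of "[2]" x] x(1) by (simp add: a dhom_iff flip: x(2,3))
    finally show ?thesis .
  qed
  then show ?thesis
    unfolding is_functor_def by (auto simp: ftr_of_def l a dhom_iff)
qed

lemma J_sel [simp]:
  "dcat (J X) ks = cat_of (slices X ks)"
  "dftr (J X) js ks \<phi> = ftr_of (\<lambda>s. act X (js @ s) (ks @ s) (\<phi> @ mid s))"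
  by (simp_all add: J_def)

lemma ftr_of_sel [simp]: "fob (ftr_of f) = f [0]" "far (ftr_of f) = f [Suc 0]"
  by (simp_all add: ftr_of_def)

lemma category_J: "nfold_cat (Suc m) X \<Longrightarrow> length ks = m \<Longrightarrow> category (cat_of (slices X ks))"
  using category_cat_of[OF nfold_cat_slices[of ks "Suc 0" X]] by simp

lemma functor_J:
  assumes "nfold_cat (Suc m) X" "\<phi> \<in> mhom js ks" "length ks = m"
  shows "is_functor (cat_of (slices X ks)) (cat_of (slices X js))
    (ftr_of (\<lambda>s. act X (js @ s) (ks @ s) (\<phi> @ mid s)))"
  using assms mhom_length[OF assms(2)] nfold_cat_msset[OF assms(1)]
  by (intro functor_ftr_of nfold_cat_slices msmap_structure) auto

lemma functor_J_map:
  assumes "nfold_cat (Suc m) X" "nfold_cat (Suc m) Y" "msmap (Suc m) X Y f" "length ks = m"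
  shows "is_functor (cat_of (slices X ks)) (cat_of (slices Y ks)) (ftr_of (\<lambda>s. f (ks @ s)))"
  using assms by (intro functor_ftr_of nfold_cat_slices msmap_slices) auto

section \<open>The functor p on n-fold categories and on their maps\<close>

lemma pn_lev: "lev (pn X) ks = p_cat (cat_of (slices X ks))"
  by (simp add: pbar_def)

lemma pn_lev_iff:
  "nfold_cat (Suc m) X \<Longrightarrow> length ks = m \<Longrightarrow>
    x \<in> lev (pn X) ks \<longleftrightarrow> x \<in> lev X (ks @ [0]) \<and> cls (cat_of (slices X ks)) x = x"
  by (simp add: pn_lev p_cat_iff category_J)

lemma pn_act: "act (pn X) js ks \<phi> x =
    cls (cat_of (slices X js)) (act X (js @ [0]) (ks @ [0]) (\<phi> @ [[0]]) x)"
  by (simp add: pbar_def)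

lemma pn_slices: "pn (slices X ss) = slices (pn X) ss"
  by (simp add: pbar_def slices_def)

lemma cls_lev_pn:
  "nfold_cat (Suc m) X \<Longrightarrow> length ks = m \<Longrightarrow> x \<in> lev X (ks @ [0]) \<Longrightarrow>
    cls (cat_of (slices X ks)) x \<in> lev (pn X) ks"
  by (simp add: pn_lev p_cat_def)

text \<open>Functors preserve isomorphism, so choosing a representative before a structure map does
  not affect the class of the result. This makes \<open>pn X\<close> strictly functorial in spite of
  the choices.\<close>

lemma cls_act_cls:
  assumes "nfold_cat (Suc m) X" "\<phi> \<in> mhom js ks" "length ks = m" "x \<in> lev X (ks @ [0])"
  shows "cls (cat_of (slices X js)) (act X (js @ [0]) (ks @ [0]) (\<phi> @ [[0]]) (cls (cat_of (slices X ks)) x)) =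
    cls (cat_of (slices X js)) (act X (js @ [0]) (ks @ [0]) (\<phi> @ [[0]]) x)"
  using functor_cls[OF category_J category_J functor_J[OF assms(1-3)], of m m x] assms
    mhom_length[OF assms(2)] by simp

lemma cls_map_cls:
  assumes "nfold_cat (Suc m) X" "nfold_cat (Suc m) Y" "msmap (Suc m) X Y f" "length ks = m"
    "x \<in> lev X (ks @ [0])"
  shows "cls (cat_of (slices Y ks)) (f (ks @ [0]) (cls (cat_of (slices X ks)) x)) =
    cls (cat_of (slices Y ks)) (f (ks @ [0]) x)"
  using functor_cls[OF category_J category_J functor_J_map[OF assms(1-4)], of m m x] assms by simp

lemma act_snoc_lev:
  assumes "msset (Suc m) X" "\<phi> \<in> mhom js ks" "length ks = m" "\<theta> \<in> dhom j k" "x \<in> lev X (ks @ [k])"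
  shows "act X (js @ [j]) (ks @ [k]) (\<phi> @ [\<theta>]) x \<in> lev X (js @ [j])"
  using assms by (intro msset_act[OF assms(1)] mhom_append) auto

lemma act_snoc_act_snoc:
  assumes "msset (Suc m) X" "\<phi> \<in> mhom is js" "\<psi> \<in> mhom js ks" "length ks = m"
    "\<theta> \<in> dhom i j" "\<theta>' \<in> dhom j k" "x \<in> lev X (ks @ [k])"
  shows "act X (is @ [i]) (js @ [j]) (\<phi> @ [\<theta>]) (act X (js @ [j]) (ks @ [k]) (\<psi> @ [\<theta>']) x) =
    act X (is @ [i]) (ks @ [k]) (mcmp \<psi> \<phi> @ [dcmp \<theta>' \<theta>]) x"
  using assms mhom_length[OF assms(2)] mhom_length[OF assms(3)]
  by (subst msset_comp[OF assms(1)]) (auto intro: mhom_append)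

lemma zero_in_dhom [simp]: "[0] \<in> dhom 0 k"
  by (simp add: dhom_iff)

lemma dcmp_zero [simp]: "dcmp [0] [0] = [0]"
  by (simp add: dcmp_def)

lemma msset_pn:
  assumes X: "nfold_cat (Suc m) X"
  shows "msset m (pn X)"
proof -
  note M = nfold_cat_msset[OF X]
  have "act (pn X) js ks \<phi> x \<in> lev (pn X) js"
    if "\<phi> \<in> mhom js ks" "x \<in> lev (pn X) ks" "length ks = m" for js ks \<phi> x
    unfolding pn_act using that mhom_length[OF that(1)]
    by (intro cls_lev_pn[OF X] act_snoc_lev[OF M]) (auto simp: pn_lev_iff[OF X])
  moreover have "act (pn X) ks ks (mid ks) x = x" if "x \<in> lev (pn X) ks" "length ks = m" for ks x
    using that msset_id[OF M, of "ks @ [0]"] by (simp add: pn_lev_iff[OF X] pn_act)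
  moreover have "act (pn X) is ks (mcmp \<psi> \<phi>) x = act (pn X) is js \<phi> (act (pn X) js ks \<psi> x)"
    if "\<phi> \<in> mhom is js" "\<psi> \<in> mhom js ks" "x \<in> lev (pn X) ks" "length ks = m" for "is" js ks \<phi> \<psi> x
    using that mhom_length[OF that(2)]
    by (simp add: pn_act pn_lev_iff[OF X] cls_act_cls[OF X] act_snoc_lev[OF M] act_snoc_act_snoc[OF M])
  ultimately show ?thesis unfolding msset_def by blast
qed

lemma pn_map_lev:
  assumes "nfold_cat (Suc m) X" "nfold_cat (Suc m) Y" "msmap (Suc m) X Y f" "length ks = m"
    "x \<in> lev X (ks @ [0])"
  shows "pn_map Y f ks x \<in> lev (pn Y) ks"
  using cls_lev_pn[OF assms(2,4)] msmap_lev[OF assms(3), of "ks @ [0]" x] assms(4,5) by (simp add: pn_map_def)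

lemma msmap_pn:
  assumes X: "nfold_cat (Suc m) X" and Y: "nfold_cat (Suc m) Y" and f: "msmap (Suc m) X Y f"
  shows "msmap m (pn X) (pn Y) (pn_map Y f)"
proof -
  note M = nfold_cat_msset[OF X]
  have "pn_map Y f js (act (pn X) js ks \<phi> x) = act (pn Y) js ks \<phi> (pn_map Y f ks x)"
    if "\<phi> \<in> mhom js ks" "x \<in> lev (pn X) ks" "length ks = m" for js ks \<phi> x
    using that mhom_length[OF that(1)]
    by (simp add: pn_act pn_lev_iff[OF X] pn_map_def cls_map_cls[OF X Y f] act_snoc_lev[OF M]
        cls_act_cls[OF Y] msmap_lev[OF f] msmap_act[OF f] mhom_append)
  then show ?thesis
    unfolding msmap_def using pn_map_lev[OF X Y f] by (auto simp: pn_lev_iff[OF X])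
qed

text \<open>The representative chosen for the intermediate value leaves no trace in the class, which
  gives functoriality of \<open>p\<close> on composites of maps.\<close>

lemma pn_map_pn_map:
  assumes Y: "nfold_cat (Suc m) Y" and Z: "nfold_cat (Suc m) Z"
    and f: "msmap (Suc m) X Y f" and g: "msmap (Suc m) Y Z g" and ks: "length ks = m"
    and x: "x \<in> lev X (ks @ [0])"
  shows "pn_map Z g ks (pn_map Y f ks x) = cls (cat_of (slices Z ks)) (g (ks @ [0]) (f (ks @ [0]) x))"
  using cls_map_cls[OF Y Z g ks] msmap_lev[OF f, of "ks @ [0]" x] ks x by (simp add: pn_map_def)


section \<open>Represented multisimplicial sets\<close>

text \<open>
  Fibres of maps, iterated fibre products over a discrete object and isomorphic copies are all
  described by jointly injective maps \<open>\<pi> i : Z \<rightarrow> Y\<close> whose image consists of the families satisfying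
  a predicate that is invariant under the multisimplicial structure. In contrast to a concrete
  construction, this description is preserved by \<open>pn\<close>, where representatives of classes are chosen.
\<close>

definition represents ::
    "nat \<Rightarrow> nat \<Rightarrow> 'b mss \<Rightarrow> (nat list \<Rightarrow> (nat \<Rightarrow> 'b) \<Rightarrow> bool) \<Rightarrow> 'a mss
      \<Rightarrow> (nat \<Rightarrow> nat list \<Rightarrow> 'a \<Rightarrow> 'b) \<Rightarrow> bool" where
  "represents m k Y P Z \<pi> \<longleftrightarrow>
     msset m Z \<and> (\<forall>i<k. msmap m Z Y (\<pi> i)) \<and>
     (\<forall>ks. length ks = m \<longrightarrow> (\<forall>z\<in>lev Z ks. \<forall>z'\<in>lev Z ks. (\<forall>i<k. \<pi> i ks z = \<pi> i ks z') \<longrightarrow> z = z')) \<and>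
     (\<forall>ks c. length ks = m \<longrightarrow> (\<forall>i<k. c i \<in> lev Y ks) \<longrightarrow> P ks c \<longrightarrow>
        (\<exists>z\<in>lev Z ks. \<forall>i<k. \<pi> i ks z = c i)) \<and>
     (\<forall>ks. length ks = m \<longrightarrow> (\<forall>z\<in>lev Z ks. P ks (\<lambda>i. \<pi> i ks z))) \<and>
     (\<forall>js ks. \<forall>\<phi>\<in>mhom js ks. \<forall>c. length ks = m \<longrightarrow> (\<forall>i<k. c i \<in> lev Y ks) \<longrightarrow>
        P js (\<lambda>i. act Y js ks \<phi> (c i)) = P ks c) \<and>
     (\<forall>ks c c'. length ks = m \<longrightarrow> (\<forall>i<k. c i \<in> lev Y ks \<and> c' i = c i) \<longrightarrow> P ks c = P ks c')"

lemma representsI: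
  assumes "msset m Z" "\<And>i. i < k \<Longrightarrow> msmap m Z Y (\<pi> i)"
    "\<And>ks z z'. length ks = m \<Longrightarrow> z \<in> lev Z ks \<Longrightarrow> z' \<in> lev Z ks \<Longrightarrow> \<forall>i<k. \<pi> i ks z = \<pi> i ks z' \<Longrightarrow> z = z'"
    "\<And>ks c. length ks = m \<Longrightarrow> \<forall>i<k. c i \<in> lev Y ks \<Longrightarrow> P ks c \<Longrightarrow> \<exists>z\<in>lev Z ks. \<forall>i<k. \<pi> i ks z = c i"
    "\<And>ks z. length ks = m \<Longrightarrow> z \<in> lev Z ks \<Longrightarrow> P ks (\<lambda>i. \<pi> i ks z)"
    "\<And>js ks \<phi> c. \<phi> \<in> mhom js ks \<Longrightarrow> length ks = m \<Longrightarrow> \<forall>i<k. c i \<in> lev Y ks \<Longrightarrow>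
      P js (\<lambda>i. act Y js ks \<phi> (c i)) = P ks c"
    "\<And>ks c c'. length ks = m \<Longrightarrow> \<forall>i<k. c i \<in> lev Y ks \<and> c' i = c i \<Longrightarrow> P ks c = P ks c'"
  shows "represents m k Y P Z \<pi>"
  unfolding represents_def
  by (intro conjI allI impI ballI; (rule assms; assumption)?)

lemma representsD:
  assumes "represents m k Y P Z \<pi>"
  shows rep_msset: "msset m Z"
    and rep_msmap: "i < k \<Longrightarrow> msmap m Z Y (\<pi> i)"
    and rep_inj: "length ks = m \<Longrightarrow> z \<in> lev Z ks \<Longrightarrow> z' \<in> lev Z ks \<Longrightarrow>
      (\<And>i. i < k \<Longrightarrow> \<pi> i ks z = \<pi> i ks z') \<Longrightarrow> z = z'"
    and rep_lift: "length ks = m \<Longrightarrow> (\<And>i. i < k \<Longrightarrow> c i \<in> lev Y ks) \<Longrightarrow> P ks c \<Longrightarrow>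
      \<exists>z\<in>lev Z ks. \<forall>i<k. \<pi> i ks z = c i"
    and rep_sound: "length ks = m \<Longrightarrow> z \<in> lev Z ks \<Longrightarrow> P ks (\<lambda>i. \<pi> i ks z)"
    and rep_act: "\<phi> \<in> mhom js ks \<Longrightarrow> length ks = m \<Longrightarrow> (\<And>i. i < k \<Longrightarrow> c i \<in> lev Y ks) \<Longrightarrow>
      P js (\<lambda>i. act Y js ks \<phi> (c i)) = P ks c"
    and rep_cong: "length ks = m \<Longrightarrow> (\<And>i. i < k \<Longrightarrow> c i \<in> lev Y ks) \<Longrightarrow> (\<And>i. i < k \<Longrightarrow> c' i = c i) \<Longrightarrow>
      P ks c = P ks c'"
proof -
  show "z = z'" if "length ks = m" "z \<in> lev Z ks" "z' \<in> lev Z ks"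
    "\<And>i. i < k \<Longrightarrow> \<pi> i ks z = \<pi> i ks z'"
    using assms that unfolding represents_def by simp
  show "P ks c = P ks c'" if "length ks = m" "\<And>i. i < k \<Longrightarrow> c i \<in> lev Y ks" "\<And>i. i < k \<Longrightarrow> c' i = c i"
  proof -
    have "\<forall>i<k. c i \<in> lev Y ks \<and> c' i = c i" using that by simp
    then show ?thesis using assms that(1) unfolding represents_def by blast
  qed
qed (use assms in \<open>simp_all add: represents_def\<close>)

lemma rep_lev: "represents m k Y P Z \<pi> \<Longrightarrow> i < k \<Longrightarrow> length ks = m \<Longrightarrow> z \<in> lev Z ks \<Longrightarrow> \<pi> i ks z \<in> lev Y ks"
  by (rule msmap_lev[OF rep_msmap])

lemma represents_slice:
  assumes R: "represents (Suc m) k Y P Z \<pi>"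
  shows "represents m k (slice Y s) (\<lambda>ks. P (s # ks)) (slice Z s) (\<lambda>i ks. \<pi> i (s # ks))"
proof -
  have "P (s # js) (\<lambda>i. act Y (s # js) (s # ks) (did s # \<phi>) (c i)) = P (s # ks) c"
    if "\<phi> \<in> mhom js ks" "length ks = m" "\<forall>i<k. c i \<in> lev Y (s # ks)" for js ks \<phi> c
    using rep_act[OF R, of "did s # \<phi>" "s # js" "s # ks" c] that by simp
  moreover have "z = z'" if "length ks = m" "z \<in> lev Z (s # ks)" "z' \<in> lev Z (s # ks)"
    "\<forall>i<k. \<pi> i (s # ks) z = \<pi> i (s # ks) z'" for ks z z'
    using rep_inj[OF R, of "s # ks" z z'] that by simp
  moreover have "\<exists>z\<in>lev Z (s # ks). \<forall>i<k. \<pi> i (s # ks) z = c i"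
    if "length ks = m" "\<forall>i<k. c i \<in> lev Y (s # ks)" "P (s # ks) c" for ks c
    using rep_lift[OF R, of "s # ks" c] that by simp
  moreover have "P (s # ks) (\<lambda>i. \<pi> i (s # ks) z)" if "length ks = m" "z \<in> lev Z (s # ks)" for ks z
    using rep_sound[OF R, of "s # ks" z] that by simp
  moreover have "P (s # ks) c = P (s # ks) c'" if "length ks = m"
    "\<forall>i<k. c i \<in> lev Y (s # ks) \<and> c' i = c i" for ks c c'
    using rep_cong[OF R, of "s # ks" c c'] that by simp
  ultimately show ?thesis
    unfolding represents_def
    using msset_slice[OF rep_msset[OF R]] msmap_slice[OF rep_msmap[OF R]] by auto
qed

text \<open>Strings in \<open>Z\<close> are filled projection by projection in \<open>Y\<close>;
  joint injectivity turns equalities in \<open>Y\<close> into equalities in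
  \<open>Z\<close>.\<close>

lemma nfold_cat_represents:
  assumes "nfold_cat m Y" "represents m k Y P Z \<pi>"
  shows "nfold_cat m Z"
  using assms
proof (induction m arbitrary: Y P Z \<pi>)
  case 0
  then show ?case using rep_msset by auto
next
  case (Suc m)
  note Y = Suc.prems(1) and R = Suc.prems(2)
  note MY = nfold_cat_msset[OF Y] and MZ = rep_msset[OF R]
  have comm: "\<pi> i (j # ks) (simp_map Z j q \<theta> ks z) = simp_map Y j q \<theta> ks (\<pi> i (q # ks) z)"
    if "i < k" "\<theta> \<in> dhom j q" "z \<in> lev Z (q # ks)" "length ks = m" for i j q \<theta> ks z
    using msmap_simp_map_commute[OF rep_msmap[OF R that(1)]] that by blast
  have lev: "\<pi> i (q # ks) z \<in> lev Y (q # ks)" if "i < k" "length ks = m" "z \<in> lev Z (q # ks)" for i q ks z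
    using rep_lev[OF R that(1), of "q # ks" z] that by simp
  have "segal_bij Z q ks" if q: "2 \<le> q" and ks: "length ks = m" for q ks
    unfolding segal_bij_def
  proof (intro conjI ballI allI impI)
    note S = nfold_cat_segal_bij[OF Y q ks]
    fix z z' assume z: "z \<in> lev Z (q # ks)" "z' \<in> lev Z (q # ks)"
      "\<forall>j<q. edge Z q j ks z = edge Z q j ks z'"
    show "z = z'"
    proof (rule rep_inj[OF R _ z(1,2)])
      fix i assume i: "i < k"
      show "\<pi> i (q # ks) z = \<pi> i (q # ks) z'"
      proof (rule segal_bijD1[OF S])
        fix j assume j: "j < q"
        then have "[j, Suc j] \<in> dhom (Suc 0) q" by (auto intro: edge_in)
        then show "edge Y q j ks (\<pi> i (q # ks) z) = edge Y q j ks (\<pi> i (q # ks) z')"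
          using comm[OF i _ z(1) ks] comm[OF i _ z(2) ks] z(3) j by (metis One_nat_def)
      qed (use lev i ks z in auto)
    qed (use ks in auto)
  next
    note S = nfold_cat_segal_bij[OF Y q ks]
    fix c assume c: "\<forall>j<q. c j \<in> lev Z (1 # ks)"
      "\<forall>j. Suc j < q \<longrightarrow> tgt Z ks (c j) = src Z ks (c (Suc j))"
    have "\<exists>y\<in>lev Y (q # ks). \<forall>j<q. edge Y q j ks y = \<pi> i (1 # ks) (c j)" if i: "i < k" for i
    proof (rule segal_bijD2[OF S, of "\<lambda>j. \<pi> i (1 # ks) (c j)"])
      show "\<pi> i (1 # ks) (c j) \<in> lev Y (1 # ks)" if "j < q" for j
        using lev[OF i ks] c(1) that by blast
      show "tgt Y ks (\<pi> i (1 # ks) (c j)) = src Y ks (\<pi> i (1 # ks) (c (Suc j)))" if "Suc j < q" for j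
        using comm[OF i vertex_in, of 1 1 "c j" ks] comm[OF i vertex_in, of 0 1 "c (Suc j)" ks] c that ks
        by (metis One_nat_def Suc_lessD le_refl zero_le)
    qed blast
    then obtain y where y: "y i \<in> lev Y (q # ks)" "j < q \<Longrightarrow> edge Y q j ks (y i) = \<pi> i (1 # ks) (c j)"
      if "i < k" for i j
      by metis
    \<comment> \<open>Compatibility of the fillers \<open>y\<close> can be tested after any
      structure map. The first edge, which exists since \<open>q\<close> is at least 2, turns
      \<open>y\<close> into the projections of \<open>c 0\<close>, and these are compatible.\<close>
    have e0: "[0, Suc 0] # mid ks \<in> mhom (Suc 0 # ks) (q # ks)" using q by (auto simp: edge_in)
    have c0: "c 0 \<in> lev Z (Suc 0 # ks)" using c(1) q by auto
    have "P (Suc 0 # ks) (\<lambda>i. \<pi> i (Suc 0 # ks) (c 0)) =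
      P (Suc 0 # ks) (\<lambda>i. act Y (Suc 0 # ks) (q # ks) ([0, Suc 0] # mid ks) (y i))"
    proof (rule rep_cong[OF R])
      show "act Y (Suc 0 # ks) (q # ks) ([0, Suc 0] # mid ks) (y i) = \<pi> i (Suc 0 # ks) (c 0)"
        if "i < k" for i
        using y(2)[OF that, of 0] q by (simp add: simp_map_def)
    qed (use c0 ks lev in auto)
    then have "P (q # ks) y"
      using rep_act[OF R e0, of y] rep_sound[OF R, of "Suc 0 # ks" "c 0"] c0 ks y(1) by simp
    then obtain z where z: "z \<in> lev Z (q # ks)" "\<And>i. i < k \<Longrightarrow> \<pi> i (q # ks) z = y i"
      using rep_lift[OF R, of "q # ks" y] ks y(1) by auto
    have "edge Z q j ks z = c j" if j: "j < q" for j
    proof (rule rep_inj[OF R])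
      have e: "[j, Suc j] \<in> dhom 1 q" using j by (auto intro: edge_in)
      show "edge Z q j ks z \<in> lev Z (1 # ks)"
        using simp_map_lev[OF MZ e z(1) ks] by simp
      show "\<pi> i (1 # ks) (edge Z q j ks z) = \<pi> i (1 # ks) (c j)" if "i < k" for i
        using comm[OF that e z(1) ks] z(2)[OF that] y(2)[OF that j] by simp
    qed (use c(1) j ks in auto)
    then show "\<exists>z\<in>lev Z (q # ks). \<forall>j<q. edge Z q j ks z = c j" using z(1) by blast
  qed
  then show ?case
    using Suc.IH[OF nfold_cat_slice[OF Y] represents_slice[OF R]] MZ segal_iff[OF MZ] by auto
qed

lemma rep_face:
  assumes R: "represents (Suc m) k Y P Z \<pi>" and ks: "length ks = m" and i: "i < k" and F: "F \<in> lev Z (ks @ [Suc 0])"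
    and e: "e \<le> 1"
  shows "\<pi> i (ks @ [0]) (act Z (ks @ [0]) (ks @ [Suc 0]) (mid ks @ [[e]]) F) =
    act Y (ks @ [0]) (ks @ [Suc 0]) (mid ks @ [[e]]) (\<pi> i (ks @ [Suc 0]) F)"
  using msmap_act[OF rep_msmap[OF R i], of "mid ks @ [[e]]" "ks @ [0]" "ks @ [Suc 0]" F] ks F e
  by (simp add: mhom_append vertex_in)

lemma rep_hom_eqI:
  assumes R: "represents (Suc m) k Y P Z \<pi>" and ks: "length ks = m"
    and F: "F \<in> lev Z (ks @ [Suc 0])" "F' \<in> lev Z (ks @ [Suc 0])"
    and eq: "\<And>i. i < k \<Longrightarrow> \<pi> i (ks @ [Suc 0]) F = \<pi> i (ks @ [Suc 0]) F'"
  shows "F = F'"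
  using rep_inj[OF R _ F eq] ks by simp

text \<open>A family of arrows satisfies \<open>P\<close> as soon as its sources do, because
  \<open>P\<close> is invariant under the source map. So the arrows of \<open>Z\<close> between two
  given objects are just families of arrows between their projections.\<close>

lemma rep_lift_hom:
  assumes R: "represents (Suc m) k Y P Z \<pi>" and ks: "length ks = m"
    and z: "z \<in> lev Z (ks @ [0])" "z' \<in> lev Z (ks @ [0])"
    and f: "\<And>i. i < k \<Longrightarrow> in_hom (cat_of (slices Y ks)) (f i) (\<pi> i (ks @ [0]) z) (\<pi> i (ks @ [0]) z')"
  obtains F where "in_hom (cat_of (slices Z ks)) F z z'" "\<And>i. i < k \<Longrightarrow> \<pi> i (ks @ [Suc 0]) F = f i"
proof -
  note MZ = rep_msset[OF R]
  have d: "mid ks @ [[e]] \<in> mhom (ks @ [0]) (ks @ [Suc 0])" if "e \<le> 1" for e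
    using that by (intro mhom_append) (auto simp: vertex_in)
  have "P (ks @ [0]) (\<lambda>i. \<pi> i (ks @ [0]) z) =
      P (ks @ [0]) (\<lambda>i. act Y (ks @ [0]) (ks @ [Suc 0]) (mid ks @ [[0]]) (f i))"
    by (rule rep_cong[OF R]) (use z f ks rep_lev[OF R, of _ "ks @ [0]" z] in auto)
  then have "P (ks @ [Suc 0]) f"
    using rep_sound[OF R _ z(1)] rep_act[OF R d[of 0], of f] f ks by simp
  then obtain F where F: "F \<in> lev Z (ks @ [Suc 0])" "\<And>i. i < k \<Longrightarrow> \<pi> i (ks @ [Suc 0]) F = f i"
    using rep_lift[OF R, of "ks @ [Suc 0]" f] f ks by auto
  have l: "act Z (ks @ [0]) (ks @ [Suc 0]) (mid ks @ [[e]]) F \<in> lev Z (ks @ [0])" if "e \<le> 1" for e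
    using msset_act[OF MZ d[OF that]] F(1) ks by simp
  have "act Z (ks @ [0]) (ks @ [Suc 0]) (mid ks @ [[0]]) F = z"
    by (rule rep_inj[OF R _ l z(1)]) (use ks f F rep_face[OF R ks _ F(1)] in auto)
  moreover have "act Z (ks @ [0]) (ks @ [Suc 0]) (mid ks @ [[Suc 0]]) F = z'"
    by (rule rep_inj[OF R _ l z(2)]) (use ks f F rep_face[OF R ks _ F(1)] in auto)
  ultimately show ?thesis using that[of F] F by simp
qed

text \<open>The two halves are lifted separately; that they are inverse to each other is checked on
  the projections, which are jointly faithful functors.\<close>

lemma rep_lift_inv_pair:
  fixes Y :: "'b elt mss" and Z :: "'a elt mss"
  assumes Y: "nfold_cat (Suc m) Y" and R: "represents (Suc m) k Y P Z \<pi>" and ks: "length ks = m"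
    and z: "z \<in> lev Z (ks @ [0])" "z' \<in> lev Z (ks @ [0])"
    and f: "\<And>i. i < k \<Longrightarrow> inv_pair (cat_of (slices Y ks)) (f i) (g i) (\<pi> i (ks @ [0]) z) (\<pi> i (ks @ [0]) z')"
  obtains F G where "inv_pair (cat_of (slices Z ks)) F G z z'" "\<And>i. i < k \<Longrightarrow> \<pi> i (ks @ [Suc 0]) F = f i"
proof -
  let ?C = "cat_of (slices Y ks)" and ?D = "cat_of (slices Z ks)"
  note Z = nfold_cat_represents[OF Y R]
  note D = category_J[OF Z ks]
  obtain F where F: "in_hom ?D F z z'" "\<And>i. i < k \<Longrightarrow> \<pi> i (ks @ [Suc 0]) F = f i"
    by (rule rep_lift_hom[OF R ks z, of f]) (use f in \<open>auto simp: inv_pair_def\<close>)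
  obtain G where G: "in_hom ?D G z' z" "\<And>i. i < k \<Longrightarrow> \<pi> i (ks @ [Suc 0]) G = g i"
    by (rule rep_lift_hom[OF R ks z(2,1), of g]) (use f in \<open>auto simp: inv_pair_def\<close>)
  have fct: "is_functor ?D ?C (ftr_of (\<lambda>s. \<pi> i (ks @ s)))" if "i < k" for i
    using functor_J_map[OF Z Y rep_msmap[OF R that] ks] .
  have GF: "in_hom ?D (cmp ?D G F) z z" and FG: "in_hom ?D (cmp ?D F G) z' z'"
    using cat_cmp[OF D F(1) G(1)] cat_cmp[OF D G(1) F(1)] by auto
  have id: "in_hom ?D (idn ?D z) z z" "in_hom ?D (idn ?D z') z' z'" using cat_idn[OF D] z by auto
  have "cmp ?D G F = idn ?D z"
  proof (rule rep_hom_eqI[OF R ks])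
    fix i assume i: "i < k"
    show "\<pi> i (ks @ [Suc 0]) (cmp ?D G F) = \<pi> i (ks @ [Suc 0]) (idn ?D z)"
      using functor_cmp[OF fct[OF i] F(1) G(1)] functor_idn[OF fct[OF i], of z] z f[OF i] F(2) G(2) i
      unfolding inv_pair_def by simp
  qed (use GF id in auto)
  moreover have "cmp ?D F G = idn ?D z'"
  proof (rule rep_hom_eqI[OF R ks])
    fix i assume i: "i < k"
    show "\<pi> i (ks @ [Suc 0]) (cmp ?D F G) = \<pi> i (ks @ [Suc 0]) (idn ?D z')"
      using functor_cmp[OF fct[OF i] G(1) F(1)] functor_idn[OF fct[OF i], of z'] z f[OF i] F(2) G(2) i
      unfolding inv_pair_def by simp
  qed (use FG id in auto)
  ultimately show ?thesis using that[of F G] F G by (simp add: inv_pair_def)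
qed

lemma cat_hd_thin: "cat_hd C \<Longrightarrow> in_hom C f x y \<Longrightarrow> in_hom C g x y \<Longrightarrow> f = g"
  unfolding cat_hd_def by metis

lemma cat_hd_inverse: "cat_hd C \<Longrightarrow> in_hom C f x y \<Longrightarrow> \<exists>g. inv_pair C f g x y"
  unfolding cat_hd_def iso_arr_iff by blast

lemma cat_hd_represents:
  fixes Y :: "'b elt mss" and Z :: "'a elt mss"
  assumes Y: "nfold_cat (Suc m) Y" and R: "represents (Suc m) k Y P Z \<pi>" and ks: "length ks = m"
    and hd: "cat_hd (cat_of (slices Y ks))"
  shows "cat_hd (cat_of (slices Z ks))"
proof -
  let ?C = "cat_of (slices Y ks)" and ?D = "cat_of (slices Z ks)"
  note Z = nfold_cat_represents[OF Y R]
  note D = category_J[OF Z ks]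
  have fct: "is_functor ?D ?C (ftr_of (\<lambda>s. \<pi> i (ks @ s)))" if "i < k" for i
    using functor_J_map[OF Z Y rep_msmap[OF R that] ks] .
  have thin: "F = F'" if F: "in_hom ?D F z z'" "in_hom ?D F' z z'" for F F' z z'
  proof (rule rep_hom_eqI[OF R ks])
    fix i assume i: "i < k"
    show "\<pi> i (ks @ [Suc 0]) F = \<pi> i (ks @ [Suc 0]) F'"
      using cat_hd_thin[OF hd functor_far[OF fct[OF i] F(1)] functor_far[OF fct[OF i] F(2)]] by simp
  qed (use F in auto)
  have "iso_arr ?D F" if F: "in_hom ?D F z z'" for F z z'
  proof -
    have z: "z \<in> lev Z (ks @ [0])" "z' \<in> lev Z (ks @ [0])" using cat_objs[OF D F] by auto
    have "\<exists>g. inv_pair ?C (\<pi> i (ks @ [Suc 0]) F) g (\<pi> i (ks @ [0]) z) (\<pi> i (ks @ [0]) z')" if "i < k" for i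
      using cat_hd_inverse[OF hd functor_far[OF fct[OF that] F]] by simp
    then obtain g where g: "inv_pair ?C (\<pi> i (ks @ [Suc 0]) F) (g i) (\<pi> i (ks @ [0]) z) (\<pi> i (ks @ [0]) z')"
      if "i < k" for i by metis
    obtain F' G where F': "inv_pair ?D F' G z z'"
      by (rule rep_lift_inv_pair[OF Y R ks z g])
    \<comment> \<open>The isomorphism obtained by lifting is parallel to \<open>F\<close>, and
      thinness identifies the two.\<close>
    have "F' = F" by (rule thin[OF _ F]) (use F' in \<open>simp add: inv_pair_def\<close>)
    then show ?thesis using inv_pair_iso_arr[OF F'] by simp
  qed
  then have "\<forall>F\<in>Arr ?D. iso_arr ?D F" by blast
  moreover have "\<forall>F\<in>Arr ?D. \<forall>F'\<in>Arr ?D. dom ?D F = dom ?D F' \<longrightarrow> cod ?D F = cod ?D F' \<longrightarrow> F = F'"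
    using thin by (intro ballI impI) blast
  ultimately show ?thesis using D unfolding cat_hd_def by blast
qed

text \<open>Source and target maps both preserve and reflect \<open>P\<close>, so along a family of
  arrows the sources satisfy \<open>P\<close> exactly if the targets do. Hence \<open>P\<close>
  depends only on isomorphism classes.\<close>

lemma rep_pred_iso:
  assumes Y: "nfold_cat (Suc m) Y" and R: "represents (Suc m) k Y P Z \<pi>" and ks: "length ks = m"
    and iso: "\<And>i. i < k \<Longrightarrow> iso_objs (cat_of (slices Y ks)) (c i) (c' i)"
  shows "P (ks @ [0]) c = P (ks @ [0]) c'"
proof -
  have "\<exists>f. in_hom (cat_of (slices Y ks)) f (c i) (c' i)" if "i < k" for i
    using iso[OF that] unfolding iso_objs_iff inv_pair_def by blast
  then obtain f where f: "in_hom (cat_of (slices Y ks)) (f i) (c i) (c' i)" if "i < k" for i by metis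
  have d: "mid ks @ [[e]] \<in> mhom (ks @ [0]) (ks @ [Suc 0])" if "e \<le> 1" for e
    using that by (intro mhom_append) (auto simp: vertex_in)
  have o: "c i \<in> lev Y (ks @ [0])" "c' i \<in> lev Y (ks @ [0])" if "i < k" for i
    using cat_objs[OF category_J[OF Y ks] f[OF that]] by auto
  have "P (ks @ [0]) c = P (ks @ [0]) (\<lambda>i. act Y (ks @ [0]) (ks @ [Suc 0]) (mid ks @ [[0]]) (f i))"
    by (rule rep_cong[OF R]) (use o f ks in auto)
  also have "\<dots> = P (ks @ [Suc 0]) f" by (rule rep_act[OF R d]) (use f ks in auto)
  also have "\<dots> = P (ks @ [0]) (\<lambda>i. act Y (ks @ [0]) (ks @ [Suc 0]) (mid ks @ [[Suc 0]]) (f i))"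
    by (rule rep_act[OF R d, symmetric]) (use f ks in auto)
  also have "\<dots> = P (ks @ [0]) c'"
    by (rule rep_cong[OF R, symmetric]) (use o f ks in auto)
  finally show ?thesis .
qed

text \<open>This is the commutation of \<open>p\<close> with fibres and with fibre products over a
  discrete object. Injectivity: isomorphisms between all projections lift to an isomorphism in
  \<open>Z\<close>. Existence: a family of representatives is lifted as a family of objects of
  \<open>Y\<close>, and the class of the lift is taken. \<open>P'\<close> has to agree with
  \<open>P\<close> only on elements of \<open>pn Y\<close>, which leaves room for predicates formed
  in \<open>pn X\<close>.\<close>

lemma represents_pn:
  fixes Y :: "'b elt mss" and Z :: "'a elt mss"
  assumes Y: "nfold_cat (Suc m) Y" and R: "represents (Suc m) k Y P Z \<pi>"
    and P': "\<And>ks c. length ks = m \<Longrightarrow> (\<And>i. i < k \<Longrightarrow> c i \<in> lev (pn Y) ks) \<Longrightarrow> P' ks c = P (ks @ [0]) c"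
  shows "represents m k (pn Y) P' (pn Z) (\<lambda>i. pn_map Y (\<pi> i))"
proof -
  note Z = nfold_cat_represents[OF Y R]
  let ?C = "\<lambda>ks. cat_of (slices Y ks)" and ?D = "\<lambda>ks. cat_of (slices Z ks)"
  have mp: "msmap (Suc m) Z Y (\<pi> i)" if "i < k" for i using rep_msmap[OF R that] .
  have pl: "\<pi> i (ks @ [0]) z \<in> lev Y (ks @ [0])" if "i < k" "length ks = m" "z \<in> lev Z (ks @ [0])" for i ks z
    using rep_lev[OF R that(1)] that by simp
  have pnl: "pn_map Y (\<pi> i) ks z \<in> lev (pn Y) ks" if "i < k" "length ks = m" "z \<in> lev Z (ks @ [0])" for i ks z
    using pn_map_lev[OF Z Y mp[OF that(1)]] that by blast
  have iso: "iso_objs (?C ks) (\<pi> i (ks @ [0]) z) (pn_map Y (\<pi> i) ks z)"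
    if "i < k" "length ks = m" "z \<in> lev Z (ks @ [0])" for i ks z
    using iso_objs_cls[OF category_J[OF Y that(2)]] pl[OF that] by (simp add: pn_map_def)
  have inj: "z = z'" if ks: "length ks = m" and z: "z \<in> lev (pn Z) ks" "z' \<in> lev (pn Z) ks"
    and eq: "\<forall>i<k. pn_map Y (\<pi> i) ks z = pn_map Y (\<pi> i) ks z'" for ks z z'
  proof -
    have zz: "z \<in> lev Z (ks @ [0])" "z' \<in> lev Z (ks @ [0])" "cls (?D ks) z = z" "cls (?D ks) z' = z'"
      using z by (auto simp: pn_lev_iff[OF Z ks])
    have "\<exists>f g. inv_pair (?C ks) f g (\<pi> i (ks @ [0]) z) (\<pi> i (ks @ [0]) z')" if "i < k" for i
      using eq that iffD1[OF cls_eq_iff[OF category_J[OF Y ks]], of "\<pi> i (ks @ [0]) z" "\<pi> i (ks @ [0]) z'"]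
        pl[OF that ks] zz
      by (simp add: pn_map_def flip: iso_objs_iff)
    then obtain f g where fg: "inv_pair (?C ks) (f i) (g i) (\<pi> i (ks @ [0]) z) (\<pi> i (ks @ [0]) z')"
      if "i < k" for i by metis
    obtain F G where "inv_pair (?D ks) F G z z'"
      by (rule rep_lift_inv_pair[OF Y R ks zz(1,2) fg])
    then have "cls (?D ks) z = cls (?D ks) z'"
      using cls_eq_iff[OF category_J[OF Z ks]] zz(1,2) by (auto simp: iso_objs_iff)
    then show ?thesis using zz by simp
  qed
  have lift: "\<exists>z\<in>lev (pn Z) ks. \<forall>i<k. pn_map Y (\<pi> i) ks z = c i"
    if ks: "length ks = m" and c: "\<forall>i<k. c i \<in> lev (pn Y) ks" and P: "P' ks c" for ks c
  proof -
    have c': "c i \<in> lev Y (ks @ [0])" "cls (?C ks) (c i) = c i" if "i < k" for i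
      using c that by (auto simp: pn_lev_iff[OF Y ks])
    have "P (ks @ [0]) c" using P P'[OF ks, of c] c by simp
    then obtain z where z: "z \<in> lev Z (ks @ [0])" "\<And>i. i < k \<Longrightarrow> \<pi> i (ks @ [0]) z = c i"
      using rep_lift[OF R, of "ks @ [0]" c] c' ks by auto
    have "pn_map Y (\<pi> i) ks (cls (?D ks) z) = c i" if "i < k" for i
      using cls_map_cls[OF Z Y mp[OF that] ks z(1)] z(2)[OF that] c'(2)[OF that] by (simp add: pn_map_def)
    then show ?thesis using cls_lev_pn[OF Z ks z(1)] by blast
  qed
  have sound: "P' ks (\<lambda>i. pn_map Y (\<pi> i) ks z)" if ks: "length ks = m" and z: "z \<in> lev (pn Z) ks" for ks z
  proof -
    have zz: "z \<in> lev Z (ks @ [0])" using z by (simp add: pn_lev_iff[OF Z ks])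
    have "P' ks (\<lambda>i. pn_map Y (\<pi> i) ks z) = P (ks @ [0]) (\<lambda>i. pn_map Y (\<pi> i) ks z)"
      using P'[OF ks] pnl[OF _ ks zz] by simp
    also have "\<dots> = P (ks @ [0]) (\<lambda>i. \<pi> i (ks @ [0]) z)"
      using rep_pred_iso[OF Y R ks iso[OF _ ks zz]] by simp
    finally show ?thesis using rep_sound[OF R _ zz] ks by simp
  qed
  have act: "P' js (\<lambda>i. act (pn Y) js ks \<phi> (c i)) = P' ks c"
    if \<phi>: "\<phi> \<in> mhom js ks" and ks: "length ks = m" and c: "\<forall>i<k. c i \<in> lev (pn Y) ks" for js ks \<phi> c
  proof -
    have js: "length js = m" using mhom_length[OF \<phi>] ks by simp
    have c': "c i \<in> lev Y (ks @ [0])" if "i < k" for i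
      using c that by (auto simp: pn_lev_iff[OF Y ks])
    have l: "act Y (js @ [0]) (ks @ [0]) (\<phi> @ [[0]]) (c i) \<in> lev Y (js @ [0])" if "i < k" for i
      using act_snoc_lev[OF nfold_cat_msset[OF Y] \<phi> ks _ c'[OF that]] by simp
    have "P' js (\<lambda>i. act (pn Y) js ks \<phi> (c i)) = P (js @ [0]) (\<lambda>i. act (pn Y) js ks \<phi> (c i))"
      using P'[OF js] msset_act[OF msset_pn[OF Y] \<phi> ks] c by simp
    also have "\<dots> = P (js @ [0]) (\<lambda>i. act Y (js @ [0]) (ks @ [0]) (\<phi> @ [[0]]) (c i))"
      using rep_pred_iso[OF Y R js iso_objs_cls[OF category_J[OF Y js]]] l unfolding pn_act by simp
    also have "\<dots> = P (ks @ [0]) c"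
      by (rule rep_act[OF R]) (use \<phi> ks c' in \<open>auto intro: mhom_append\<close>)
    finally show ?thesis using P'[OF ks, of c] c by simp
  qed
  have cong: "P' ks c = P' ks c'" if "length ks = m" "\<forall>i<k. c i \<in> lev (pn Y) ks \<and> c' i = c i" for ks c c'
    using P'[OF that(1), of c] P'[OF that(1), of c'] that rep_cong[OF R, of "ks @ [0]" c c']
    by (simp add: pn_lev_iff[OF Y that(1)])
  show ?thesis
    by (rule representsI[OF msset_pn[OF Z] msmap_pn[OF Z Y mp] inj lift sound act cong])
qed

text \<open>The weakly globular (\<open>h = False\<close>) and the homotopically discrete (\<open>h = True\<close>) objects.\<close>

primrec tower :: "bool \<Rightarrow> nat \<Rightarrow> 'a elt mss \<Rightarrow> bool" where
  "tower h 0 X \<longleftrightarrow> msset 0 X"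
| "tower h (Suc n) X \<longleftrightarrow> nfold_cat (Suc n) X \<and>
     (\<forall>ks. length ks = n \<longrightarrow> h \<or> 0 \<in> set ks \<longrightarrow> cat_hd (dcat (J X) ks)) \<and> tower h n (pn X)"

lemma tower_nfold_cat: "tower h n X \<Longrightarrow> nfold_cat n X"
  by (cases n) auto

text \<open>The cases of interest are isomorphic copies, with one projection and a predicate that is
  always true, the fibres X(a,b), and the induced fibre products over X_0^d.\<close>

lemma tower_represents:
  assumes "tower h m Y" "represents m k Y P Z \<pi>"
  shows "tower h m Z"
  using assms
proof (induction m arbitrary: Y P Z \<pi>)
  case 0
  then show ?case using rep_msset by auto
next
  case (Suc m)
  then have Y: "nfold_cat (Suc m) Y" by simp
  have "tower h m (pn Z)"
    using Suc.IH[OF _ represents_pn[OF Y Suc.prems(2), of "\<lambda>ks. P (ks @ [0])"]] Suc.prems by simp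
  then show ?case
    using nfold_cat_represents[OF Y Suc.prems(2)] cat_hd_represents[OF Y Suc.prems(2)] Suc.prems(1) by simp
qed

lemma tower_slice: "tower h (Suc n) X \<Longrightarrow> tower h n (slice X s)"
proof (induction n arbitrary: X)
  case 0
  then show ?case by simp
next
  case (Suc n)
  then have "tower h n (pn (slice X s))" by (simp add: pn_slices)
  then show ?case using Suc.prems by auto
qed

text \<open>Every index of the slice contains 0 once the leading 0 is put in front, so the
  restricted condition for \<open>h = False\<close> already covers all categories of the
  slice.\<close>

lemma tower_slice_0: "tower h (Suc n) X \<Longrightarrow> tower True n (slice X 0)"
proof (induction n arbitrary: X)
  case 0
  then show ?case by simp
next
  case (Suc n)
  then have "tower True n (pn (slice X 0))" by (simp add: pn_slices)
  then show ?case using Suc.prems by auto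
qed


section \<open>The discretization map\<close>

lemma gamma1_snoc: "gamma1 X (ks @ [k]) x =
    cls (cat_of (slices X ks)) (act X (ks @ [0]) (ks @ [k]) (mid ks @ [[0]]) x)"
  by (simp add: gamma1_def)

lemma gamma1_lev:
  assumes X: "nfold_cat (Suc m) X" and ks: "length ks = Suc m" and x: "x \<in> lev X ks"
  shows "gamma1 X ks x \<in> lev (pn X) (butlast ks)"
proof -
  obtain ks' k where k: "ks = ks' @ [k]" using ks by (metis length_Suc_conv_rev)
  show ?thesis
    unfolding k gamma1_snoc butlast_snoc
    by (intro cls_lev_pn[OF X] act_snoc_lev[OF nfold_cat_msset[OF X]]) (use k ks x in auto)
qed

text \<open>\<open>gamma1\<close> reads the first vertex of a string in the last direction, and the
  last component \<open>\<theta>\<close> of \<open>\<phi>\<close> may move it to the vertex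
  \<open>\<theta> ! 0\<close>. In an equivalence relation all vertices of a string are isomorphic,
  so the class stays the same.\<close>

lemma gamma1_act:
  assumes T: "tower True (Suc m) X" and \<phi>: "\<phi> \<in> mhom js ks" and ks: "length ks = Suc m"
    and x: "x \<in> lev X ks"
  shows "gamma1 X js (act X js ks \<phi> x) =
    act (pn X) (butlast js) (butlast ks) (butlast \<phi>) (gamma1 X ks x)"
proof -
  have X: "nfold_cat (Suc m) X" using T by simp
  note M = nfold_cat_msset[OF X]
  obtain js' j ks' k \<phi>' \<theta> where eq: "js = js' @ [j]" "ks = ks' @ [k]" "\<phi> = \<phi>' @ [\<theta>]"
    and \<phi>': "\<phi>' \<in> mhom js' ks'" and \<theta>: "\<theta> \<in> dhom j k" and ks': "length ks' = m"
    using mhom_snocE[OF \<phi> ks] by metis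
  have js': "length js' = m" using mhom_length[OF \<phi>'] ks' by simp
  have x': "x \<in> lev X (ks' @ [k])" using x eq by simp
  have \<theta>0: "\<theta> ! 0 \<le> k" using \<theta> by (cases \<theta>) (auto simp: dhom_iff)
  let ?v = "\<lambda>i. act X (js' @ [0]) (ks' @ [k]) (\<phi>' @ [[i]]) x"
  \<comment> \<open>The edge from vertex 0 to vertex \<open>\<theta> ! 0\<close> of the string,
    degenerate if \<open>\<theta> ! 0 = 0\<close>.\<close>
  define e where "e = act X (js' @ [Suc 0]) (ks' @ [k]) (\<phi>' @ [[0, \<theta> ! 0]]) x"
  have e: "in_hom (cat_of (slices X js')) e (?v 0) (?v (\<theta> ! 0))"
    using act_snoc_lev[OF M \<phi>' ks' edge_in x'] \<theta>0 ks' x'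
    by (simp add: e_def act_snoc_act_snoc[OF M mid_in \<phi>'] mcmp_mid_right[OF \<phi>'] edge_in vertex_in dcmp_def)
  have "cat_hd (cat_of (slices X js'))" using T js' by simp
  then have "iso_objs (cat_of (slices X js')) (?v 0) (?v (\<theta> ! 0))"
    using cat_hd_inverse[OF _ e] unfolding iso_objs_iff by blast
  then have "cls (cat_of (slices X js')) (?v 0) = cls (cat_of (slices X js')) (?v (\<theta> ! 0))"
    using cls_eq_iff[OF category_J[OF X js']] cat_objs[OF category_J[OF X js'] e] by blast
  also have "\<dots> = gamma1 X js (act X js ks \<phi> x)"
    unfolding eq gamma1_snoc using act_snoc_act_snoc[OF M mid_in \<phi>' ks' _ \<theta> x', of "[0]" 0]
    by (simp add: mcmp_mid_right[OF \<phi>'] dcmp_def)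
  finally show ?thesis
    using cls_act_cls[OF X \<phi>' ks', of "act X (ks' @ [0]) (ks' @ [k]) (mid ks' @ [[0]]) x"]
      act_snoc_lev[OF M mid_in ks' _ x', of "[0]" 0]
      act_snoc_act_snoc[OF M \<phi>' mid_in ks' _ _ x', of "[0]" 0 0 "[0]"]
    by (simp add: eq gamma1_snoc pn_act mcmp_mid_left[OF \<phi>'])
qed

lemma gamma1_map:
  assumes X: "nfold_cat (Suc m) X" and Y: "nfold_cat (Suc m) Y" and f: "msmap (Suc m) X Y f"
    and ks: "length ks = Suc m" and x: "x \<in> lev X ks"
  shows "gamma1 Y ks (f ks x) = pn_map Y f (butlast ks) (gamma1 X ks x)"
proof -
  obtain ks' k where k: "ks = ks' @ [k]" using ks by (metis length_Suc_conv_rev)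
  have ks': "length ks' = m" using ks k by simp
  have z: "mid ks' @ [[0]] \<in> mhom (ks' @ [0]) (ks' @ [k])" by (intro mhom_append) auto
  show ?thesis
    using cls_map_cls[OF X Y f ks', of "act X (ks' @ [0]) ks (mid ks' @ [[0]]) x"]
      act_snoc_lev[OF nfold_cat_msset[OF X] mid_in ks', of "[0]" 0 k x]
      msmap_act[OF f z, of x] x ks
    by (simp add: k gamma1_snoc pn_map_def)
qed

text \<open>Each step of the recursion strips one direction from \<open>\<phi>\<close>, until only
  the identity of the empty index is left.\<close>

lemma gamma_act:
  assumes "tower True n X" "\<phi> \<in> mhom js ks" "length ks = n" "x \<in> lev X ks"
  shows "gamma n X js (act X js ks \<phi> x) = gamma n X ks x"
  using assms
proof (induction n arbitrary: X js ks \<phi> x)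
  case 0
  then show ?case using msset_id[of 0 X "[]" x] by simp
next
  case (Suc n)
  have X: "nfold_cat (Suc n) X" using Suc.prems by simp
  have "butlast \<phi> \<in> mhom (butlast js) (butlast ks)"
    using mhom_snocE[OF Suc.prems(2,3)] by (metis butlast_snoc)
  then show ?case
    using Suc.IH[of "pn X" "butlast \<phi>" "butlast js" "butlast ks" "gamma1 X ks x"]
      gamma1_act[OF Suc.prems] gamma1_lev[OF X Suc.prems(3,4)] Suc.prems by simp
qed

lemma gamma_map:
  assumes "tower h n X" "tower h n Y" "msmap n X Y f" "length ks = n" "x \<in> lev X ks"
  shows "gamma n Y ks (f ks x) = dmap n Y f (gamma n X ks x)"
  using assms
proof (induction n arbitrary: X Y f ks x)
  case 0
  then show ?case by simp
next
  case (Suc n)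
  have XY: "nfold_cat (Suc n) X" "nfold_cat (Suc n) Y" using Suc.prems by auto
  show ?case
    using Suc.IH[of "pn X" "pn Y" "pn_map Y f" "butlast ks" "gamma1 X ks x"]
      gamma1_map[OF XY Suc.prems(3-5)] gamma1_lev[OF XY(1) Suc.prems(4,5)]
      msmap_pn[OF XY Suc.prems(3)] Suc.prems by simp
qed

text \<open>Both ends \<open>X_1 \<rightarrow> X_0^d\<close> at once, \<open>e = 0\<close> for the
  source and \<open>e = 1\<close> for the target. Here \<open>X\<close> has dimension
  \<open>n + 1\<close>: \<open>n\<close> counts the directions left in X_0.\<close>

definition dend :: "nat \<Rightarrow> nat \<Rightarrow> 'a mss \<Rightarrow> nat list \<Rightarrow> 'a \<Rightarrow> 'a" where
  "dend e n X ks x = gamma n (slice X 0) ks (simp_map X 0 1 [e] ks x)"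

lemma dsrc_dend: "dsrc (Suc n) X = dend 0 n X" and dtgt_dend: "dtgt (Suc n) X = dend 1 n X"
  by (simp_all add: dsrc_def dtgt_def dend_def fun_eq_iff)

lemma dend_act:
  assumes T: "tower h (Suc n) X" and e: "e \<le> 1" and \<phi>: "\<phi> \<in> mhom js ks" and ks: "length ks = n"
    and x: "x \<in> lev X (Suc 0 # ks)"
  shows "dend e n X js (act X (Suc 0 # js) (Suc 0 # ks) (did (Suc 0) # \<phi>) x) = dend e n X ks x"
proof -
  note M = nfold_cat_msset[OF tower_nfold_cat[OF T]]
  have e': "[e] \<in> dhom 0 (Suc 0)" using e by (simp add: vertex_in)
  show ?thesis
    using gamma_act[OF tower_slice_0[OF T] \<phi> ks, of "simp_map X 0 1 [e] ks x"]
      simp_map_act[OF M e' x ks \<phi>] simp_map_lev[OF M e' x ks]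
    by (simp add: dend_def)
qed

lemma dend_map:
  assumes X: "tower h (Suc n) X" and Y: "tower h (Suc n) Y" and f: "msmap (Suc n) X Y f"
    and e: "e \<le> 1" and ks: "length ks = n" and x: "x \<in> lev X (Suc 0 # ks)"
  shows "dend e n Y ks (f (Suc 0 # ks) x) = dmap n (slice Y 0) (\<lambda>ks. f (0 # ks)) (dend e n X ks x)"
proof -
  note M = nfold_cat_msset[OF tower_nfold_cat[OF X]]
  have e': "[e] \<in> dhom 0 (Suc 0)" using e by (simp add: vertex_in)
  show ?thesis
    using gamma_map[OF tower_slice_0[OF X] tower_slice_0[OF Y] msmap_slice[OF f] ks,
        of "simp_map X 0 1 [e] ks x"]
      msmap_simp_map_commute[OF f e' x ks] simp_map_lev[OF M e' x ks]
    by (simp add: dend_def)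
qed

text \<open>In last degree 0 the first vertex of a string is the string itself, so the first step of
  \<open>gamma\<close> only takes the class in X_0, and that is how the face maps of
  \<open>pn X\<close> are defined.\<close>

lemma dend_pn:
  assumes X: "nfold_cat (Suc (Suc m)) X" and e: "e \<le> 1" and ks: "length ks = m"
    and x: "x \<in> lev (pn X) (Suc 0 # ks)"
  shows "dend e (Suc m) X (ks @ [0]) x = dend e m (pn X) ks x"
proof -
  note M = nfold_cat_msset[OF X]
  have e': "[e] \<in> dhom 0 (Suc 0)" using e by (simp add: vertex_in)
  have x': "x \<in> lev X (Suc 0 # ks @ [0])" using x ks pn_lev_iff[OF X, of "Suc 0 # ks" x] by simp
  have "simp_map X 0 1 [e] (ks @ [0]) x \<in> lev X (0 # ks @ [0])"
    using simp_map_lev[OF M e' x'] ks by simp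
  then show ?thesis
    using msset_id[OF M, of "0 # ks @ [0]" "simp_map X 0 1 [e] (ks @ [0]) x"] ks
    by (simp add: dend_def gamma1_snoc pn_slices[of X "[0]", symmetric] pn_act simp_map_def)
qed

definition segal_pred :: "nat \<Rightarrow> 'a mss \<Rightarrow> nat \<Rightarrow> nat list \<Rightarrow> (nat \<Rightarrow> 'a) \<Rightarrow> bool" where
  "segal_pred n X k ks c \<longleftrightarrow> (\<forall>j. Suc j < k \<longrightarrow> dend 1 n X ks (c j) = dend 0 n X ks (c (Suc j)))"

text \<open>Only \<open>c 0\<close> is read: a fibre has a single projection, its inclusion into
  X_1.\<close>

definition hom_pred :: "nat \<Rightarrow> 'a mss \<Rightarrow> 'a \<Rightarrow> 'a \<Rightarrow> nat list \<Rightarrow> (nat \<Rightarrow> 'a) \<Rightarrow> bool" where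
  "hom_pred n X a b ks c \<longleftrightarrow> dend 0 n X ks (c 0) = a \<and> dend 1 n X ks (c 0) = b"

text \<open>Structure maps do not change values in X_0^d (\<open>dend_act\<close>); this is the
  invariance that \<open>represents\<close> demands of the compatibility condition.\<close>

lemma represents_ind_fprod:
  fixes X :: "'a elt mss"
  assumes T: "tower h (Suc n) X"
  shows "represents n k (slice X 1) (segal_pred n X k) (ind_fprod (Suc n) X k) (\<lambda>j ks z. comps z ! j)"
proof -
  note M = msset_slice[OF nfold_cat_msset[OF tower_nfold_cat[OF T]], of 1]
  let ?Y = "slice X 1" and ?Z = "ind_fprod (Suc n) X k"
  have lev_iff: "z \<in> lev ?Z ks \<longleftrightarrow>
      (\<exists>xs. z = Tuple xs \<and> length xs = k \<and> (\<forall>j<k. xs ! j \<in> lev ?Y ks) \<and> segal_pred n X k ks ((!) xs))" for z ks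
    unfolding ind_fprod_def fprod_def chain_def segal_pred_def dsrc_dend dtgt_dend
    by (auto simp: subset_iff in_set_conv_nth)
  have act: "act ?Z js ks \<phi> z = Tuple (map (act ?Y js ks \<phi>) (comps z))" for js ks \<phi> z
    by (simp add: ind_fprod_def fprod_def)
  have tup: "length (comps z) = k" "i < k \<Longrightarrow> comps z ! i \<in> lev ?Y ks" if "z \<in> lev ?Z ks" for z ks i
    using that unfolding lev_iff by auto
  have inv: "segal_pred n X k js (\<lambda>i. act ?Y js ks \<phi> (c i)) = segal_pred n X k ks c"
    if "\<phi> \<in> mhom js ks" "length ks = n" "\<forall>i<k. c i \<in> lev ?Y ks" for js ks \<phi> c
    using dend_act[OF T _ that(1,2)] that(3) by (auto simp: segal_pred_def)
  have cong: "segal_pred n X k ks c = segal_pred n X k ks c'" if "\<forall>i<k. c' i = c i" for ks c c'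
    using that by (auto simp: segal_pred_def)
  have closed: "act ?Z js ks \<phi> z \<in> lev ?Z js" if z: "z \<in> lev ?Z ks" and "length ks = n" "\<phi> \<in> mhom js ks" for js ks \<phi> z
  proof -
    obtain xs where xs: "z = Tuple xs" "length xs = k" "\<forall>j<k. xs ! j \<in> lev ?Y ks" "segal_pred n X k ks ((!) xs)"
      using z unfolding lev_iff by blast
    have "segal_pred n X k js ((!) (map (act ?Y js ks \<phi>) xs))"
      using inv[OF that(3,2) xs(3)] xs(4) cong[of "\<lambda>i. act ?Y js ks \<phi> (xs ! i)" "(!) (map (act ?Y js ks \<phi>) xs)"] xs(2)
      by simp
    moreover have "\<forall>j<k. map (act ?Y js ks \<phi>) xs ! j \<in> lev ?Y js"
      using msset_act[OF M that(3,2)] xs(2,3) by simp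
    ultimately show ?thesis unfolding lev_iff act using xs(1,2) by simp
  qed
  have "msset n ?Z"
    unfolding msset_def
  proof (intro conjI allI ballI impI image_subsetI)
    fix ks z assume ks: "z \<in> lev ?Z ks" "length ks = n"
    then show "act ?Z ks ks (mid ks) z = z"
      using msset_id[OF M ks(2)] unfolding lev_iff act by (auto intro!: nth_equalityI)
  next
    fix "is" js ks \<phi> \<psi> z assume a: "\<phi> \<in> mhom is js" "\<psi> \<in> mhom js ks" "z \<in> lev ?Z ks" "length ks = n"
    show "act ?Z is ks (mcmp \<psi> \<phi>) z = act ?Z is js \<phi> (act ?Z js ks \<psi> z)"
      using msset_comp[OF M a(1,2,4)] a(3) unfolding lev_iff act by (auto simp: in_set_conv_nth)
  qed (use closed in blast)
  moreover have "msmap n ?Z ?Y (\<lambda>ks z. comps z ! i)" if "i < k" for i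
    unfolding msmap_def
  proof (intro conjI allI ballI impI image_subsetI)
    show "comps z ! i \<in> lev ?Y ks" if "z \<in> lev ?Z ks" for z ks
      by (rule tup(2)[OF that \<open>i < k\<close>])
    show "comps (act ?Z js ks \<phi> z) ! i = act ?Y js ks \<phi> (comps z ! i)" if "z \<in> lev ?Z ks" for z js ks \<phi>
      using tup(1)[OF that] \<open>i < k\<close> unfolding act by simp
  qed
  moreover have "z = z'" if "z \<in> lev ?Z ks" "z' \<in> lev ?Z ks" "\<forall>i<k. comps z ! i = comps z' ! i" for z z' ks
    using that unfolding lev_iff by (auto intro!: nth_equalityI)
  moreover have "\<exists>z\<in>lev ?Z ks. \<forall>i<k. comps z ! i = c i" if "\<forall>i<k. c i \<in> lev ?Y ks" "segal_pred n X k ks c" for ks c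
    using that cong[of "(!) (map c [0..<k])" c ks]
    by (intro bexI[of _ "Tuple (map c [0..<k])"]) (auto simp: lev_iff)
  moreover have "segal_pred n X k ks (\<lambda>i. comps z ! i)" if "z \<in> lev ?Z ks" for ks z
    using that unfolding lev_iff by auto
  ultimately show ?thesis
    by (intro representsI[OF _ _ _ _ _ inv cong]) auto
qed

lemma represents_hom_fib:
  assumes T: "tower h (Suc n) X"
  shows "represents n 1 (slice X 1) (hom_pred n X a b) (hom_fib (Suc n) X a b) (\<lambda>_ _ z. z)"
proof -
  note M = msset_slice[OF nfold_cat_msset[OF tower_nfold_cat[OF T]], of 1]
  let ?Y = "slice X 1" and ?Z = "hom_fib (Suc n) X a b"
  have lev_iff: "z \<in> lev ?Z ks \<longleftrightarrow> z \<in> lev ?Y ks \<and> hom_pred n X a b ks (\<lambda>_. z)" for z ks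
    by (simp add: hom_fib_def hom_pred_def dsrc_dend dtgt_dend)
  have act: "act ?Z = act ?Y" by (simp add: hom_fib_def)
  have inv: "hom_pred n X a b js (\<lambda>i. act ?Y js ks \<phi> (c i)) = hom_pred n X a b ks c"
    if "\<phi> \<in> mhom js ks" "length ks = n" "\<forall>i<1. c i \<in> lev ?Y ks" for js ks \<phi> c
    using dend_act[OF T _ that(1,2)] that(3) by (auto simp: hom_pred_def)
  have "msset n ?Z"
    unfolding msset_def act
  proof (intro conjI allI ballI impI image_subsetI)
    fix js ks \<phi> z assume a: "\<phi> \<in> mhom js ks" "length ks = n" "z \<in> lev ?Z ks"
    then show "act ?Y js ks \<phi> z \<in> lev ?Z js"
      using msset_act[OF M a(1,2)] inv[OF a(1,2), of "\<lambda>_. z"] unfolding lev_iff by simp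
  qed (use msset_id[OF M] msset_comp[OF M] lev_iff in auto)
  then show ?thesis
  proof (intro representsI inv)
    show "msmap n ?Z ?Y (\<lambda>_ z. z)" for i :: nat
      unfolding msmap_def by (simp add: act subset_iff lev_iff)
  qed (simp_all add: lev_iff hom_pred_def)
qed


section \<open>Fully faithful maps\<close>

text \<open>A sufficient condition for an \<open>n\<close>-equivalence that does not mention the fibres.\<close>

primrec tower_eq :: "nat \<Rightarrow> 'a elt mss \<Rightarrow> 'b elt mss \<Rightarrow> (nat list \<Rightarrow> 'a elt \<Rightarrow> 'b elt) \<Rightarrow> bool" where
  "tower_eq 0 X Y f \<longleftrightarrow> msset 0 X \<and> msset 0 Y \<and> msiso 0 X Y f"
| "tower_eq (Suc n) X Y f \<longleftrightarrow>
     tower False (Suc n) X \<and> tower False (Suc n) Y \<and> msmap (Suc n) X Y f \<and>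
     (\<forall>ks. length ks = n \<longrightarrow>
        fully_faithful (dcat (J X) ks) (dcat (J Y) ks) (ftr_of (\<lambda>s. f (ks @ s)))) \<and>
     tower_eq n (pn X) (pn Y) (pn_map Y f)"

lemma fully_faithfulI:
  assumes "\<And>x y g. x \<in> Obj C \<Longrightarrow> y \<in> Obj C \<Longrightarrow> in_hom D g (fob F x) (fob F y) \<Longrightarrow>
      \<exists>f. in_hom C f x y \<and> far F f = g"
    and "\<And>x y f f'. in_hom C f x y \<Longrightarrow> in_hom C f' x y \<Longrightarrow> far F f = far F f' \<Longrightarrow> f = f'"
  shows "fully_faithful C D F"
  unfolding fully_faithful_def
proof (intro ballI allI impI)
  fix x y g assume a: "x \<in> Obj C" "y \<in> Obj C" "in_hom D g (fob F x) (fob F y)"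
  obtain f where f: "in_hom C f x y" "far F f = g" using assms(1)[OF a] by blast
  show "\<exists>!f. in_hom C f x y \<and> far F f = g"
  proof (rule ex1I[of _ f])
    show "f' = f" if "in_hom C f' x y \<and> far F f' = g" for f'
      by (rule assms(2)[of f' x y f]) (use that f in auto)
  qed (use f in auto)
qed

lemma fully_faithful_lift:
  assumes "fully_faithful C D F" "x \<in> Obj C" "y \<in> Obj C" "in_hom D g (fob F x) (fob F y)"
  obtains f where "in_hom C f x y" "far F f = g"
  using assms unfolding fully_faithful_def by blast

lemma fully_faithful_inj:
  assumes "fully_faithful C D F" "x \<in> Obj C" "y \<in> Obj C" "in_hom D (far F f) (fob F x) (fob F y)"
    "in_hom C f x y" "in_hom C f' x y" "far F f = far F f'"
  shows "f = f'"
  using assms unfolding fully_faithful_def by metis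

lemma segal_pred_pn:
  assumes X: "nfold_cat (Suc (Suc m)) X" and ks: "length ks = m"
    and c: "\<And>i. i < k \<Longrightarrow> c i \<in> lev (pn X) (Suc 0 # ks)"
  shows "segal_pred m (pn X) k ks c = segal_pred (Suc m) X k (ks @ [0]) c"
  using dend_pn[OF X _ ks c] unfolding segal_pred_def by auto

lemma hom_pred_pn:
  assumes X: "nfold_cat (Suc (Suc m)) X" and ks: "length ks = m"
    and c: "c 0 \<in> lev (pn X) (Suc 0 # ks)"
  shows "hom_pred m (pn X) a b ks c = hom_pred (Suc m) X a b (ks @ [0]) c"
  using dend_pn[OF X _ ks c] unfolding hom_pred_def by auto

text \<open>The form with an arbitrary representing \<open>Z\<close>, and an \<open>f\<close> whose
  projections are the edges, is forced by the induction: after one application of \<open>pn\<close>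
  the target is no longer of the form \<open>ind_fprod\<close>.\<close>

lemma tower_eq_segal:
  assumes "tower False (Suc n) X" "2 \<le> k"
    "represents n k (slice X 1) (segal_pred n X k) Z \<pi>"
    "msmap n (slice X k) Z f"
    "\<And>ks x j. length ks = n \<Longrightarrow> x \<in> lev X (k # ks) \<Longrightarrow> j < k \<Longrightarrow> \<pi> j ks (f ks x) = edge X k j ks x"
  shows "tower_eq n (slice X k) Z f"
  using assms
proof (induction n arbitrary: X Z \<pi> f)
  case 0
  note R = "0.prems"(3) and f = "0.prems"(4) and fe = "0.prems"(5)[of "[]", simplified]
  have X: "nfold_cat (Suc 0) X" using "0.prems"(1) by simp
  note S = nfold_cat_segal_bij[OF X "0.prems"(2), of "[]", simplified]
  have fl: "f [] x \<in> lev Z []" if "x \<in> lev X [k]" for x using msmap_lev[OF f, of "[]" x] that by simp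
  have "bij_betw (f []) (lev X [k]) (lev Z [])"
    unfolding bij_betw_def
  proof (intro conjI inj_onI equalityI subsetI)
    fix x y assume xy: "x \<in> lev X [k]" "y \<in> lev X [k]" "f [] x = f [] y"
    show "x = y"
    proof (rule segal_bijD1[OF S xy(1,2)])
      show "edge X k j [] x = edge X k j [] y" if "j < k" for j
        using fe[OF xy(1) that] fe[OF xy(2) that] xy(3) by simp
    qed
  next
    fix z assume z: "z \<in> lev Z []"
    \<comment> \<open>Without further directions \<open>gamma\<close> is the identity, so
      compatibility over X_0^d is compatibility over X_0 and the strict Segal condition
      applies.\<close>
    have p: "segal_pred 0 X k [] (\<lambda>j. \<pi> j [] z)" using rep_sound[OF R _ z] by simp
    obtain x where x: "x \<in> lev X [k]" "\<And>j. j < k \<Longrightarrow> edge X k j [] x = \<pi> j [] z"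
    proof (rule segal_bijD2[OF S, of "\<lambda>j. \<pi> j [] z"])
      show "\<pi> j [] z \<in> lev X [1]" if "j < k" for j using rep_lev[OF R that _ z] by simp
      show "tgt X [] (\<pi> j [] z) = src X [] (\<pi> (Suc j) [] z)" if "Suc j < k" for j
        using p that by (simp add: segal_pred_def dend_def)
    qed auto
    have "z = f [] x"
      by (rule rep_inj[OF R _ z fl[OF x(1)]]) (use fe[OF x(1)] x(2) in auto)
    then show "z \<in> f [] ` lev X [k]" using x(1) by blast
  qed (use fl in auto)
  then show ?case
    using rep_msset[OF R] f msset_slice[OF nfold_cat_msset[OF X]] by (simp add: msiso_def)
next
  case (Suc n)
  note T = Suc.prems(1) and k = Suc.prems(2) and R = Suc.prems(3) and f = Suc.prems(4) and fe = Suc.prems(5)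
  have X: "nfold_cat (Suc (Suc n)) X" using T by simp
  note M = nfold_cat_msset[OF X]
  note T1 = tower_slice[OF T, of 1] and Tk = tower_slice[OF T, of k]
  note X1 = tower_nfold_cat[OF T1] and Xk = tower_nfold_cat[OF Tk]
  note TZ = tower_represents[OF T1 R]
  note Z = tower_nfold_cat[OF TZ]
  have ff: "fully_faithful (cat_of (slices (slice X k) ks)) (cat_of (slices Z ks)) (ftr_of (\<lambda>s. f (ks @ s)))"
    (is "fully_faithful ?C ?D ?F") if ks: "length ks = n" for ks
  proof (rule fully_faithfulI)
    let ?B = "cat_of (slices X (0 # ks))"
    have ks0: "length (ks @ [0]) = Suc n" and ks1: "length (ks @ [Suc 0]) = Suc n" using ks by auto
    note S0 = nfold_cat_segal_bij[OF X k ks0] and S1 = nfold_cat_segal_bij[OF X k ks1]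
    have d: "mid ks @ [[e]] \<in> mhom (ks @ [0]) (ks @ [Suc 0])" if "e \<le> 1" for e
      using that by (intro mhom_append) (auto simp: vertex_in)
    show "h = h'" if h: "in_hom ?C h x y" "in_hom ?C h' x y" "far ?F h = far ?F h'" for x y h h'
    proof (rule segal_bijD1[OF S1])
      have hl: "h \<in> lev X (k # ks @ [Suc 0])" "h' \<in> lev X (k # ks @ [Suc 0])" using h by auto
      show "edge X k j (ks @ [Suc 0]) h = edge X k j (ks @ [Suc 0]) h'" if "j < k" for j
        using fe[OF ks1 hl(1) that] fe[OF ks1 hl(2) that] h(3) by simp
    qed (use h in auto)
    fix x y g assume xy: "x \<in> Obj ?C" "y \<in> Obj ?C" and g: "in_hom ?D g (fob ?F x) (fob ?F y)"
    have x: "x \<in> lev X (k # ks @ [0])" and y: "y \<in> lev X (k # ks @ [0])" using xy by auto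
    have gl: "g \<in> lev Z (ks @ [Suc 0])" using g by simp
    define G where "G j = \<pi> j (ks @ [Suc 0]) g" for j
    have G: "G j \<in> lev X (1 # ks @ [Suc 0])" if "j < k" for j
      using rep_lev[OF R that ks1 gl] by (simp add: G_def)
    have Gd: "act X (1 # ks @ [0]) (1 # ks @ [Suc 0]) (did 1 # mid ks @ [[0]]) (G j) = edge X k j (ks @ [0]) x"
      and Gc: "act X (1 # ks @ [0]) (1 # ks @ [Suc 0]) (did 1 # mid ks @ [[Suc 0]]) (G j) = edge X k j (ks @ [0]) y"
      if "j < k" for j
      using rep_face[OF R ks that gl, of 0] rep_face[OF R ks that gl, of 1] g
        fe[OF ks0 x that] fe[OF ks0 y that] by (simp_all add: G_def)
    \<comment> \<open>The families over \<open>X\<^sub>0\<^sup>d\<close> already lie over \<open>X\<^sub>0\<close>, since parallel arrows of \<open>X\<^sub>0\<close> agree.\<close>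
    have match: "tgt X (ks @ [Suc 0]) (G j) = src X (ks @ [Suc 0]) (G (Suc j))" if j: "Suc j < k" for j
    proof (rule cat_hd_thin)
      show "cat_hd ?B" using T ks by simp
      have j': "j < k" using j by simp
      have v: "[e] \<in> dhom 0 1" if "e \<le> 1" for e using that by (auto intro: vertex_in)
      have dom: "dom ?B (simp_map X 0 1 [e] (ks @ [Suc 0]) (G i)) = simp_map X 0 1 [e] (ks @ [0]) (edge X k i (ks @ [0]) x)"
        and cod: "cod ?B (simp_map X 0 1 [e] (ks @ [Suc 0]) (G i)) = simp_map X 0 1 [e] (ks @ [0]) (edge X k i (ks @ [0]) y)"
        if "e \<le> 1" "i < k" for e i
        using simp_map_act[OF M v[OF that(1)] G[OF that(2)] ks1 d[of 0]] Gd[OF that(2)]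
          simp_map_act[OF M v[OF that(1)] G[OF that(2)] ks1 d[of 1]] Gc[OF that(2)]
        by simp_all
      show "in_hom ?B (tgt X (ks @ [Suc 0]) (G j)) (tgt X (ks @ [0]) (edge X k j (ks @ [0]) x))
          (tgt X (ks @ [0]) (edge X k j (ks @ [0]) y))"
        using simp_map_lev[OF M v[of 1] G[OF j'] ks1] dom[OF _ j', of 1] cod[OF _ j', of 1] by simp
      show "in_hom ?B (src X (ks @ [Suc 0]) (G (Suc j))) (tgt X (ks @ [0]) (edge X k j (ks @ [0]) x))
          (tgt X (ks @ [0]) (edge X k j (ks @ [0]) y))"
        using simp_map_lev[OF M v[of 0] G[OF j] ks1] dom[OF _ j, of 0] cod[OF _ j, of 0]
          edge_compatible[OF M x ks0 j] edge_compatible[OF M y ks0 j] by simp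
    qed
    obtain h where h: "h \<in> lev X (k # ks @ [Suc 0])" "\<And>j. j < k \<Longrightarrow> edge X k j (ks @ [Suc 0]) h = G j"
      using S1[unfolded segal_bij_def, THEN conjunct2, rule_format, of G, OF G match] by blast
    have e: "[j, Suc j] \<in> dhom 1 k" if "j < k" for j using that by (auto intro: edge_in)
    have lh: "act X (k # ks @ [0]) (k # ks @ [Suc 0]) (did k # mid ks @ [[i]]) h \<in> lev X (k # ks @ [0])" if "i \<le> 1" for i
      using msset_act[OF M, of "did k # mid ks @ [[i]]" "k # ks @ [0]" "k # ks @ [Suc 0]" h] d[OF that] h(1) ks by simp
    \<comment> \<open>The filler has the right ends because in last degree 0, too, a
      \<open>k\<close>-simplex is determined by its edges.\<close>
    have "act X (k # ks @ [0]) (k # ks @ [Suc 0]) (did k # mid ks @ [[0]]) h = x"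
      by (rule segal_bijD1[OF S0 lh x])
        (use simp_map_act[OF M e h(1) ks1 d[of 0]] h(2) Gd in auto)
    moreover have "act X (k # ks @ [0]) (k # ks @ [Suc 0]) (did k # mid ks @ [[Suc 0]]) h = y"
      by (rule segal_bijD1[OF S0 lh y])
        (use simp_map_act[OF M e h(1) ks1 d[of 1]] h(2) Gc in auto)
    moreover have "f (ks @ [Suc 0]) h = g"
      by (rule rep_inj[OF R ks1 _ gl])
        (use msmap_lev[OF f ks1, of h] fe[OF ks1 h(1)] h G_def in auto)
    ultimately show "\<exists>h. in_hom ?C h x y \<and> far ?F h = g" using h(1) by (intro exI[of _ h]) simp
  qed
  have "tower_eq n (slice (pn X) k) (pn Z) (pn_map Z f)"
  proof (rule Suc.IH[OF _ k])
    show "tower False (Suc n) (pn X)" using T by simp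
    show "represents n k (slice (pn X) 1) (segal_pred n (pn X) k) (pn Z) (\<lambda>i. pn_map (slice X 1) (\<pi> i))"
      unfolding pn_slices[symmetric]
      by (rule represents_pn[OF X1 R]) (rule segal_pred_pn[OF X], auto simp: pn_slices)
    show "msmap n (slice (pn X) k) (pn Z) (pn_map Z f)"
      using msmap_pn[OF Xk Z f] unfolding pn_slices .
    fix ks x j assume ks: "length ks = n" and x: "x \<in> lev (pn X) (k # ks)" and j: "j < k"
    have x': "x \<in> lev X (k # ks @ [0])" using pn_lev_iff[OF X, of "k # ks" x] x ks by simp
    have "pn_map (slice X 1) (\<pi> j) ks (pn_map Z f ks x) =
        cls (cat_of (slices X (Suc 0 # ks))) (edge X k j (ks @ [0]) x)"
      using pn_map_pn_map[OF Z X1 f rep_msmap[OF R j] ks, of x] x' fe[OF _ x' j] ks by simp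
    then show "pn_map (slice X 1) (\<pi> j) ks (pn_map Z f ks x) = edge (pn X) k j ks x"
      by (simp add: simp_map_def pn_act)
  qed
  then show ?case
    using Tk TZ f ff by (simp add: pn_slices)
qed

text \<open>Full faithfulness passes from X_1 to the fibre, because an arrow of X_1 between objects
  over (a,b) has the values of its source in X_0^d and so lies over (a,b) as well. Arbitrary
  representing objects \<open>A\<close> and \<open>B\<close> are allowed for the induction along
  \<open>pn\<close>, as for Segal maps.\<close>

lemma tower_eq_hom:
  assumes "tower_eq (Suc n) X Y f" "a \<in> dset n (slice X 0)" "b \<in> dset n (slice X 0)"
    "represents n 1 (slice X 1) (hom_pred n X a b) A \<alpha>"
    "represents n 1 (slice Y 1) (hom_pred n Y (dmap n (slice Y 0) (\<lambda>ks. f (0 # ks)) a)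
       (dmap n (slice Y 0) (\<lambda>ks. f (0 # ks)) b)) B \<beta>"
    "msmap n A B g"
    "\<And>ks z. length ks = n \<Longrightarrow> z \<in> lev A ks \<Longrightarrow> \<beta> 0 ks (g ks z) = f (Suc 0 # ks) (\<alpha> 0 ks z)"
  shows "tower_eq n A B g"
  using assms
proof (induction n arbitrary: X Y f A \<alpha> B \<beta> g)
  case 0
  note RA = "0.prems"(4) and RB = "0.prems"(5) and g = "0.prems"(6) and comm = "0.prems"(7)[of "[]", simplified]
  have ff: "fully_faithful (cat_of X) (cat_of Y) (ftr_of f)" and f: "msmap (Suc 0) X Y f"
    and XY: "nfold_cat (Suc 0) X" "nfold_cat (Suc 0) Y"
    using "0.prems"(1) by auto
  note F = functor_ftr_of[OF XY f]
  \<comment> \<open>In dimension 1 the fibres are copies of hom-sets, and full faithfulness is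
    exactly the bijection between them.\<close>
  have ab: "a \<in> Obj (cat_of X)" "b \<in> Obj (cat_of X)" using "0.prems"(2,3) by auto
  have A: "in_hom (cat_of X) (\<alpha> 0 [] z) a b" if "z \<in> lev A []" for z
    using rep_sound[OF RA _ that] rep_lev[OF RA _ _ that, of 0]
    by (simp add: hom_pred_def dend_def simp_map_def)
  have B: "in_hom (cat_of Y) (\<beta> 0 [] z) (fob (ftr_of f) a) (fob (ftr_of f) b)" if "z \<in> lev B []" for z
    using rep_sound[OF RB _ that] rep_lev[OF RB _ _ that, of 0]
    by (simp add: hom_pred_def dend_def simp_map_def)
  have gl: "g [] z \<in> lev B []" if "z \<in> lev A []" for z using msmap_lev[OF g _ that] by simp
  have "bij_betw (g []) (lev A []) (lev B [])"
    unfolding bij_betw_def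
  proof (intro conjI inj_onI equalityI subsetI)
    fix z z' assume z: "z \<in> lev A []" "z' \<in> lev A []" "g [] z = g [] z'"
    have "\<alpha> 0 [] z = \<alpha> 0 [] z'"
      by (rule fully_faithful_inj[OF ff ab functor_far[OF F A] A A])
        (use z comm[OF z(1)] comm[OF z(2)] in auto)
    then show "z = z'" using rep_inj[OF RA _ z(1,2)] by simp
  next
    fix w assume w: "w \<in> lev B []"
    obtain h where h: "in_hom (cat_of X) h a b" "far (ftr_of f) h = \<beta> 0 [] w"
      by (rule fully_faithful_lift[OF ff ab B[OF w]])
    obtain z where z: "z \<in> lev A []" "\<alpha> 0 [] z = h"
      using rep_lift[OF RA, of "[]" "\<lambda>_. h"] h(1) by (auto simp: hom_pred_def dend_def simp_map_def)
    have "w = g [] z"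
      by (rule rep_inj[OF RB _ w gl[OF z(1)]]) (use comm[OF z(1)] h(2) z(2) in auto)
    then show "w \<in> g [] ` lev A []" using z(1) by blast
  qed (use gl in auto)
  then show ?case
    using rep_msset[OF RA] rep_msset[OF RB] g by (simp add: msiso_def)
next
  case (Suc n)
  note TE = Suc.prems(1) and RA = Suc.prems(4) and RB = Suc.prems(5) and g = Suc.prems(6) and comm = Suc.prems(7)
  have TX: "tower False (Suc (Suc n)) X" and TY: "tower False (Suc (Suc n)) Y" and f: "msmap (Suc (Suc n)) X Y f"
    using TE by auto
  note X = tower_nfold_cat[OF TX] and Y = tower_nfold_cat[OF TY]
  note TX1 = tower_slice[OF TX, of 1] and TY1 = tower_slice[OF TY, of 1]
  note X1 = tower_nfold_cat[OF TX1] and Y1 = tower_nfold_cat[OF TY1]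
  note TA = tower_represents[OF TX1 RA] and TB = tower_represents[OF TY1 RB]
  note A = tower_nfold_cat[OF TA] and B = tower_nfold_cat[OF TB]
  have ff: "fully_faithful (cat_of (slices A ks)) (cat_of (slices B ks)) (ftr_of (\<lambda>s. g (ks @ s)))"
    (is "fully_faithful ?C ?D ?G") if ks: "length ks = n" for ks
  proof (rule fully_faithfulI)
    let ?CX = "cat_of (slices X (Suc 0 # ks))" and ?CY = "cat_of (slices Y (Suc 0 # ks))"
    let ?F = "ftr_of (\<lambda>s. f (Suc 0 # ks @ s))"
    have ks0: "length (ks @ [0]) = Suc n" and ks1: "length (ks @ [Suc 0]) = Suc n" using ks by auto
    have "\<forall>ls. length ls = Suc n \<longrightarrow>
        fully_faithful (cat_of (slices X ls)) (cat_of (slices Y ls)) (ftr_of (\<lambda>s. f (ls @ s)))"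
      using TE by simp
    from this[rule_format, of "Suc 0 # ks"] have f1: "fully_faithful ?CX ?CY ?F" using ks by simp
    have F: "is_functor ?CX ?CY ?F" using functor_J_map[OF X Y f, of "Suc 0 # ks"] ks by simp
    have FA: "is_functor ?C ?CX (ftr_of (\<lambda>s. \<alpha> 0 (ks @ s)))"
      using functor_J_map[OF A X1 rep_msmap[OF RA] ks] by simp
    have FB: "is_functor ?D ?CY (ftr_of (\<lambda>s. \<beta> 0 (ks @ s)))"
      using functor_J_map[OF B Y1 rep_msmap[OF RB] ks] by simp
    show "h = h'" if h: "in_hom ?C h x y" "in_hom ?C h' x y" "far ?G h = far ?G h'" for x y h h'
    proof -
      note ah = functor_far[OF FA h(1)] and ah' = functor_far[OF FA h(2)]
      have hl: "h \<in> lev A (ks @ [Suc 0])" "h' \<in> lev A (ks @ [Suc 0])" using h by auto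
      have "\<alpha> 0 (ks @ [Suc 0]) h = \<alpha> 0 (ks @ [Suc 0]) h'"
        using fully_faithful_inj[OF f1 _ _ functor_far[OF F ah] ah ah'] cat_objs[OF category_J[OF X] ah]
          comm[OF ks1 hl(1)] comm[OF ks1 hl(2)] h(3) ks by simp
      then show ?thesis using rep_inj[OF RA ks1 hl] by simp
    qed
    fix x y w assume xy: "x \<in> Obj ?C" "y \<in> Obj ?C" and w: "in_hom ?D w (fob ?G x) (fob ?G y)"
    have x: "x \<in> lev A (ks @ [0])" and y: "y \<in> lev A (ks @ [0])" using xy by auto
    have wl: "w \<in> lev B (ks @ [Suc 0])" using w by simp
    have bw: "in_hom ?CY (\<beta> 0 (ks @ [Suc 0]) w) (fob ?F (\<alpha> 0 (ks @ [0]) x)) (fob ?F (\<alpha> 0 (ks @ [0]) y))"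
      using functor_far[OF FB w] comm[OF ks0 x] comm[OF ks0 y] by simp
    obtain h where h: "in_hom ?CX h (\<alpha> 0 (ks @ [0]) x) (\<alpha> 0 (ks @ [0]) y)" "far ?F h = \<beta> 0 (ks @ [Suc 0]) w"
      by (rule fully_faithful_lift[OF f1 _ _ bw]) (use rep_lev[OF RA _ ks0 x] rep_lev[OF RA _ ks0 y] in auto)
    obtain h' where h': "in_hom ?C h' x y" "\<alpha> 0 (ks @ [Suc 0]) h' = h"
      by (rule rep_lift_hom[OF RA ks x y, of "\<lambda>_. h"]) (use h(1) in auto)
    have h'l: "h' \<in> lev A (ks @ [Suc 0])" using h'(1) by simp
    have "g (ks @ [Suc 0]) h' = w"
      by (rule rep_inj[OF RB ks1 _ wl]) (use msmap_lev[OF g ks1 h'l] comm[OF ks1 h'l] h'(2) h(2) in auto)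
    then show "\<exists>h. in_hom ?C h x y \<and> far ?G h = w" using h'(1) by (intro exI[of _ h']) simp
  qed
  \<comment> \<open>Lets \<open>dmap\<close> for \<open>slice Y 0\<close> unfold into
    \<open>dmap\<close> for \<open>slice (pn Y) 0\<close>, so that the images of \<open>a\<close>
    and \<open>b\<close> stay the same along the recursion.\<close>
  have pn0: "pn_map (slice Y 0) (\<lambda>ks. f (0 # ks)) = (\<lambda>ks. pn_map Y f (0 # ks))"
    by (simp add: pn_map_def fun_eq_iff)
  have "tower_eq n (pn A) (pn B) (pn_map B g)"
  proof (rule Suc.IH)
    show "tower_eq (Suc n) (pn X) (pn Y) (pn_map Y f)" using TE by simp
    show "a \<in> dset n (slice (pn X) 0)" "b \<in> dset n (slice (pn X) 0)"
      using Suc.prems(2,3) by (simp_all add: pn_slices)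
    show "represents n 1 (slice (pn X) 1) (hom_pred n (pn X) a b) (pn A) (\<lambda>i. pn_map (slice X 1) (\<alpha> i))"
      unfolding pn_slices[symmetric]
      by (rule represents_pn[OF X1 RA]) (rule hom_pred_pn[OF X], auto simp: pn_slices)
    show "represents n 1 (slice (pn Y) 1) (hom_pred n (pn Y)
        (dmap n (slice (pn Y) 0) (\<lambda>ks. pn_map Y f (0 # ks)) a)
        (dmap n (slice (pn Y) 0) (\<lambda>ks. pn_map Y f (0 # ks)) b)) (pn B) (\<lambda>i. pn_map (slice Y 1) (\<beta> i))"
      unfolding pn_slices[symmetric] pn0[symmetric] dmap.simps(2)[symmetric]
      by (rule represents_pn[OF Y1 RB]) (rule hom_pred_pn[OF Y], auto simp: pn_slices)
    show "msmap n (pn A) (pn B) (pn_map B g)" by (rule msmap_pn[OF A B g])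
    fix ks z assume ks: "length ks = n" and z: "z \<in> lev (pn A) ks"
    have z': "z \<in> lev A (ks @ [0])" using pn_lev_iff[OF A ks] z by simp
    have f1: "msmap (Suc n) (slice X 1) (slice Y 1) (\<lambda>ks. f (Suc 0 # ks))" using msmap_slice[OF f, of 1] by simp
    show "pn_map (slice Y 1) (\<beta> 0) ks (pn_map B g ks z) =
        pn_map Y f (Suc 0 # ks) (pn_map (slice X 1) (\<alpha> 0) ks z)"
      using pn_map_pn_map[OF B Y1 g rep_msmap[OF RB] ks z', of 0]
        pn_map_pn_map[OF X1 Y1 rep_msmap[OF RA] f1 ks z', of 0] comm[OF _ z'] ks
      by (simp add: pn_map_def)
  qed
  then show ?case
    using TA TB g ff by simp
qed


section \<open>Weak globularity\<close>

text \<open>The recursion of \<open>hd_cat\<close> also descends through slices; it meets the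
  category at \<open>s # ks\<close> inside the slice at \<open>s\<close>, so the conditions on
  slices collapse to one condition for all indices.\<close>

lemma hd_cat_iff_tower: "hd_cat n X \<longleftrightarrow> tower True n X"
proof (induction n X rule: hd_cat.induct)
  case (1 X)
  then show ?case by simp
next
  case (2 X)
  then show ?case using msset_pn[of 0 X] by auto
next
  case (3 m X)
  show ?case
  proof
    assume "hd_cat (Suc (Suc m)) X"
    then have X: "msset (Suc (Suc m)) X" "segal (Suc (Suc m)) X" "tower True (Suc m) (pn X)"
      and s: "tower True (Suc m) (slice X s)" for s
      using 3 by auto
    have "cat_hd (cat_of (slices X ks))" if "length ks = Suc m" for ks
      using that s by (cases ks) auto
    then show "tower True (Suc (Suc m)) X" using X s by simp
  next
    assume T: "tower True (Suc (Suc m)) X"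
    then show "hd_cat (Suc (Suc m)) X" using 3 tower_slice[OF T] by simp
  qed
qed

lemma wg_tower: "wg n X \<Longrightarrow> tower False n X"
proof (induction n arbitrary: X)
  case (Suc n)
  show ?case
  proof (cases n)
    case 0
    then show ?thesis using Suc.prems msset_pn[of 0 X] by simp
  next
    case (Suc m)
    note wg = \<open>wg (Suc n) X\<close>[unfolded Suc wg.simps]
    have s: "tower False (Suc m) (slice X s)" and p: "tower False (Suc m) (pn X)" for s
      using Suc.IH[unfolded Suc] wg by blast+
    have z: "tower True (Suc m) (slice X 0)" using wg hd_cat_iff_tower by blast
    have "cat_hd (cat_of (slices X ks))" if "length ks = Suc m" "0 \<in> set ks" for ks
    proof -
      obtain s ks' where ks: "ks = s # ks'" "length ks' = m" using \<open>length ks = Suc m\<close> by (cases ks) auto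
      show ?thesis
      \<comment> \<open>An entry 0 in front is covered by X_0 being homotopically discrete, one
        further back by the tower of the slice at \<open>s\<close>.\<close>
      proof (cases "s = 0")
        case True
        then show ?thesis using z ks by simp
      next
        case False
        then show ?thesis using s[of s] ks that(2) by simp
      qed
    qed
    then show ?thesis using wg s p unfolding Suc by simp
  qed
qed simp

text \<open>Edges that match over X_0 still match after \<open>gamma\<close>, that is, over
  X_0^d.\<close>

lemma msmap_segal_map:
  fixes X :: "'a elt mss"
  assumes M: "msset (Suc n) X"
  shows "msmap n (slice X k) (ind_fprod (Suc n) X k) (segal_map X k)"
proof -
  have "segal_map X k ks x \<in> lev (ind_fprod (Suc n) X k) ks" if "length ks = n" "x \<in> lev X (k # ks)" for ks x
    unfolding ind_fprod_def fprod_def segal_map_def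
    using edge_lev[OF M that(2,1)] edge_compatible[OF M that(2,1)]
    by (auto simp: chain_def dsrc_def dtgt_def intro!: imageI)
  then show ?thesis
    unfolding msmap_def using simp_map_act[OF M edge_in]
    by (auto simp: segal_map_def ind_fprod_def fprod_def)
qed

text \<open>Surjectivity on isomorphism classes is essential surjectivity.\<close>

lemma equivalence_if_tower_eq:
  assumes "tower_eq (Suc 0) X Y f"
  shows "equivalence (cat_of X) (cat_of Y) (ftr_of f)"
proof -
  have X: "nfold_cat (Suc 0) X" and Y: "nfold_cat (Suc 0) Y" and f: "msmap (Suc 0) X Y f"
    and ff: "fully_faithful (cat_of X) (cat_of Y) (ftr_of f)"
    and p: "bij_betw (pn_map Y f []) (lev (pn X) []) (lev (pn Y) [])"
    using assms by (auto simp: msiso_def)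
  note CX = category_cat_of[OF X] and CY = category_cat_of[OF Y]
  show ?thesis
  proof (rule equivalence_if_fully_faithful[OF CX CY functor_ftr_of[OF X Y f] ff])
    fix y assume y: "y \<in> Obj (cat_of Y)"
    then have "cls (cat_of Y) y \<in> lev (pn Y) []" by (simp add: pn_lev p_cat_def)
    then obtain x where x: "x \<in> lev (pn X) []" "pn_map Y f [] x = cls (cat_of Y) y"
      using p unfolding bij_betw_def by force
    have xo: "x \<in> Obj (cat_of X)" using pn_lev_iff[OF X, of "[]" x] x by simp
    have "f [0] x \<in> Obj (cat_of Y)" using msmap_lev[OF f, of "[0]" x] xo by simp
    then have "iso_objs (cat_of Y) (f [0] x) y"
      using x(2) y cls_eq_iff[OF CY, of "f [0] x" y] by (simp add: pn_map_def)
    then show "\<exists>x\<in>Obj (cat_of X). iso_objs (cat_of Y) (fob (ftr_of f) x) y"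
      using xo by (intro bexI[of _ x]) auto
  qed
qed

text \<open>The two statements need each other: \<open>wg\<close> contains \<open>weq\<close> of the
  induced Segal maps one dimension below, and \<open>weq\<close> contains \<open>wg\<close> of
  source and target.\<close>

lemma tower_wg_weq:
  "(\<forall>X :: 'a elt mss. tower False n X \<longrightarrow> wg n X) \<and>
    (\<forall>X Y (f :: nat list \<Rightarrow> 'a elt \<Rightarrow> 'a elt). tower_eq n X Y f \<longrightarrow> weq n X Y f)"
proof (induction n)
  case 0
  then show ?case by simp
next
  case (Suc n)
  show ?case
  proof (cases n)
    case 0
    have wg: "wg (Suc 0) X" if "tower False (Suc 0) X" for X :: "'a elt mss" using that by simp
    moreover have "weq (Suc 0) X Y f" if "tower_eq (Suc 0) X Y f" for X Y and f :: "nat list \<Rightarrow> 'a elt \<Rightarrow> 'a elt"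
      using that wg equivalence_if_tower_eq[OF that] by simp
    ultimately show ?thesis using 0 by blast
  next
    case (Suc m)
    have IHwg: "wg (Suc m) X" if "tower False (Suc m) X" for X :: "'a elt mss"
      using Suc.IH that unfolding Suc by blast
    have IHweq: "weq (Suc m) X Y f" if "tower_eq (Suc m) X Y f" for X Y and f :: "nat list \<Rightarrow> 'a elt \<Rightarrow> 'a elt"
      using Suc.IH that unfolding Suc by blast
    have wg: "wg (Suc (Suc m)) X" if T: "tower False (Suc (Suc m)) X" for X :: "'a elt mss"
    proof -
      note X = tower_nfold_cat[OF T]
      note M = nfold_cat_msset[OF X]
      have "weq (Suc m) (slice X k) (ind_fprod (Suc (Suc m)) X k) (segal_map X k)" if k: "k \<ge> 2" for k
        by (rule IHweq[OF tower_eq_segal[OF T k represents_ind_fprod[OF T] msmap_segal_map[OF M]]])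
          (simp add: segal_map_def)
      then show ?thesis
        using M X T IHwg[OF tower_slice[OF T]] tower_slice_0[OF T, folded hd_cat_iff_tower] IHwg[of "pn X"]
        by simp
    qed
    have "weq (Suc (Suc m)) X Y f" if TE: "tower_eq (Suc (Suc m)) X Y f"
      for X Y and f :: "nat list \<Rightarrow> 'a elt \<Rightarrow> 'a elt"
    proof -
      have TX: "tower False (Suc (Suc m)) X" and TY: "tower False (Suc (Suc m)) Y"
        and f: "msmap (Suc (Suc m)) X Y f" and p: "tower_eq (Suc m) (pn X) (pn Y) (pn_map Y f)"
        using TE by auto
      let ?d = "dmap (Suc m) (slice Y 0) (\<lambda>ks. f (0 # ks))"
      have hom: "weq (Suc m) (hom_fib (Suc (Suc m)) X a b) (hom_fib (Suc (Suc m)) Y (?d a) (?d b)) (\<lambda>ks. f (1 # ks))"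
        if ab: "a \<in> dset (Suc m) (slice X 0)" "b \<in> dset (Suc m) (slice X 0)" for a b
      proof (rule IHweq[OF tower_eq_hom[OF TE ab represents_hom_fib[OF TX] represents_hom_fib[OF TY]]])
        have f1: "msmap (Suc m) (slice X 1) (slice Y 1) (\<lambda>ks. f (1 # ks))" by (rule msmap_slice[OF f])
        show "msmap (Suc m) (hom_fib (Suc (Suc m)) X a b) (hom_fib (Suc (Suc m)) Y (?d a) (?d b)) (\<lambda>ks. f (1 # ks))"
          unfolding msmap_def
        proof (intro conjI allI ballI impI image_subsetI)
          fix ks x assume ks: "length ks = Suc m" and x: "x \<in> lev (hom_fib (Suc (Suc m)) X a b) ks"
          have x': "x \<in> lev X (Suc 0 # ks)" "dend 0 (Suc m) X ks x = a" "dend 1 (Suc m) X ks x = b"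
            using x unfolding hom_fib_def dsrc_dend dtgt_dend by auto
          \<comment> \<open>\<open>f\<close> carries the fibre over (a,b) to the fibre over the
            images under \<open>dmap\<close> because \<open>gamma\<close> is natural.\<close>
          show "f (1 # ks) x \<in> lev (hom_fib (Suc (Suc m)) Y (?d a) (?d b)) ks"
            using dend_map[OF TX TY f _ ks x'(1), of 0] dend_map[OF TX TY f _ ks x'(1), of 1]
              msmap_lev[OF f1 ks, of x] x'
            unfolding hom_fib_def dsrc_dend dtgt_dend by simp
        next
          fix js ks \<phi> x assume ks: "length ks = Suc m" and x: "x \<in> lev (hom_fib (Suc (Suc m)) X a b) ks"
            and \<phi>: "\<phi> \<in> mhom js ks"
          then show "f (1 # js) (act (hom_fib (Suc (Suc m)) X a b) js ks \<phi> x) =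
              act (hom_fib (Suc (Suc m)) Y (?d a) (?d b)) js ks \<phi> (f (1 # ks) x)"
            using msmap_act[OF f1 \<phi> ks, of x] by (simp add: hom_fib_def)
        qed
      qed simp
      show ?thesis
        unfolding weq.simps using wg[OF TX] wg[OF TY] f hom IHweq[OF p] by blast
    qed
    then show ?thesis using wg unfolding Suc by blast
  qed
qed

lemma wg_iff_tower: "wg n X \<longleftrightarrow> tower False n X"
  using wg_tower tower_wg_weq by blast

section \<open>Transport along equivalences of categories\<close>

lemma nat_iso_iso_objs: "nat_iso C D F G \<eta> \<Longrightarrow> x \<in> Obj C \<Longrightarrow> iso_objs D (fob F x) (fob G x)"
  unfolding nat_iso_def iso_objs_def by blast

lemma discrete_cat_hd:
  assumes "discrete_cat C"
  shows "cat_hd C"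
proof -
  have C: "category C" and d: "\<forall>f\<in>Arr C. f = idn C (dom C f)"
    using assms unfolding discrete_cat_def by blast+
  have "iso_arr C f" if f: "f \<in> Arr C" for f
  proof -
    have "iso_arr C (idn C (dom C f))"
      by (rule inv_pair_iso_arr[OF inv_pair_refl[OF C]]) (use cat_objs[OF C, of f] f in blast)
    then show ?thesis by (subst bspec[OF d f])
  qed
  moreover have "f = g" if "f \<in> Arr C" "g \<in> Arr C" "dom C f = dom C g" for f g
    using bspec[OF d that(1)] bspec[OF d that(2)] that(3) by (metis (no_types))
  ultimately show ?thesis using C unfolding cat_hd_def by blast
qed

lemma equivalence_reflects_iso:
  assumes C: "category C" and D: "category D" and E: "equivalence C D F"
    and xy: "x \<in> Obj C" "y \<in> Obj C" "iso_objs D (fob F x) (fob F y)"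
  shows "iso_objs C x y"
proof -
  obtain G \<eta> where G: "is_functor D C G" and \<eta>: "nat_iso C C id_ftr (cmp_ftr G F) \<eta>"
    using E unfolding equivalence_def by blast
  have "iso_objs C z (fob G (fob F z))" if "z \<in> Obj C" for z
    using nat_iso_iso_objs[OF \<eta> that] by (simp add: id_ftr_def cmp_ftr_def)
  note c = this
  show ?thesis
    by (rule iso_objs_trans[OF C c[OF xy(1)] iso_objs_trans[OF C functor_iso_objs[OF D G xy(3)]
          iso_objs_sym[OF c[OF xy(2)]]]])
qed

lemma equivalence_ess_surj:
  assumes E: "equivalence C D F" and y: "y \<in> Obj D"
  shows "\<exists>x\<in>Obj C. iso_objs D (fob F x) y"
proof -
  obtain G \<epsilon> where G: "is_functor D C G" and \<epsilon>: "nat_iso D D (cmp_ftr F G) id_ftr \<epsilon>"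
    using E unfolding equivalence_def by blast
  show ?thesis
    using nat_iso_iso_objs[OF \<epsilon> y] functor_fob[OF G y] by (auto simp: id_ftr_def cmp_ftr_def)
qed

text \<open>Parallel arrows have equal images under \<open>F\<close>, hence under \<open>G\<close>
  after \<open>F\<close>; naturality of the unit, which is invertible, brings the equality back to
  \<open>C\<close>.\<close>

lemma equivalence_cat_hd:
  assumes C: "category C" and D: "cat_hd D" and E: "equivalence C D F"
  shows "cat_hd C"
proof -
  have F: "is_functor C D F" using E unfolding equivalence_def by blast
  obtain G \<eta> where G: "is_functor D C G" and \<eta>: "nat_iso C C id_ftr (cmp_ftr G F) \<eta>"
    using E unfolding equivalence_def by blast
  have \<eta>x: "\<exists>\<eta>'. inv_pair C (\<eta> x) \<eta>' x (fob G (fob F x))" if "x \<in> Obj C" for x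
    using \<eta> that unfolding nat_iso_def iso_arr_iff by (simp add: id_ftr_def cmp_ftr_def) metis
  have thin: "f = g" if f: "in_hom C f x y" and g: "in_hom C g x y" for f g x y
  proof -
    obtain \<eta>' where \<eta>': "inv_pair C (\<eta> y) \<eta>' y (fob G (fob F y))" using \<eta>x cat_objs[OF C f] by blast
    have "far F f = far F g" by (rule cat_hd_thin[OF D functor_far[OF F f] functor_far[OF F g]])
    moreover have "cmp C (\<eta> y) h = cmp C (far G (far F h)) (\<eta> x)" if "in_hom C h x y" for h
      using \<eta> that unfolding nat_iso_def by (auto simp: id_ftr_def cmp_ftr_def)
    ultimately have "cmp C (\<eta> y) f = cmp C (\<eta> y) g" using f g by presburger
    then show ?thesis
      using inv_pair_cancel[OF C \<eta>' f] inv_pair_cancel[OF C \<eta>' g] by presburger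
  qed
  have iso: "iso_arr C f" if f: "in_hom C f x y" for f x y
  proof -
    have o: "x \<in> Obj C" "y \<in> Obj C" using cat_objs[OF C f] by auto
    obtain h where "inv_pair D (far F f) h (fob F x) (fob F y)"
      using cat_hd_inverse[OF D functor_far[OF F f]] by blast
    then have h: "in_hom C (far G h) (fob G (fob F y)) (fob G (fob F x))"
      using functor_far[OF G] by (simp add: inv_pair_def)
    obtain u where u: "inv_pair C (\<eta> x) u x (fob G (fob F x))" using \<eta>x o by blast
    obtain v where v: "inv_pair C (\<eta> y) v y (fob G (fob F y))" using \<eta>x o by blast
    have hu: "in_hom C u (fob G (fob F x)) x" and hv: "in_hom C (\<eta> y) y (fob G (fob F y))"
      using u v by (auto simp: inv_pair_def)
    \<comment> \<open>The inverse found in \<open>D\<close>, carried back by \<open>G\<close> and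
      conjugated with the unit. Its composites with \<open>f\<close> are endomorphisms, hence
      identities by thinness.\<close>
    define g where "g = cmp C u (cmp C (far G h) (\<eta> y))"
    have g: "in_hom C g y x" unfolding g_def by (rule cat_cmp[OF C cat_cmp[OF C hv h] hu])
    have "inv_pair C f g x y"
      unfolding inv_pair_def
      using f g thin[OF cat_cmp[OF C f g] cat_idn[OF C o(1)]] thin[OF cat_cmp[OF C g f] cat_idn[OF C o(2)]]
      by blast
    then show ?thesis by (rule inv_pair_iso_arr)
  qed
  have "\<forall>f\<in>Arr C. iso_arr C f" using iso by blast
  moreover have "\<forall>f\<in>Arr C. \<forall>g\<in>Arr C. dom C f = dom C g \<longrightarrow> cod C f = cod C g \<longrightarrow> f = g"
    using thin by (intro ballI impI) blast
  ultimately show ?thesis using C unfolding cat_hd_def by blast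
qed

text \<open>With one projection and a predicate that is always true, \<open>represents\<close>
  expresses an isomorphism. Natural isomorphisms become equalities of classes, which is why their
  mere existence suffices; bijectivity holds since an equivalence reflects isomorphism and is
  essentially surjective.\<close>

lemma represents_pn_levelwise_equivalence:
  fixes H :: "('b elt, 'm) ps_fun" and L :: "'a elt mss"
  assumes H: "pseudo_functor m H" and L: "nfold_cat (Suc m) L" and E: "levelwise_equivalence m (J L) H T"
  shows "represents m 1 (pbar H) (\<lambda>_ _. True) (pn L) (\<lambda>_ ks x. cls (dcat H ks) (fob (T ks) x))"
proof -
  have CH: "category (dcat H ks)" if "length ks = m" for ks
    using conjunct1[OF H[unfolded pseudo_functor_def]] that by blast
  have FH: "is_functor (dcat H ks) (dcat H js) (dftr H js ks \<phi>)" if "length ks = m" "\<phi> \<in> mhom js ks" for js ks \<phi>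
    using conjunct1[OF conjunct2[OF H[unfolded pseudo_functor_def]]] that by blast
  have T: "equivalence (cat_of (slices L ks)) (dcat H ks) (T ks)" if "length ks = m" for ks
    using E that unfolding levelwise_equivalence_def by simp
  then have FT: "is_functor (cat_of (slices L ks)) (dcat H ks) (T ks)" if "length ks = m" for ks
    using that unfolding equivalence_def by blast
  have lev: "lev (pbar H) ks = p_cat (dcat H ks)" and
    act: "act (pbar H) js ks \<phi> x = cls (dcat H js) (fob (dftr H js ks \<phi>) x)" for js ks \<phi> x
    by (simp_all add: pbar_def)
  have nat: "iso_objs (dcat H js) (fob (dftr H js ks \<phi>) (fob (T ks) x))
      (fob (T js) (act L (js @ [0]) (ks @ [0]) (\<phi> @ [[0]]) x))"
    if a: "length ks = m" "\<phi> \<in> mhom js ks" "x \<in> lev L (ks @ [0])" for js ks \<phi> x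
  proof -
    obtain \<eta> where "nat_iso (dcat (J L) ks) (dcat H js) (cmp_ftr (dftr H js ks \<phi>) (T ks))
        (cmp_ftr (T js) (dftr (J L) js ks \<phi>)) \<eta>"
      using conjunct2[OF E[unfolded levelwise_equivalence_def]] a by blast
    from nat_iso_iso_objs[OF this, of x] show ?thesis using a by (simp add: cmp_ftr_def)
  qed
  show ?thesis
  proof (rule representsI)
    show "msset m (pn L)" by (rule msset_pn[OF L])
    show "msmap m (pn L) (pbar H) (\<lambda>ks x. cls (dcat H ks) (fob (T ks) x))"
      unfolding msmap_def
    proof (intro conjI allI ballI impI image_subsetI)
      fix ks x assume ks: "length ks = m" and x: "x \<in> lev (pn L) ks"
      have "fob (T ks) x \<in> Obj (dcat H ks)"
        using functor_fob[OF FT[OF ks], of x] x by (simp add: pn_lev_iff[OF L ks])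
      then show "cls (dcat H ks) (fob (T ks) x) \<in> lev (pbar H) ks" unfolding lev p_cat_def by blast
    next
      fix js ks \<phi> x assume ks: "length ks = m" and x: "x \<in> lev (pn L) ks" and \<phi>: "\<phi> \<in> mhom js ks"
      have js: "length js = m" using mhom_length[OF \<phi>] ks by simp
      have x': "x \<in> lev L (ks @ [0])" using x by (simp add: pn_lev_iff[OF L ks])
      let ?y = "act L (js @ [0]) (ks @ [0]) (\<phi> @ [[0]]) x"
      have y: "?y \<in> lev L (js @ [0])" using act_snoc_lev[OF nfold_cat_msset[OF L] \<phi> ks _ x'] by simp
      have Tx: "fob (T ks) x \<in> Obj (dcat H ks)" using functor_fob[OF FT[OF ks]] x' by simp
      have "cls (dcat H js) (fob (T js) (act (pn L) js ks \<phi> x)) = cls (dcat H js) (fob (T js) ?y)"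
        unfolding pn_act using functor_cls[OF category_J[OF L js] CH[OF js] FT[OF js]] y by simp
      also have "\<dots> = cls (dcat H js) (fob (dftr H js ks \<phi>) (fob (T ks) x))"
        by (rule cls_eq_iff[OF CH[OF js], THEN iffD2])
          (use iso_objs_sym[OF nat[OF ks \<phi> x']] iso_objs_Obj[OF CH[OF js] nat[OF ks \<phi> x']] in auto)
      also have "\<dots> = cls (dcat H js) (fob (dftr H js ks \<phi>) (cls (dcat H ks) (fob (T ks) x)))"
        by (rule functor_cls[OF CH[OF ks] CH[OF js] FH[OF ks \<phi>] Tx, symmetric])
      finally show "cls (dcat H js) (fob (T js) (act (pn L) js ks \<phi> x)) =
          act (pbar H) js ks \<phi> (cls (dcat H ks) (fob (T ks) x))"
        unfolding act .
    qed
    fix ks :: "nat list" assume ks: "length ks = m"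
    note CL = category_J[OF L ks]
    have Tl: "fob (T ks) x \<in> Obj (dcat H ks)" if "x \<in> lev L (ks @ [0])" for x
      using functor_fob[OF FT[OF ks]] that by simp
    show "z = z'" if z: "z \<in> lev (pn L) ks" "z' \<in> lev (pn L) ks"
      and eq: "\<forall>i<(1::nat). cls (dcat H ks) (fob (T ks) z) = cls (dcat H ks) (fob (T ks) z')" for z z'
    proof -
      have zz: "z \<in> lev L (ks @ [0])" "z' \<in> lev L (ks @ [0])"
        "cls (cat_of (slices L ks)) z = z" "cls (cat_of (slices L ks)) z' = z'"
        using z by (auto simp: pn_lev_iff[OF L ks])
      have "iso_objs (dcat H ks) (fob (T ks) z) (fob (T ks) z')"
        using eq cls_eq_iff[OF CH[OF ks] Tl[OF zz(1)] Tl[OF zz(2)]] by simp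
      then have "iso_objs (cat_of (slices L ks)) z z'"
        using equivalence_reflects_iso[OF CL CH[OF ks] T[OF ks]] zz by simp
      then show ?thesis using cls_eq_iff[OF CL, of z z'] zz by simp
    qed
    show "\<exists>z\<in>lev (pn L) ks. \<forall>i<1. cls (dcat H ks) (fob (T ks) z) = c i"
      if c: "\<forall>i<1. c i \<in> lev (pbar H) ks" for c :: "nat \<Rightarrow> 'b elt"
    proof -
      have c0: "c 0 \<in> Obj (dcat H ks)" "cls (dcat H ks) (c 0) = c 0"
        using c p_cat_iff[OF CH[OF ks]] by (auto simp: lev)
      obtain x where x: "x \<in> lev L (ks @ [0])" "iso_objs (dcat H ks) (fob (T ks) x) (c 0)"
        using equivalence_ess_surj[OF T[OF ks] c0(1)] by auto
      have "cls (dcat H ks) (fob (T ks) (cls (cat_of (slices L ks)) x)) = cls (dcat H ks) (fob (T ks) x)"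
        using functor_cls[OF CL CH[OF ks] FT[OF ks]] x(1) by simp
      also have "\<dots> = c 0" using cls_eq_iff[OF CH[OF ks] Tl[OF x(1)] c0(1)] x(2) c0(2) by simp
      finally show ?thesis using cls_lev_pn[OF L ks x(1)] by (intro bexI) auto
    qed
  qed simp_all
qed

theorem proposition4p3:
  fixes n :: nat
    and H :: "('b elt, 'm) ps_fun"
    and L :: "'a elt mss"
    and T :: "nat list \<Rightarrow> ('a elt, 'a elt, 'b elt, 'm) ftr"
  assumes "n \<ge> 2"
    and "segalic (n - 1) H"
    and "nfold_cat n L"
    and "levelwise_equivalence (n - 1) (J L) H T"
  shows "wg n L \<and>
    ((\<forall>ks. length ks = n - 1 \<longrightarrow> cat_hd (dcat H ks)) \<and> hd_cat (n - 1) (pbar H)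
       \<longrightarrow> hd_cat n L)"
proof -
  define m where "m = n - 1"
  have n: "n = Suc m" using assms(1) by (simp add: m_def)
  have S: "segalic m H" and L: "nfold_cat (Suc m) L" and E: "levelwise_equivalence m (J L) H T"
    using assms(2-4) n by simp_all
  have H: "pseudo_functor m H" using S unfolding segalic_def by blast
  have hd: "cat_hd (cat_of (slices L ks))" if "length ks = m" "cat_hd (dcat H ks)" for ks
    by (rule equivalence_cat_hd[OF category_J[OF L that(1)] that(2), of "T ks"])
      (use E that in \<open>simp add: levelwise_equivalence_def\<close>)
  have p: "tower h m (pbar H) \<Longrightarrow> tower h m (pn L)" for h
    by (rule tower_represents[OF _ represents_pn_levelwise_equivalence[OF H L E]])
  \<comment> \<open>An entry 0 at position \<open>i\<close> means \<open>ks[i := 0] = ks\<close>, so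
    the discreteness condition on \<open>H\<close> applies, and a discrete category is an
    equivalence relation.\<close>
  have disc: "cat_hd (dcat H ks)" if ks: "length ks = m" "0 \<in> set ks" for ks
  proof -
    obtain i where i: "i < m" "ks ! i = 0" using ks by (auto simp: in_set_conv_nth)
    then have "ks[i := 0] = ks" using list_update_id[of ks i] by simp
    moreover have "discrete_cat (dcat H (ks[i := 0]))"
      using ks(1) i(1) conjunct1[OF conjunct2[OF S[unfolded segalic_def]]] by blast
    ultimately show ?thesis using discrete_cat_hd by simp
  qed
  \<comment> \<open>Read as a tower, \<open>wg m (pbar H)\<close> can cross to \<open>pn L\<close>,
    whose elements have another type; \<open>wg\<close> is restored afterwards.\<close>
  have "tower False m (pn L)" using S p[of False] wg_iff_tower unfolding segalic_def by blast
  then have "tower False (Suc m) L" using L hd disc by simp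
  then have "wg n L" unfolding n wg_iff_tower .
  moreover have "hd_cat n L" if "\<forall>ks. length ks = m \<longrightarrow> cat_hd (dcat H ks)" "hd_cat m (pbar H)"
  proof -
    have "tower True (Suc m) L" using L hd p[of True] that by (simp add: hd_cat_iff_tower)
    then show ?thesis unfolding n hd_cat_iff_tower .
  qed
  ultimately show ?thesis by (simp add: m_def)
qed

end
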